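(* Let $1\le p<\infty$. Let $(X,d,\mu)$ be a complete doubling metric measure space that supports a $p$-Poincaré inequality, let $O\in X$, and assume that $X$ has the annular chain property at $O$. Then the following statements are equivalent: (I) $\mathcal R_p(O)<\infty$. (II) $\mathrm{Mod}_p(\Gamma^\infty)>0$. (III) For every $u\in\dot N^{1,p}(X)$ there exists an infinite curve $\gamma\in\Gamma^\infty$ such that $\lim_{t\to\infty}u(\gamma(t))$ exists (as a real number).
   Context: $(X,d,\mu)$ is a metric space with a Borel regular measure $\mu$; $B(x,r)$ is the ball with center $x$ and radius $r$, and $\tau B(x,r):=B(x,\tau r)$. $\mu$ is doubling if every ball has finite positive measure and there is $C\ge 1$ with $\mu(B(x,2r))\le C\mu(B(x,r))$ for all $x\in X$, $r>0$. Write $u_A=\frac1{\mu(A)}\int_A u\,d\mu$. For $j\in\mathbb N=\{0,1,2,\dots\}$ let $A_{2^j}(O)=B(O,2^{j+1})\setminus B(O,2^j)$ and set $$\mathcal R_p(O)=\sum_{j\in\mathbb N}(2^j)^{\frac p{p-1}}\mu(A_{2^j}(O))^{\frac1{1-p}}\ \text{ if }p>1,\qquad \mathcal R_1(O)=\sup_{j\in\mathbb N}2^j\mu(A_{2^j}(O))^{-1},$$ where negative powers of $0$ are $\infty$. Curves: a curve is a nonconstant continuous map from an interval into $X$; it is locally rectifiable if its restriction to every compact subinterval has finite length. $\int_\gamma\rho\,ds$ is the arc-length line integral (for locally rectifiable $\gamma$, the supremum over rectifiable subcurves). An infinite curve is a locally rectifiable curve $\gamma:[0,\infty)\to X$ whose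 image is not contained in any ball; $\Gamma^\infty$ is the collection of all infinite curves. Upper gradients: a Borel function $\rho:X\to[0,\infty]$ is an upper gradient of $u$ if $|u(x)-u(y)|\le\int_\gamma\rho\,ds$ for every rectifiable curve $\gamma$ connecting $x$ and $y$. $\dot N^{1,p}(X)$ is the collection of all locally integrable functions $u:X\to\mathbb R$ (defined pointwise) that have a $p$-integrable upper gradient. $p$-Poincaré inequality: every ball has finite positive measure and there are $C>0$, $\lambda\ge1$ such that $\frac1{\mu(B)}\int_B|u-u_B|\,d\mu\le Cr\left(\frac1{\mu(\lambda B)}\int_{\lambda B}\rho^p\,d\mu\right)^{1/p}$ for all balls $B=B(x,r)$ and all $u$ integrable on balls with upper gradient $\rho$. Modulus: for a family $\Gamma$ of curves, $\mathrm{Mod}_p(\Gamma)=\inf\int_X\rho^p\,d\mu$ over Borel $\rho:X\to[0,\infty]$ with $\int_\gamma\rho\,ds\ge1$ for every locally rectifiable $\gamma\in\Gamma$. Annular chain property: for $\lambda\ge1$, $X$ satisfies an annular $\lambda$-chain condition at $O$ if there are constants $c_1\ge1$, $c_2\ge1$, $\delta>0$ and $M<\infty$ such that for all $r>0$ and $x,y\in B(O,r)\setminus B(O,r/2)$ there are balls $B_1,\dots,B_k$ with: (1) $k\le M$; (2) $B_1=B(x,r/(\lambda c_1))$, $B_k=B(y,r/(\lambda c_1))$ and every $B_i$ has radius $r/(\lambda c_1)$; (3) $\lambda B_i\subset B(O,c_2r)\setminus B(O,r/c_2)$ for $1\le i\le k$; (4) for each $1\le i\le k-1$ there is a ball $D_i\subset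 B_i\cap B_{i+1}$ of radius $\delta r$. $X$ has the annular chain property at $O$ if it satisfies an annular $\lambda$-chain condition at $O$ for every $\lambda\ge1$ (the constants may depend on $\lambda$). *)

theory Defs
  imports "HOL-Analysis.Analysis"
begin

text \<open>
  Conventions. The measure \<open>M\<close> is given on the Borel sets (\<open>sets M = sets borel\<close> is a hypothesis of
  the theorem). A Borel regular outer measure is determined by its restriction to the Borel sets,
  every Borel measure arises as such a restriction, and when balls have finite measure the
  Caratheodory-measurable sets are exactly the sets of \<open>completion M\<close>. Hence integrals of arbitrary
  measurable functions are taken over \<open>completion M\<close>, those of Borel functions over \<open>M\<close>.

  All balls are open, and are given by a centre and a radius.
\<close>


section \<open>Extended non-negative powers\<close>

text \<open>Negative powers of \<open>0\<close> are \<open>\<infinity>\<close> and negative powers of \<open>\<infinity>\<close> are \<open>0\<close>; note that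
  \<^const>\<open>powr\<close> itself sends \<open>0\<close> to \<open>0\<close> for every exponent.\<close>

definition ennpowr :: "ennreal \<Rightarrow> real \<Rightarrow> ennreal" (infixr \<open>epowr\<close> 80) where
  "x epowr q =
    (if q = 0 then 1
     else if x = 0 then (if q < 0 then \<infinity> else 0)
     else if x = \<infinity> then (if q < 0 then 0 else \<infinity>)
     else ennreal (enn2real x powr q))"


section \<open>Doubling measures and the quantity \<open>R\<^sub>p\<close>\<close>

definition balls_finite_positive :: "'a::metric_space measure \<Rightarrow> bool" where
  "balls_finite_positive M \<longleftrightarrow>
    (\<forall>x. \<forall>r>0. 0 < emeasure M (ball x r) \<and> emeasure M (ball x r) < \<infinity>)"

definition doubling_measure :: "'a::metric_space measure \<Rightarrow> bool" where
  "doubling_measure M \<longleftrightarrow>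
    balls_finite_positive M \<and>
    (\<exists>C::real. C \<ge> 1 \<and>
      (\<forall>x. \<forall>r>0. emeasure M (ball x (2 * r)) \<le> ennreal C * emeasure M (ball x r)))"

definition dyadic_annulus :: "'a::metric_space \<Rightarrow> nat \<Rightarrow> 'a set" where
  "dyadic_annulus z j = ball z (2 ^ (j + 1)) - ball z (2 ^ j)"

definition Rp :: "real \<Rightarrow> 'a::metric_space measure \<Rightarrow> 'a \<Rightarrow> ennreal" where
  "Rp p M z =
    (if p = 1
     then (SUP j. ennreal (2 ^ j) * emeasure M (dyadic_annulus z j) epowr (-1))
     else (\<Sum>j. ennreal ((2 ^ j) powr (p / (p - 1)))
                * emeasure M (dyadic_annulus z j) epowr (1 / (1 - p))))"


section \<open>Curves and line integrals\<close>

text \<open>A curve is represented by its parameter interval together with a map on \<open>real\<close>, of which only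
  the values on that interval are relevant.\<close>

type_synonym 'a curve = "real set \<times> (real \<Rightarrow> 'a)"

definition is_curve :: "'a::metric_space curve \<Rightarrow> bool" where
  "is_curve = (\<lambda>(I, \<gamma>). is_interval I \<and> continuous_on I \<gamma> \<and> \<not> \<gamma> constant_on I)"

definition curve_length :: "real set \<Rightarrow> (real \<Rightarrow> 'a::metric_space) \<Rightarrow> ennreal" where
  "curve_length I \<gamma> =
    (SUP ts \<in> {ts. sorted ts \<and> set ts \<subseteq> I}.
       \<Sum>i<length ts - 1. ennreal (dist (\<gamma> (ts ! i)) (\<gamma> (ts ! Suc i))))"

definition locally_rectifiable :: "'a::metric_space curve \<Rightarrow> bool" where
  "locally_rectifiable = (\<lambda>(I, \<gamma>). is_curve (I, \<gamma>) \<and>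
    (\<forall>a b. {a..b} \<subseteq> I \<longrightarrow> curve_length {a..b} \<gamma> < \<infinity>))"

text \<open>The arc-length parametrization \<open>\<gamma>\<^sub>s\<close> of a rectifiable \<open>\<gamma>\<close> on \<open>{a..b}\<close> is determined by
  \<open>\<gamma>\<^sub>s (length of \<gamma> on {a..t}) = \<gamma> t\<close>; the choice of \<open>t\<close> is immaterial because \<open>\<gamma>\<close> is constant
  between any two parameters with the same length.\<close>

definition arclength_param :: "real \<Rightarrow> real \<Rightarrow> (real \<Rightarrow> 'a::metric_space) \<Rightarrow> real \<Rightarrow> 'a" where
  "arclength_param a b \<gamma> s = \<gamma> (SOME t. t \<in> {a..b} \<and> curve_length {a..t} \<gamma> = ennreal s)"

definition line_integral_on ::
    "real \<Rightarrow> real \<Rightarrow> (real \<Rightarrow> 'a::metric_space) \<Rightarrow> ('a \<Rightarrow> ennreal) \<Rightarrow> ennreal" where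
  "line_integral_on a b \<gamma> \<rho> =
    (\<integral>\<^sup>+ s \<in> {0..enn2real (curve_length {a..b} \<gamma>)}. \<rho> (arclength_param a b \<gamma> s) \<partial>lborel)"

text \<open>For a locally rectifiable curve: the supremum over its compact subcurves.\<close>

definition line_integral :: "'a::metric_space curve \<Rightarrow> ('a \<Rightarrow> ennreal) \<Rightarrow> ennreal" where
  "line_integral = (\<lambda>(I, \<gamma>) \<rho>.
    (SUP (a, b) \<in> {(a, b). a \<le> b \<and> {a..b} \<subseteq> I}. line_integral_on a b \<gamma> \<rho>))"

definition infinite_curves :: "'a::metric_space curve set" where
  "infinite_curves =
    {(I, \<gamma>). I = {0..} \<and> locally_rectifiable (I, \<gamma>) \<and> (\<forall>x r. \<not> \<gamma> ` I \<subseteq> ball x r)}"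

definition modulus :: "real \<Rightarrow> 'a::metric_space measure \<Rightarrow> 'a curve set \<Rightarrow> ennreal" where
  "modulus p M \<Gamma> =
    (INF \<rho> \<in> {\<rho>. \<rho> \<in> borel_measurable borel \<and>
                 (\<forall>\<gamma>\<in>\<Gamma>. locally_rectifiable \<gamma> \<longrightarrow> 1 \<le> line_integral \<gamma> \<rho>)}.
       \<integral>\<^sup>+ x. \<rho> x epowr p \<partial>M)"


section \<open>Upper gradients, the Dirichlet space and the Poincare inequality\<close>

text \<open>The condition is vacuous for constant curves, so these need not be admitted.\<close>

definition upper_gradient :: "('a::metric_space \<Rightarrow> ennreal) \<Rightarrow> ('a \<Rightarrow> real) \<Rightarrow> bool" where
  "upper_gradient \<rho> u \<longleftrightarrow>
    \<rho> \<in> borel_measurable borel \<and>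
    (\<forall>a b \<gamma>. is_curve ({a..b}, \<gamma>) \<and> curve_length {a..b} \<gamma> < \<infinity> \<longrightarrow>
       ennreal \<bar>u (\<gamma> a) - u (\<gamma> b)\<bar> \<le> line_integral_on a b \<gamma> \<rho>)"

definition locally_integrable :: "'a::metric_space measure \<Rightarrow> ('a \<Rightarrow> real) \<Rightarrow> bool" where
  "locally_integrable M u \<longleftrightarrow> (\<forall>x. \<exists>r>0. set_integrable (completion M) (ball x r) u)"

definition integrable_on_balls :: "'a::metric_space measure \<Rightarrow> ('a \<Rightarrow> real) \<Rightarrow> bool" where
  "integrable_on_balls M u \<longleftrightarrow> (\<forall>x. \<forall>r>0. set_integrable (completion M) (ball x r) u)"

definition dirichlet_space :: "real \<Rightarrow> 'a::metric_space measure \<Rightarrow> ('a \<Rightarrow> real) set" where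
  "dirichlet_space p M =
    {u. locally_integrable M u \<and>
        (\<exists>\<rho>. upper_gradient \<rho> u \<and> (\<integral>\<^sup>+ x. \<rho> x epowr p \<partial>M) < \<infinity>)}"

definition mean_on :: "'a::metric_space measure \<Rightarrow> 'a set \<Rightarrow> ('a \<Rightarrow> real) \<Rightarrow> real" where
  "mean_on M A u = (LINT x:A|completion M. u x) / measure M A"

definition poincare_inequality :: "real \<Rightarrow> 'a::metric_space measure \<Rightarrow> bool" where
  "poincare_inequality p M \<longleftrightarrow>
    balls_finite_positive M \<and>
    (\<exists>C>0. \<exists>\<tau>\<ge>1. \<forall>u \<rho>. integrable_on_balls M u \<and> upper_gradient \<rho> u \<longrightarrow>
      (\<forall>x. \<forall>r>0.
        ennreal (mean_on M (ball x r) (\<lambda>y. \<bar>u y - mean_on M (ball x r) u\<bar>))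
          \<le> ennreal (C * r)
             * ((\<integral>\<^sup>+ y \<in> ball x (\<tau> * r). \<rho> y epowr p \<partial>M)
                  / emeasure M (ball x (\<tau> * r))) epowr (1 / p)))"


section \<open>Annular chains\<close>

text \<open>The ball \<open>B\<^sub>i\<close> has centre \<open>z i\<close> and radius \<open>r / (l * c1)\<close>, so \<open>l B\<^sub>i = ball (z i) (l * (r / (l * c1)))\<close>.\<close>

definition annular_chain_condition :: "real \<Rightarrow> 'a::metric_space \<Rightarrow> bool" where
  "annular_chain_condition l w \<longleftrightarrow>
    (\<exists>c1\<ge>1. \<exists>c2\<ge>1. \<exists>\<delta>>0. \<exists>K::nat.
      \<forall>r>0. \<forall>x \<in> ball w r - ball w (r / 2). \<forall>y \<in> ball w r - ball w (r / 2).
        \<exists>(k::nat) z.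
          1 \<le> k \<and> k \<le> K \<and> z 1 = x \<and> z k = y \<and>
          (\<forall>i\<in>{1..k}. ball (z i) (l * (r / (l * c1))) \<subseteq> ball w (c2 * r) - ball w (r / c2)) \<and>
          (\<forall>i\<in>{1..<k}. \<exists>v. ball v (\<delta> * r)
               \<subseteq> ball (z i) (r / (l * c1)) \<inter> ball (z (i + 1)) (r / (l * c1))))"

definition annular_chain_property :: "'a::metric_space \<Rightarrow> bool" where
  "annular_chain_property w \<longleftrightarrow> (\<forall>l\<ge>1. annular_chain_condition l w)"

end

theory Submission
  imports Defs
begin

text \<open>
  The three statements are proved equivalent in a circle.

  \<^emph>\<open>Finite \<open>R\<^sub>p\<close> implies positive modulus.\<close> The Poincare inequality, telescoped along the annular chains
  through all dyadic scales, compares the mean value of a function on a fixed ball with its mean value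
  far away: the difference is at most a sum over \<open>j\<close> of \<open>2\<^sup>j \<mu>(A\<^sub>j)\<^sup>-\<^sup>1\<^sup>/\<^sup>p\<close> times the \<open>L\<^sup>p\<close>-norm of the upper
  gradient near the \<open>j\<close>-th annulus. The numbers \<open>2\<^sup>j \<mu>(A\<^sub>j)\<^sup>-\<^sup>1\<^sup>/\<^sup>p\<close> are in the dual of \<open>\<ell>\<^sup>p\<close> exactly if \<open>R\<^sub>p\<close> is
  finite, so a function that is one on the ball and zero far away has energy bounded below
  (\<open>capacity_lower_bound\<close>). If the modulus were zero, some admissible density would have tiny norm; it
  has continuous majorants \<open>g\<^sub>n\<close> of tiny norm (\<open>continuous_majorant_sequence\<close>). The capacity bound is
  applied to the cost, measured by \<open>g\<^sub>n\<close>, of reaching the complement of the ball of radius \<open>n\<close> by chains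
  of jumps of length at most \<open>1/(n+1)\<close>. This potential is continuous and has upper gradient \<open>g\<^sub>n\<close>. Hence
  there are cheap chains, and by an Arzela--Ascoli argument, closed balls being compact, they converge
  to an infinite curve that is too cheap for the density to be admissible
  (\<open>exists_cheap_infinite_curve\<close>). No existence of rectifiable curves has to be known in advance.

  \<^emph>\<open>Positive modulus implies limits.\<close> The infinite curves along which an \<open>L\<^sup>p\<close> density has infinite
  line integral form a family of modulus zero. So some infinite curve has finite line integral of the
  upper gradient of \<open>u\<close>, and \<open>u\<close> is Cauchy along it.

  \<^emph>\<open>Limits imply finite \<open>R\<^sub>p\<close>.\<close> If \<open>R\<^sub>p\<close> is infinite, then there are \<open>a\<^sub>j \<ge> 0\<close> with divergent sum for which
  the sum of \<open>(a\<^sub>j 2\<^sup>-\<^sup>j)\<^sup>p \<mu>(A\<^sub>j)\<close> converges, provided that all annuli have positive measure. A radial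
  function with slope \<open>a\<^sub>j 2\<^sup>-\<^sup>j\<close> on the annulus \<open>A\<^sub>j\<close> is unbounded with finite energy, and its sine
  oscillates along every infinite curve. A null annulus makes the space bounded, and then there is no
  infinite curve at all (\<open>exists_dirichlet_function_without_limits\<close>).
\<close>

section \<open>Length of curves\<close>

definition polygon_length :: "(real \<Rightarrow> 'a::metric_space) \<Rightarrow> real list \<Rightarrow> ennreal" where
  "polygon_length \<gamma> ts = (\<Sum>i<length ts - 1. ennreal (dist (\<gamma> (ts ! i)) (\<gamma> (ts ! Suc i))))"

lemma curve_length_eq:
  "curve_length I \<gamma> = (SUP ts \<in> {ts. sorted ts \<and> set ts \<subseteq> I}. polygon_length \<gamma> ts)"
  by (simp add: curve_length_def polygon_length_def)

lemma polygon_length_simps [simp]: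
  "polygon_length \<gamma> [] = 0"
  "polygon_length \<gamma> [x] = 0"
  "polygon_length \<gamma> (x # y # ts) = ennreal (dist (\<gamma> x) (\<gamma> y)) + polygon_length \<gamma> (y # ts)"
  unfolding polygon_length_def by (simp_all add: sum.lessThan_Suc_shift del: sum.lessThan_Suc)

lemma polygon_length_append_ge:
  "polygon_length \<gamma> xs + polygon_length \<gamma> ys \<le> polygon_length \<gamma> (xs @ ys)"
proof (induction xs rule: induct_list012)
  case (2 x)
  then show ?case by (cases ys) auto
next
  case (3 x y zs)
  then show ?case by (simp add: add.assoc)
qed simp

lemma polygon_length_split_le:
  "polygon_length \<gamma> (xs @ ys) \<le> polygon_length \<gamma> (xs @ [b]) + polygon_length \<gamma> (b # ys)"
proof (induction xs rule: induct_list012)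
  case 1
  then show ?case by (cases ys) (auto simp: add_increasing)
next
  case (2 x)
  show ?case
  proof (cases ys)
    case (Cons y zs)
    have "ennreal (dist (\<gamma> x) (\<gamma> y)) \<le> ennreal (dist (\<gamma> x) (\<gamma> b)) + ennreal (dist (\<gamma> b) (\<gamma> y))"
      by (simp flip: ennreal_plus add: dist_triangle)
    then show ?thesis
      using Cons by (simp add: add.assoc[symmetric] add_right_mono)
  qed auto
next
  case (3 x y zs)
  then show ?case by (simp add: add.assoc add_left_mono)
qed

lemma polygon_length_le_curve_length:
  "sorted ts \<Longrightarrow> set ts \<subseteq> I \<Longrightarrow> polygon_length \<gamma> ts \<le> curve_length I \<gamma>"
  unfolding curve_length_eq by (rule SUP_upper) auto

lemma curve_length_mono: "I \<subseteq> J \<Longrightarrow> curve_length I \<gamma> \<le> curve_length J \<gamma>"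
  unfolding curve_length_eq by (rule SUP_subset_mono) auto

lemma dist_le_curve_length:
  "a \<le> b \<Longrightarrow> ennreal (dist (\<gamma> a) (\<gamma> b)) \<le> curve_length {a..b} \<gamma>"
  using polygon_length_le_curve_length[of "[a, b]" "{a..b}" \<gamma>] by simp

lemma curve_length_add:
  assumes "a \<le> b" "b \<le> c"
  shows "curve_length {a..c} \<gamma> = curve_length {a..b} \<gamma> + curve_length {b..c} \<gamma>"
proof (rule antisym)
  show "curve_length {a..c} \<gamma> \<le> curve_length {a..b} \<gamma> + curve_length {b..c} \<gamma>"
    unfolding curve_length_eq[of "{a..c}"]
  proof (rule SUP_least, clarify)
    fix ts :: "real list" assume ts: "sorted ts" "set ts \<subseteq> {a..c}"
    let ?xs = "takeWhile (\<lambda>t. t \<le> b) ts" and ?ys = "dropWhile (\<lambda>t. t \<le> b) ts"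
    have sub: "set ?xs \<subseteq> set ts" "set ?ys \<subseteq> set ts"
      by (auto dest: set_takeWhileD set_dropWhileD)
    have sor: "sorted ?xs" "sorted ?ys"
      using ts(1) by (auto intro: sorted_takeWhile sorted_dropWhile)
    have xs: "sorted (?xs @ [b])" "set (?xs @ [b]) \<subseteq> {a..b}"
      using sor sub ts assms by (auto simp: sorted_append dest!: set_takeWhileD)
    have "b \<le> y" if y: "y \<in> set ?ys" for y
    proof -
      obtain z zs where z: "?ys = z # zs" using y by (erule_tac list.set_cases) blast+
      then have "b < z" using hd_dropWhile[of "\<lambda>t. t \<le> b" ts] by auto
      then show ?thesis using sor(2) z y by (auto intro: less_imp_le)
    qed
    then have ys: "sorted (b # ?ys)" "set (b # ?ys) \<subseteq> {b..c}"
      using sor sub ts assms by (simp_all add: subset_iff)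
    have "polygon_length \<gamma> ts \<le> polygon_length \<gamma> (?xs @ [b]) + polygon_length \<gamma> (b # ?ys)"
      using polygon_length_split_le[of \<gamma> ?xs ?ys b] by simp
    also have "\<dots> \<le> curve_length {a..b} \<gamma> + curve_length {b..c} \<gamma>"
      by (intro add_mono polygon_length_le_curve_length xs ys)
    finally show "polygon_length \<gamma> ts \<le> curve_length {a..b} \<gamma> + curve_length {b..c} \<gamma>" .
  qed
next
  have ne: "{ts. sorted ts \<and> set ts \<subseteq> I} \<noteq> {}" for I :: "real set"
    by (auto intro!: exI[of _ "[]"])
  have "polygon_length \<gamma> xs + polygon_length \<gamma> ys \<le> curve_length {a..c} \<gamma>"
    if "sorted xs" "set xs \<subseteq> {a..b}" "sorted ys" "set ys \<subseteq> {b..c}" for xs ys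
  proof -
    have "sorted (xs @ ys)" "set (xs @ ys) \<subseteq> {a..c}"
      using that assms by (fastforce simp: sorted_append)+
    then show ?thesis
      using polygon_length_append_ge polygon_length_le_curve_length order_trans by blast
  qed
  then have "polygon_length \<gamma> xs + curve_length {b..c} \<gamma> \<le> curve_length {a..c} \<gamma>"
    if "sorted xs" "set xs \<subseteq> {a..b}" for xs
    unfolding curve_length_eq[of "{b..c}"] ennreal_SUP_add_right[OF ne]
    using that by (intro SUP_least) auto
  then show "curve_length {a..b} \<gamma> + curve_length {b..c} \<gamma> \<le> curve_length {a..c} \<gamma>"
    unfolding curve_length_eq[of "{a..b}"] ennreal_SUP_add_left[OF ne, symmetric]
    by (intro SUP_least) auto
qed

lemma curve_length_singleton [simp]: "curve_length {a} \<gamma> = 0"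
proof -
  have "polygon_length \<gamma> ts = 0" if "set ts \<subseteq> {a}" for ts
    using that by (induction ts rule: induct_list012) auto
  then show ?thesis unfolding curve_length_eq by (auto intro!: antisym SUP_least)
qed

lemma curve_length_le_of_lipschitz:
  assumes "\<And>s t. s \<in> {a..b} \<Longrightarrow> t \<in> {a..b} \<Longrightarrow> dist (\<gamma> s) (\<gamma> t) \<le> \<bar>s - t\<bar>" "a \<le> b"
  shows "curve_length {a..b} \<gamma> \<le> ennreal (b - a)"
  unfolding curve_length_eq
proof (rule SUP_least, clarify)
  fix ts assume "sorted ts" "set ts \<subseteq> {a..b}"
  then have "polygon_length \<gamma> ts \<le> ennreal (if ts = [] then 0 else last ts - hd ts)"
  proof (induction ts rule: induct_list012)
    case (3 x y zs)
    have *: "dist (\<gamma> x) (\<gamma> y) \<le> y - x" "y \<le> last (y # zs)"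
      using assms(1)[of x y] 3 by (auto split: if_splits)
    have "polygon_length \<gamma> (x # y # zs) \<le> ennreal (y - x) + ennreal (last (y # zs) - y)"
      using 3 * by (auto intro!: add_mono ennreal_leI)
    also have "\<dots> = ennreal (last (x # y # zs) - x)"
      using 3 * by (simp flip: ennreal_plus)
    finally show ?case by simp
  qed auto
  also have "\<dots> \<le> ennreal (b - a)"
  proof (cases "ts = []")
    case False
    then have "last ts \<in> {a..b}" "hd ts \<in> {a..b}"
      using \<open>set ts \<subseteq> {a..b}\<close> last_in_set[of ts] hd_in_set[of ts] by blast+
    then show ?thesis using False by (auto intro!: ennreal_leI)
  qed (use assms in auto)
  finally show "polygon_length \<gamma> ts \<le> ennreal (b - a)" .
qed

lemma tendsto_polygon_length:
  assumes "\<And>x. x \<in> set ts \<Longrightarrow> ((\<lambda>t. \<gamma> (f t x)) \<longlongrightarrow> \<gamma> (f t0 x)) F"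
  shows "((\<lambda>t. polygon_length \<gamma> (map (f t) ts)) \<longlongrightarrow> polygon_length \<gamma> (map (f t0) ts)) F"
  using assms
proof (induction ts rule: induct_list012)
  case (3 x y zs)
  then show ?case by (auto intro!: tendsto_add tendsto_ennrealI tendsto_dist)
qed auto

text \<open>Length is a supremum of functions that depend continuously on the curve, hence lower
  semicontinuous. The times in \<open>I t0\<close> are moved continuously into \<open>I t\<close> by \<open>f t\<close>; with \<open>f = min\<close> and
  \<open>f = max\<close> this gives lower semicontinuity of the length of an initial and of a final piece of the
  curve in its end point.\<close>

lemma curve_length_lsc:
  fixes f :: "real \<Rightarrow> real \<Rightarrow> real"
  assumes cont: "continuous_on {a..b} \<gamma>" and t0: "t0 \<in> {a..b}" and less: "\<alpha> < curve_length (I t0) \<gamma>"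
    and f: "\<And>x. continuous_on {a..b} (\<lambda>t. f t x)" "\<And>t. mono (f t)"
      "\<And>t x. t \<in> {a..b} \<Longrightarrow> x \<in> I t0 \<Longrightarrow> f t x \<in> I t" "\<And>x. x \<in> I t0 \<Longrightarrow> f t0 x = x"
    and I: "\<And>t. t \<in> {a..b} \<Longrightarrow> I t \<subseteq> {a..b}"
  shows "\<forall>\<^sub>F t in at t0 within {a..b}. \<alpha> < curve_length (I t) \<gamma>"
proof -
  obtain ts where ts: "sorted ts" "set ts \<subseteq> I t0" "\<alpha> < polygon_length \<gamma> ts"
    using less unfolding curve_length_eq by (auto simp: less_SUP_iff)
  have eq: "map (f t0) ts = ts" using ts(2) f(4) by (intro map_idI) auto
  have "((\<lambda>t. polygon_length \<gamma> (map (f t) ts)) \<longlongrightarrow> polygon_length \<gamma> (map (f t0) ts))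
      (at t0 within {a..b})"
  proof (rule tendsto_polygon_length)
    fix x assume "x \<in> set ts"
    then have "(\<lambda>t. f t x) ` {a..b} \<subseteq> {a..b}" using ts(2) f(3) I by blast
    then have "continuous_on {a..b} (\<lambda>t. \<gamma> (f t x))"
      by (rule continuous_on_compose2[OF cont f(1)])
    then show "((\<lambda>t. \<gamma> (f t x)) \<longlongrightarrow> \<gamma> (f t0 x)) (at t0 within {a..b})"
      using t0 by (auto simp: continuous_on_def)
  qed
  then have "\<forall>\<^sub>F t in at t0 within {a..b}. \<alpha> < polygon_length \<gamma> (map (f t) ts)"
    using ts(3) unfolding eq by (rule order_tendstoD)
  moreover have "\<forall>\<^sub>F t in at t0 within {a..b}. t \<in> {a..b}"
    by (simp add: eventually_at_filter)
  ultimately show ?thesis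
  proof eventually_elim
    case (elim t)
    have "sorted (map (f t) ts)"
      using ts(1) monoD[OF f(2)] by (induction ts) auto
    moreover have "set (map (f t) ts) \<subseteq> I t" using ts(2) f(3) elim by auto
    ultimately show ?case using elim polygon_length_le_curve_length order_less_le_trans by blast
  qed
qed

section \<open>Arc length\<close>

locale rectifiable_curve =
  fixes a b :: real and \<gamma> :: "real \<Rightarrow> 'a::metric_space"
  assumes ab: "a \<le> b"
    and cont: "continuous_on {a..b} \<gamma>"
    and finite_length: "curve_length {a..b} \<gamma> < \<infinity>"
begin

definition len :: "real \<Rightarrow> real" where "len t = enn2real (curve_length {a..t} \<gamma>)"

definition arc :: "real \<Rightarrow> 'a" where "arc = arclength_param a b \<gamma>"

lemma curve_length_finite: "a \<le> s \<Longrightarrow> t \<le> b \<Longrightarrow> curve_length {s..t} \<gamma> < \<infinity>"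
  using curve_length_mono[of "{s..t}" "{a..b}" \<gamma>] finite_length by (auto intro: order_le_less_trans)

lemma curve_length_eq_len: "t \<in> {a..b} \<Longrightarrow> curve_length {a..t} \<gamma> = ennreal (len t)"
  unfolding len_def using curve_length_finite[of a t] by auto

lemma len_nonneg [simp]: "0 \<le> len t" by (simp add: len_def)

lemma len_start [simp]: "len a = 0" by (simp add: len_def)

lemma curve_length_diff:
  assumes "a \<le> s" "s \<le> t" "t \<le> b"
  shows "len s \<le> len t" "curve_length {s..t} \<gamma> = ennreal (len t - len s)"
proof -
  obtain l where l: "curve_length {s..t} \<gamma> = ennreal l" "l \<ge> 0"
    using curve_length_finite[of s t] assms by (cases "curve_length {s..t} \<gamma>") auto
  have "ennreal (len t) = ennreal (len s) + ennreal l"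
    using curve_length_add[of a s t \<gamma>] curve_length_eq_len[of s] curve_length_eq_len[of t] assms l
    by simp
  then have "len t = len s + l"
    using l by (simp flip: ennreal_plus)
  then show "len s \<le> len t" "curve_length {s..t} \<gamma> = ennreal (len t - len s)"
    using l by auto
qed

lemma dist_le_len:
  assumes "s \<in> {a..b}" "t \<in> {a..b}"
  shows "dist (\<gamma> s) (\<gamma> t) \<le> \<bar>len s - len t\<bar>"
proof -
  have *: "dist (\<gamma> s) (\<gamma> t) \<le> \<bar>len s - len t\<bar>" if "s \<le> t" "s \<in> {a..b}" "t \<in> {a..b}" for s t
    using dist_le_curve_length[OF that(1), of \<gamma>] curve_length_diff[of s t] that by auto
  show ?thesis
    using *[of s t] *[of t s] assms by (cases "s \<le> t") (auto simp: dist_commute)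
qed

lemma continuous_on_len: "continuous_on {a..b} len"
  unfolding continuous_on_def
proof
  fix t0 assume t0: "t0 \<in> {a..b}"
  have ev: "\<forall>\<^sub>F t in at t0 within {a..b}. t \<in> {a..b}"
    by (simp add: eventually_at_filter)
  show "(len \<longlongrightarrow> len t0) (at t0 within {a..b})"
  proof (rule order_tendstoI)
    fix y assume "y < len t0"
    show "\<forall>\<^sub>F t in at t0 within {a..b}. y < len t"
    proof (cases "y < 0")
      case True
      then show ?thesis by (intro always_eventually) (auto intro: less_le_trans)
    next
      case False
      have lt: "ennreal y < curve_length {a..t0} \<gamma>"
        using t0 False \<open>y < len t0\<close> by (simp add: curve_length_eq_len ennreal_less_iff)
      have "\<forall>\<^sub>F t in at t0 within {a..b}. ennreal y < curve_length {a..t} \<gamma>"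
        using lt t0
        by (intro curve_length_lsc[OF cont t0, where f = min and I = "\<lambda>t. {a..t}"] continuous_intros)
          (auto simp: mono_def min_def)
      with ev show ?thesis
        by eventually_elim (use False in \<open>simp add: curve_length_eq_len ennreal_less_iff\<close>)
    qed
  next
    fix y assume y: "len t0 < y"
    show "\<forall>\<^sub>F t in at t0 within {a..b}. len t < y"
    proof (cases "len b < y")
      case True
      from ev show ?thesis
        by eventually_elim (use True curve_length_diff(1)[of _ b] in force)
    next
      case False
      have lt: "ennreal (len b - y) < curve_length {t0..b} \<gamma>"
        using t0 False y curve_length_diff(2)[of t0 b] by (simp add: ennreal_less_iff)
      have "\<forall>\<^sub>F t in at t0 within {a..b}. ennreal (len b - y) < curve_length {t..b} \<gamma>"
        using lt t0
        by (intro curve_length_lsc[OF cont t0, where f = max and I = "\<lambda>t. {t..b}"] continuous_intros)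
          (auto simp: mono_def max_def)
      with ev show ?thesis
      proof eventually_elim
        case (elim t)
        then show ?case using curve_length_diff(2)[of t b] False by (simp add: ennreal_less_iff)
      qed
    qed
  qed
qed

lemma len_surj: "s \<in> {0..len b} \<Longrightarrow> \<exists>t\<in>{a..b}. len t = s"
  using IVT'[of len a s b] continuous_on_len ab by auto

lemma arc_len: "t \<in> {a..b} \<Longrightarrow> arc (len t) = \<gamma> t"
proof -
  assume t: "t \<in> {a..b}"
  let ?P = "\<lambda>t'. t' \<in> {a..b} \<and> curve_length {a..t'} \<gamma> = ennreal (len t)"
  have "?P t" using t curve_length_eq_len by auto
  then have P: "?P (Eps ?P)" by (rule someI)
  then have "len (Eps ?P) = len t" using curve_length_eq_len by (auto simp: len_def)
  then have "\<gamma> (Eps ?P) = \<gamma> t" using dist_le_len[of "Eps ?P" t] t P by auto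
  then show ?thesis unfolding arc_def arclength_param_def by simp
qed

lemma dist_arc_le:
  assumes "s \<in> {0..len b}" "t \<in> {0..len b}"
  shows "dist (arc s) (arc t) \<le> \<bar>s - t\<bar>"
  using len_surj[OF assms(1)] len_surj[OF assms(2)] arc_len dist_le_len by metis

lemma arc_start: "arc 0 = \<gamma> a" and arc_end: "arc (len b) = \<gamma> b"
  using arc_len[of a] arc_len[of b] ab by auto

lemma line_integral_on_eq:
  "line_integral_on a b \<gamma> \<rho> = (\<integral>\<^sup>+ s \<in> {0..len b}. \<rho> (arc s) \<partial>lborel)"
  by (simp add: line_integral_on_def len_def arc_def)

text \<open>Continuing the arc length parametrization by constants makes it continuous on the whole line,
  which is convenient for measurability.\<close>

definition clamped_arc :: "real \<Rightarrow> 'a" where "clamped_arc s = arc (max 0 (min (len b) s))"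

lemma clamped_arc_eq: "s \<in> {0..len b} \<Longrightarrow> clamped_arc s = arc s"
  by (auto simp: clamped_arc_def max_def min_def)

lemma dist_clamped_arc_le: "dist (clamped_arc s) (clamped_arc t) \<le> \<bar>s - t\<bar>"
  unfolding clamped_arc_def
  by (rule order_trans[OF dist_arc_le]) (auto simp: max_def min_def)

lemma continuous_on_clamped_arc: "continuous_on UNIV clamped_arc"
proof -
  have "1-lipschitz_on UNIV clamped_arc"
    by (rule lipschitz_onI) (use dist_clamped_arc_le in \<open>auto simp: dist_real_def\<close>)
  then show ?thesis by (rule lipschitz_on_continuous_on)
qed

lemma borel_measurable_clamped_arc [measurable]: "clamped_arc \<in> borel_measurable borel"
  by (rule borel_measurable_continuous_onI) (rule continuous_on_clamped_arc)

lemma line_integral_on_clamped: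
  "line_integral_on a b \<gamma> \<rho> = (\<integral>\<^sup>+ s \<in> {0..len b}. \<rho> (clamped_arc s) \<partial>lborel)"
  unfolding line_integral_on_eq
  by (rule nn_integral_cong) (auto simp: clamped_arc_eq indicator_def)

end

section \<open>Line integrals\<close>

lemma continuous_on_imp_set_nn_integral:
  fixes f :: "real \<Rightarrow> real"
  assumes "continuous_on {a..b} f" "\<And>x. 0 \<le> f x"
  shows "(\<integral>\<^sup>+ x \<in> {a..b}. ennreal (f x) \<partial>lborel) = ennreal (integral {a..b} f)"
  by (rule nn_integral_has_integral_lebesgue')
    (use assms in \<open>auto intro: integrable_integral integrable_continuous_real\<close>)

context rectifiable_curve
begin

lemma rectifiable_subcurve:
  assumes "a \<le> s" "s \<le> t" "t \<le> b"
  shows "rectifiable_curve s t \<gamma>"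
  by unfold_locales (use assms curve_length_finite[of s t] in \<open>auto intro: continuous_on_subset[OF cont]\<close>)

lemma line_integral_on_initial:
  assumes "s \<in> {a..b}"
  shows "line_integral_on a s \<gamma> \<rho> = (\<integral>\<^sup>+ x \<in> {0..len s}. \<rho> (clamped_arc x) \<partial>lborel)"
proof -
  interpret L: rectifiable_curve a s \<gamma> using assms by (intro rectifiable_subcurve) auto
  have "L.arc x = clamped_arc x" if x: "x \<in> {0..len s}" for x
  proof -
    obtain t where "t \<in> {a..s}" "len t = x" using L.len_surj[OF x] by blast
    moreover have "x \<in> {0..len b}" using x curve_length_diff(1)[of s b] assms by auto
    ultimately show ?thesis
      using L.arc_len[of t] arc_len[of t] assms by (auto simp: clamped_arc_eq)
  qed
  then show ?thesis
    unfolding L.line_integral_on_eq by (intro nn_integral_cong) (auto simp: indicator_def)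
qed

lemma line_integral_on_final:
  assumes "s \<in> {a..b}" and [measurable]: "\<rho> \<in> borel_measurable borel"
  shows "line_integral_on s b \<gamma> \<rho> = (\<integral>\<^sup>+ x \<in> {len s..len b}. \<rho> (clamped_arc x) \<partial>lborel)"
proof -
  interpret R: rectifiable_curve s b \<gamma> using assms by (intro rectifiable_subcurve) auto
  have len: "R.len t = len t - len s" if "t \<in> {s..b}" for t
    using curve_length_diff[of s t] that assms by (auto simp: R.len_def)
  have s: "len s \<le> len b" using curve_length_diff(1)[of s b] assms by auto
  have "R.arc x = clamped_arc (len s + x)" if x: "x \<in> {0..R.len b}" for x
  proof -
    obtain t where t: "t \<in> {s..b}" "R.len t = x" using R.len_surj[OF x] by blast
    then have "len t = len s + x" using len by auto
    moreover have "len s + x \<in> {0..len b}" using x len[of b] assms by auto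
    ultimately show ?thesis
      using R.arc_len[of t] arc_len[of t] t assms by (auto simp: clamped_arc_eq)
  qed
  then have "line_integral_on s b \<gamma> \<rho>
      = (\<integral>\<^sup>+ x. \<rho> (clamped_arc (len s + x)) * indicator {0..R.len b} x \<partial>lborel)"
    unfolding R.line_integral_on_eq by (intro nn_integral_cong) (auto simp: indicator_def)
  also have "\<dots> = (\<integral>\<^sup>+ x. \<rho> (clamped_arc (len s + 1 * x))
      * indicator {len s..len b} (len s + 1 * x) \<partial>lborel)"
    using len[of b] assms by (intro nn_integral_cong) (auto simp: indicator_def)
  also have "\<dots> = (\<integral>\<^sup>+ x \<in> {len s..len b}. \<rho> (clamped_arc x) \<partial>lborel)"
    by (subst nn_integral_real_affine[where c = 1 and t = "len s"]) auto
  finally show ?thesis .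
qed

lemma line_integral_on_add_le:
  assumes "s \<in> {a..b}" and [measurable]: "\<rho> \<in> borel_measurable borel"
  shows "line_integral_on a s \<gamma> \<rho> + line_integral_on s b \<gamma> \<rho> \<le> line_integral_on a b \<gamma> \<rho>"
proof -
  have s: "len s \<le> len b" using curve_length_diff(1)[of s b] assms by auto
  have "line_integral_on a s \<gamma> \<rho> + line_integral_on s b \<gamma> \<rho>
     = (\<integral>\<^sup>+ x. \<rho> (clamped_arc x) * indicator {0..len s} x
             + \<rho> (clamped_arc x) * indicator {len s..len b} x \<partial>lborel)"
    unfolding line_integral_on_initial[OF assms(1)] line_integral_on_final[OF assms]
    by (rule nn_integral_add[symmetric]) auto
  also have "\<dots> \<le> (\<integral>\<^sup>+ x \<in> {0..len b}. \<rho> (clamped_arc x) \<partial>lborel)"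
    using AE_lborel_singleton[of "len s"] s
    by (intro nn_integral_mono_AE) (auto simp: indicator_def elim!: eventually_mono intro: order_trans[OF len_nonneg])
  finally show ?thesis unfolding line_integral_on_clamped .
qed

lemma line_integral_on_cmult:
  assumes [measurable]: "\<rho> \<in> borel_measurable borel"
  shows "line_integral_on a b \<gamma> (\<lambda>x. c * \<rho> x) = c * line_integral_on a b \<gamma> \<rho>"
  unfolding line_integral_on_clamped
  by (subst nn_integral_cmult[symmetric]) (auto simp: mult.assoc)

text \<open>On short parameter intervals the integrand is almost constant, while the arc length grows at
  most as fast as the parameter. The resulting estimates for short intervals are transitive up to the
  error \<open>\<epsilon> (t - s)\<close>, so bisection extends them to the whole interval.\<close>

lemma line_integral_on_le_parameter_integral:
  fixes g :: "'a \<Rightarrow> real"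
  assumes g: "continuous_on UNIV g" "\<And>x. 0 \<le> g x"
    and lip: "\<And>s t. s \<in> {a..b} \<Longrightarrow> t \<in> {a..b} \<Longrightarrow> dist (\<gamma> s) (\<gamma> t) \<le> \<bar>s - t\<bar>"
  shows "line_integral_on a b \<gamma> (\<lambda>x. ennreal (g x)) \<le> (\<integral>\<^sup>+ t \<in> {a..b}. ennreal (g (\<gamma> t)) \<partial>lborel)"
proof -
  let ?h = "\<lambda>x. g (clamped_arc x)" and ?k = "\<lambda>t. g (\<gamma> t)"
  have ch: "continuous_on A ?h" for A
    by (rule continuous_on_subset[OF continuous_on_compose2[OF g(1) continuous_on_clamped_arc]]) auto
  have ck: "continuous_on {a..b} ?k"
    by (rule continuous_on_compose2[OF g(1) cont]) auto
  have hi: "?h integrable_on {u..v}" for u v by (rule integrable_continuous_real) (rule ch)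
  have ki: "?k integrable_on {u..v}" if "a \<le> u" "v \<le> b" for u v
    by (rule integrable_continuous_real, rule continuous_on_subset[OF ck]) (use that in auto)
  have "integral {len a..len b} ?h \<le> integral {a..b} ?k + e" if "e > 0" for e :: real
  proof -
    define \<epsilon> where "\<epsilon> = e / (b - a + 1)"
    have \<epsilon>: "\<epsilon> > 0" using ab that by (simp add: \<epsilon>_def)
    define P where "P s t \<longleftrightarrow> (a \<le> s \<longrightarrow> s \<le> t \<longrightarrow> t \<le> b \<longrightarrow>
        integral {len s..len t} ?h \<le> integral {s..t} ?k + \<epsilon> * (t - s))" for s t
    have "P a b" using ab
    proof (induction rule: Bolzano)
      case (trans r s t)
      show ?case unfolding P_def
      proof (intro impI)
        assume *: "a \<le> r" "r \<le> t" "t \<le> b"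
        have "integral {len r..len t} ?h = integral {len r..len s} ?h + integral {len s..len t} ?h"
          using * trans curve_length_diff(1)[of r s] curve_length_diff(1)[of s t]
          by (intro Henstock_Kurzweil_Integration.integral_combine[symmetric] hi) auto
        moreover have "integral {r..t} ?k = integral {r..s} ?k + integral {s..t} ?k"
          using * trans by (intro Henstock_Kurzweil_Integration.integral_combine[symmetric] ki) auto
        ultimately show "integral {len r..len t} ?h \<le> integral {r..t} ?k + \<epsilon> * (t - r)"
          using trans * unfolding P_def by (simp add: algebra_simps)
      qed
    next
      case (local x)
      obtain d where d: "d > 0" "\<And>t. t \<in> {a..b} \<Longrightarrow> \<bar>t - x\<bar> < d \<Longrightarrow> \<bar>?k t - ?k x\<bar> < \<epsilon> / 2"
        using ck[unfolded continuous_on_iff dist_real_def, rule_format, of x "\<epsilon> / 2"] local \<epsilon>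
        by auto
      have "P s t" if st: "s \<le> x" "x \<le> t" "t - s < d" for s t
        unfolding P_def
      proof (intro impI)
        assume *: "a \<le> s" "s \<le> t" "t \<le> b"
        let ?l = "len t - len s"
        have l: "0 \<le> ?l" "?l \<le> t - s"
          using curve_length_diff[of s t] curve_length_le_of_lipschitz[of s t \<gamma>] lip *
          by (auto simp: ennreal_le_iff)
        have near: "?k x - \<epsilon> / 2 \<le> ?k r" "?k r \<le> ?k x + \<epsilon> / 2" if "r \<in> {s..t}" for r
        proof -
          have "\<bar>?k r - ?k x\<bar> < \<epsilon> / 2" using d(2)[of r] st * that by auto
          then show "?k x - \<epsilon> / 2 \<le> ?k r" "?k r \<le> ?k x + \<epsilon> / 2" by linarith+
        qed
        have up: "?h y \<le> ?k x + \<epsilon> / 2" if y: "y \<in> {len s..len t}" for y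
        proof -
          have "continuous_on {s..t} len"
            by (rule continuous_on_subset[OF continuous_on_len]) (use * in auto)
          then obtain r where r: "r \<in> {s..t}" "len r = y"
            using IVT'[of len s y t] y * by auto
          then have "y \<in> {0..len b}" using curve_length_diff(1)[of r b] * by auto
          then have "?h y = ?k r" using r * arc_len[of r] by (simp add: clamped_arc_eq)
          then show ?thesis using near(2)[OF r(1)] by simp
        qed
        have "integral {len s..len t} ?h \<le> integral {len s..len t} (\<lambda>_. ?k x + \<epsilon> / 2)"
          using up hi by (intro integral_le) auto
        also have "\<dots> = ?l * (?k x + \<epsilon> / 2)" using l by simp
        also have "\<dots> \<le> (t - s) * (?k x + \<epsilon> / 2)"
          using l g(2)[of "\<gamma> x"] \<epsilon> by (intro mult_right_mono) auto
        also have "\<dots> = integral {s..t} (\<lambda>_. ?k x - \<epsilon> / 2) + \<epsilon> * (t - s)"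
          using * by (simp add: algebra_simps)
        also have "integral {s..t} (\<lambda>_. ?k x - \<epsilon> / 2) \<le> integral {s..t} ?k"
          using near(1) ki[of s t] * by (intro integral_le) auto
        finally show "integral {len s..len t} ?h \<le> integral {s..t} ?k + \<epsilon> * (t - s)" by simp
      qed
      then show ?case using d(1) by blast
    qed
    moreover have "\<epsilon> * (b - a) \<le> e" using ab that by (simp add: \<epsilon>_def field_simps)
    ultimately show ?thesis using ab unfolding P_def by auto
  qed
  then have "integral {len a..len b} ?h \<le> integral {a..b} ?k"
    by (rule field_le_epsilon)
  then have "integral {0..len b} ?h \<le> integral {a..b} ?k" by simp
  moreover have "line_integral_on a b \<gamma> (\<lambda>x. ennreal (g x)) = ennreal (integral {0..len b} ?h)"
    unfolding line_integral_on_clamped by (rule continuous_on_imp_set_nn_integral[OF ch g(2)])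
  moreover have "(\<integral>\<^sup>+ t \<in> {a..b}. ennreal (?k t) \<partial>lborel) = ennreal (integral {a..b} ?k)"
    by (rule continuous_on_imp_set_nn_integral[OF ck g(2)])
  ultimately show ?thesis by (simp add: ennreal_leI)
qed

end

lemma rectifiable_curve_of_is_curve:
  assumes "is_curve ({a..b}, \<gamma>)" "curve_length {a..b} \<gamma> < \<infinity>"
  shows "rectifiable_curve a b \<gamma>"
proof
  show "a \<le> b" using assms(1) by (rule_tac ccontr) (auto simp: is_curve_def constant_on_def)
qed (use assms in \<open>auto simp: is_curve_def\<close>)

lemma rectifiable_curve_of_locally_rectifiable:
  assumes "locally_rectifiable (I, \<gamma>)" "a \<le> b" "{a..b} \<subseteq> I"
  shows "rectifiable_curve a b \<gamma>"
  by unfold_locales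
    (use assms in \<open>auto simp: locally_rectifiable_def is_curve_def intro: continuous_on_subset\<close>)

lemma line_integral_on_le_line_integral:
  "a \<le> b \<Longrightarrow> {a..b} \<subseteq> I \<Longrightarrow> line_integral_on a b \<gamma> \<rho> \<le> line_integral (I, \<gamma>) \<rho>"
  unfolding line_integral_def prod.case by (rule SUP_upper2[of "(a, b)"]) simp_all

lemma line_integral_cmult:
  assumes "locally_rectifiable (I, \<gamma>)" "\<rho> \<in> borel_measurable borel"
  shows "line_integral (I, \<gamma>) (\<lambda>x. c * \<rho> x) = c * line_integral (I, \<gamma>) \<rho>"
  unfolding line_integral_def prod.case SUP_mult_left_ennreal
  using rectifiable_curve.line_integral_on_cmult[OF rectifiable_curve_of_locally_rectifiable[OF assms(1)] assms(2)]
  by (intro SUP_cong) auto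

lemma line_integral_mono:
  assumes "\<And>x. \<rho> x \<le> \<sigma> x"
  shows "line_integral \<Gamma> \<rho> \<le> line_integral \<Gamma> \<sigma>"
proof (cases \<Gamma>)
  case (Pair I \<gamma>)
  have "line_integral_on a b \<gamma> \<rho> \<le> line_integral_on a b \<gamma> \<sigma>" for a b
    unfolding line_integral_on_def by (intro nn_integral_mono mult_right_mono assms) auto
  then show ?thesis unfolding line_integral_def Pair prod.case by (intro SUP_mono) auto
qed

text \<open>Along a curve, the short-range estimates add up to Riemann sums of the line integral of the
  continuous function \<open>g\<close>.\<close>

lemma upper_gradient_of_short_range:
  fixes g u :: "'a::metric_space \<Rightarrow> real"
  assumes g: "continuous_on UNIV g" "\<And>x. 0 \<le> g x"
    and "\<delta> > 0" and short: "\<And>x y. dist x y \<le> \<delta> \<Longrightarrow> u x \<le> g x * dist x y + u y"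
  shows "upper_gradient (\<lambda>x. ennreal (g x)) u"
  unfolding upper_gradient_def
proof (intro conjI allI impI; (elim conjE)?)
  show "(\<lambda>x. ennreal (g x)) \<in> borel_measurable borel"
    using borel_measurable_continuous_onI[OF g(1)] by simp
next
  fix a b \<gamma> assume "is_curve ({a..b}, \<gamma> :: real \<Rightarrow> 'a)" "curve_length {a..b} \<gamma> < \<infinity>"
  then interpret rectifiable_curve a b \<gamma> by (rule rectifiable_curve_of_is_curve)
  let ?c = clamped_arc
  let ?h = "\<lambda>x. g (?c x)"
  have ch: "continuous_on A ?h" for A
    by (rule continuous_on_subset[OF continuous_on_compose2[OF g(1) continuous_on_clamped_arc]]) auto
  have hi: "?h integrable_on {u..v}" for u v by (rule integrable_continuous_real) (rule ch)
  have "\<bar>u (?c 0) - u (?c (len b))\<bar> \<le> integral {0..len b} ?h + e" if "e > 0" for e :: real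
  proof -
    define \<epsilon> where "\<epsilon> = e / (len b + 1)"
    have "len b \<ge> 0" by simp
    then have \<epsilon>: "\<epsilon> > 0" using that unfolding \<epsilon>_def by (intro divide_pos_pos) linarith+
    define P where "P s t \<longleftrightarrow> (s \<le> t \<longrightarrow>
        \<bar>u (?c s) - u (?c t)\<bar> \<le> integral {s..t} ?h + \<epsilon> * (t - s))" for s t
    have "P 0 (len b)" using \<open>len b \<ge> 0\<close>
    proof (induction rule: Bolzano)
      case (trans r s t)
      have "integral {r..t} ?h = integral {r..s} ?h + integral {s..t} ?h"
        using trans by (intro Henstock_Kurzweil_Integration.integral_combine[symmetric] hi) auto
      then show ?case using trans unfolding P_def by (auto simp: algebra_simps)
    next
      case (local x)
      obtain d where d: "d > 0" "\<And>t. \<bar>t - x\<bar> < d \<Longrightarrow> \<bar>?h t - ?h x\<bar> < \<epsilon> / 2"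
        using ch[of UNIV, unfolded continuous_on_iff dist_real_def, rule_format, of x "\<epsilon> / 2"] \<epsilon>
        by auto
      have "P s t" if st: "s \<le> x" "x \<le> t" "t - s < min d \<delta>" for s t
        unfolding P_def
      proof
        assume *: "s \<le> t"
        have near: "?h x - \<epsilon> / 2 \<le> ?h r" "?h r \<le> ?h x + \<epsilon> / 2" if "r \<in> {s..t}" for r
        proof -
          have "\<bar>?h r - ?h x\<bar> < \<epsilon> / 2" using d(2)[of r] st * that by auto
          then show "?h x - \<epsilon> / 2 \<le> ?h r" "?h r \<le> ?h x + \<epsilon> / 2" by linarith+
        qed
        have c: "dist (?c s) (?c t) \<le> t - s" using dist_clamped_arc_le[of s t] * by simp
        then have "\<bar>u (?c s) - u (?c t)\<bar> \<le> max (?h s) (?h t) * dist (?c s) (?c t)"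
          using short[of "?c s" "?c t"] short[of "?c t" "?c s"] st
            mult_right_mono[OF max.cobounded1[of "?h s" "?h t"] zero_le_dist[of "?c s" "?c t"]]
            mult_right_mono[OF max.cobounded2[of "?h t" "?h s"] zero_le_dist[of "?c s" "?c t"]]
          by (simp add: dist_commute)
        also have "\<dots> \<le> (?h x + \<epsilon> / 2) * (t - s)"
          using near(2)[of s] near(2)[of t] * c g(2)[of "?c x"] \<epsilon> by (intro mult_mono) auto
        also have "\<dots> = integral {s..t} (\<lambda>_. ?h x - \<epsilon> / 2) + \<epsilon> * (t - s)"
          using * by (simp add: algebra_simps)
        also have "integral {s..t} (\<lambda>_. ?h x - \<epsilon> / 2) \<le> integral {s..t} ?h"
          using near(1) hi[of s t] * by (intro integral_le) auto
        finally show "\<bar>u (?c s) - u (?c t)\<bar> \<le> integral {s..t} ?h + \<epsilon> * (t - s)" by simp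
      qed
      then show ?case using d(1) \<open>\<delta> > 0\<close> by (intro exI[of _ "min d \<delta>"]) auto
    qed
    moreover have "\<epsilon> * len b \<le> e"
    proof -
      have "\<epsilon> * len b \<le> \<epsilon> * (len b + 1)" using \<epsilon> by simp
      also have "\<dots> = e" using \<open>len b \<ge> 0\<close> by (simp add: \<epsilon>_def add_nonneg_eq_0_iff)
      finally show ?thesis .
    qed
    ultimately show ?thesis unfolding P_def by auto
  qed
  then have "\<bar>u (?c 0) - u (?c (len b))\<bar> \<le> integral {0..len b} ?h"
    by (rule field_le_epsilon)
  moreover have "?c 0 = \<gamma> a" "?c (len b) = \<gamma> b"
    by (simp_all add: clamped_arc_eq arc_start arc_end)
  moreover have "line_integral_on a b \<gamma> (\<lambda>x. ennreal (g x)) = ennreal (integral {0..len b} ?h)"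
    unfolding line_integral_on_clamped by (rule continuous_on_imp_set_nn_integral[OF ch g(2)])
  ultimately show "ennreal \<bar>u (\<gamma> a) - u (\<gamma> b)\<bar> \<le> line_integral_on a b \<gamma> (\<lambda>x. ennreal (g x))"
    by (simp add: ennreal_leI)
qed

section \<open>Extended powers\<close>

lemma ennreal_epowr: "0 \<le> x \<Longrightarrow> 0 < q \<Longrightarrow> ennreal x epowr q = ennreal (x powr q)"
  by (auto simp: ennpowr_def)

lemma zero_epowr [simp]: "0 < q \<Longrightarrow> 0 epowr q = 0"
  by (auto simp: ennpowr_def)

lemma top_epowr [simp]: "0 < q \<Longrightarrow> top epowr q = top"
  by (auto simp: ennpowr_def infinity_ennreal_def)

lemma epowr_cmult:
  assumes "0 < q" "0 < c"
  shows "(ennreal c * x) epowr q = ennreal (c powr q) * x epowr q"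
  using assms
  by (cases x) (auto simp: ennreal_epowr powr_mult ennreal_mult_top simp flip: ennreal_mult)

lemma borel_measurable_epowr [measurable]:
  assumes [measurable]: "f \<in> borel_measurable N"
  shows "(\<lambda>x. f x epowr q) \<in> borel_measurable N"
  unfolding ennpowr_def by measurable

section \<open>Discrete chains\<close>

text \<open>The measurability of functions defined by minimizing over curves is delicate, and their values are
  finite only where curves exist. Minimizing Riemann sums over chains of jumps of length at most
  \<open>\<delta>\<close> avoids both problems: the resulting potential is continuous. Its truncation at 1 makes it a
  bounded function even if no chain reaches \<open>E\<close>.\<close>

inductive chain_cost :: "('a::metric_space \<Rightarrow> real) \<Rightarrow> real \<Rightarrow> 'a set \<Rightarrow> 'a \<Rightarrow> real \<Rightarrow> bool"
  for g :: "'a \<Rightarrow> real" and \<delta> :: real and E :: "'a set" where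
  base: "x \<in> E \<Longrightarrow> chain_cost g \<delta> E x 0"
| step: "chain_cost g \<delta> E y c \<Longrightarrow> dist x y \<le> \<delta> \<Longrightarrow> chain_cost g \<delta> E x (g x * dist x y + c)"

definition chain_potential :: "('a::metric_space \<Rightarrow> real) \<Rightarrow> real \<Rightarrow> 'a set \<Rightarrow> 'a \<Rightarrow> real" where
  "chain_potential g \<delta> E x = Inf (insert 1 {c. chain_cost g \<delta> E x c})"

context
  fixes g :: "'a::metric_space \<Rightarrow> real" and \<delta> :: real and E :: "'a set"
  assumes g_nonneg: "\<And>x. 0 \<le> g x" and \<delta>_pos: "0 < \<delta>"
begin

lemma chain_cost_nonneg: "chain_cost g \<delta> E x c \<Longrightarrow> 0 \<le> c"
  by (induction rule: chain_cost.induct) (auto simp: g_nonneg)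

lemma bdd_below_chain_cost: "bdd_below (insert 1 {c. chain_cost g \<delta> E x c})"
  using chain_cost_nonneg by (intro bdd_belowI[of _ 0]) auto

lemma chain_potential_le: "chain_cost g \<delta> E x c \<Longrightarrow> chain_potential g \<delta> E x \<le> c"
  unfolding chain_potential_def by (rule cInf_lower[OF _ bdd_below_chain_cost]) auto

lemma chain_potential_le_1: "chain_potential g \<delta> E x \<le> 1"
  unfolding chain_potential_def by (rule cInf_lower[OF _ bdd_below_chain_cost]) auto

lemma chain_potential_nonneg: "0 \<le> chain_potential g \<delta> E x"
  unfolding chain_potential_def by (rule cInf_greatest) (auto dest: chain_cost_nonneg)

lemma chain_potential_eq_0: "x \<in> E \<Longrightarrow> chain_potential g \<delta> E x = 0"
  using chain_potential_le[OF chain_cost.base, of x] chain_potential_nonneg[of x] by simp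

lemma chain_potential_short_range:
  assumes "dist x y \<le> \<delta>"
  shows "chain_potential g \<delta> E x \<le> g x * dist x y + chain_potential g \<delta> E y"
proof -
  have "chain_potential g \<delta> E x - g x * dist x y \<le> chain_potential g \<delta> E y"
    unfolding chain_potential_def[of g \<delta> E y]
  proof (rule cInf_greatest)
    fix c assume "c \<in> insert 1 {c. chain_cost g \<delta> E y c}"
    then consider "c = 1" | "chain_cost g \<delta> E y c" by auto
    then show "chain_potential g \<delta> E x - g x * dist x y \<le> c"
    proof cases
      case 1
      then show ?thesis
        using chain_potential_le_1[of x] mult_nonneg_nonneg[OF g_nonneg[of x] zero_le_dist[of x y]] by simp
    next
      case 2
      then show ?thesis using chain_potential_le[OF chain_cost.step[OF 2 assms]] by simp
    qed
  qed auto
  then show ?thesis by simp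
qed

lemma upper_gradient_chain_potential:
  "continuous_on UNIV g \<Longrightarrow> upper_gradient (\<lambda>x. ennreal (g x)) (chain_potential g \<delta> E)"
  using chain_potential_short_range g_nonneg \<delta>_pos by (intro upper_gradient_of_short_range)

lemma continuous_on_chain_potential:
  assumes "continuous_on UNIV g"
  shows "continuous_on UNIV (chain_potential g \<delta> E)"
  unfolding continuous_on_def
proof
  fix x :: 'a
  let ?u = "chain_potential g \<delta> E"
  have g: "(g \<longlongrightarrow> g x) (at x)" using assms by (simp add: continuous_on_def)
  have "((\<lambda>y. (g x + g y) * dist x y) \<longlongrightarrow> (g x + g x) * dist x x) (at x)"
    by (intro tendsto_intros g)
  then have lim: "((\<lambda>y. (g x + g y) * dist x y) \<longlongrightarrow> 0) (at x)" by simp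
  have "\<forall>\<^sub>F y in at x. dist y x < \<delta>"
    using \<delta>_pos by (auto simp: eventually_at)
  then have "\<forall>\<^sub>F y in at x. \<bar>?u y - ?u x\<bar> \<le> (g x + g y) * dist x y"
  proof eventually_elim
    case (elim y)
    then show ?case
      using chain_potential_short_range[of x y] chain_potential_short_range[of y x]
        mult_nonneg_nonneg[OF g_nonneg[of x] zero_le_dist[of x y]]
        mult_nonneg_nonneg[OF g_nonneg[of y] zero_le_dist[of x y]]
      by (simp add: dist_commute algebra_simps)
  qed
  then have "((\<lambda>y. ?u y - ?u x) \<longlongrightarrow> 0) (at x)"
    by (intro Lim_null_comparison[OF _ lim]) simp
  then show "(?u \<longlongrightarrow> ?u x) (at x within UNIV)" by (simp add: LIM_zero_iff)
qed

lemma chain_potential_less_1: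
  assumes "chain_potential g \<delta> E x < 1"
  obtains c where "chain_cost g \<delta> E x c" "c < 1"
  using cInf_lessD[of "insert 1 {c. chain_cost g \<delta> E x c}" 1] assms
  unfolding chain_potential_def by auto

text \<open>A chain is turned into a step path that stays in each point for as long as the following jump
  is wide. Such a path is 1-Lipschitz up to the error \<open>\<delta>\<close>, and the integral of \<open>g\<close> over the
  parameter interval is the cost of the chain.\<close>

lemma chain_cost_imp_step_path:
  assumes "chain_cost g \<delta> E x c" and [measurable]: "g \<in> borel_measurable borel"
  shows "\<exists>T \<gamma>. 0 \<le> T \<and> \<gamma> \<in> borel_measurable borel \<and> \<gamma> 0 = x \<and> \<gamma> T \<in> E \<and>
    (\<forall>t\<in>{0..T}. dist x (\<gamma> t) \<le> t) \<and>
    (\<forall>s\<in>{0..T}. \<forall>t\<in>{0..T}. dist (\<gamma> s) (\<gamma> t) \<le> \<bar>s - t\<bar> + \<delta>) \<and>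
    (\<integral>\<^sup>+ t \<in> {0..<T}. ennreal (g (\<gamma> t)) \<partial>lborel) = ennreal c"
  using assms(1)
proof (induction rule: chain_cost.induct)
  case (base x)
  then show ?case
    using \<delta>_pos by (intro exI[of _ 0] exI[of _ "\<lambda>_. x"]) auto
next
  case (step y c x)
  obtain T \<gamma> where \<gamma>: "0 \<le> T" "\<gamma> 0 = y" "\<gamma> T \<in> E"
    "\<And>t. t \<in> {0..T} \<Longrightarrow> dist y (\<gamma> t) \<le> t"
    "\<And>s t. s \<in> {0..T} \<Longrightarrow> t \<in> {0..T} \<Longrightarrow> dist (\<gamma> s) (\<gamma> t) \<le> \<bar>s - t\<bar> + \<delta>"
    "(\<integral>\<^sup>+ t \<in> {0..<T}. ennreal (g (\<gamma> t)) \<partial>lborel) = ennreal c"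
    and [measurable]: "\<gamma> \<in> borel_measurable borel"
    using step.IH by blast
  let ?d = "dist x y"
  define \<gamma>' where "\<gamma>' t = (if t < ?d then x else \<gamma> (t - ?d))" for t
  have [measurable]: "\<gamma>' \<in> borel_measurable borel" unfolding \<gamma>'_def by measurable
  have "\<gamma>' 0 = x" using \<gamma>(2) by (auto simp: \<gamma>'_def)
  moreover have "\<gamma>' (T + ?d) \<in> E" using \<gamma> by (simp add: \<gamma>'_def)
  moreover have from_start: "dist x (\<gamma>' t) \<le> t" if "t \<in> {0..T + ?d}" for t
    using that \<gamma>(4)[of "t - ?d"] dist_triangle[of x "\<gamma> (t - ?d)" y] by (auto simp: \<gamma>'_def)
  moreover have "dist (\<gamma>' s) (\<gamma>' t) \<le> \<bar>s - t\<bar> + \<delta>" if st: "s \<in> {0..T + ?d}" "t \<in> {0..T + ?d}" for s t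
  proof (cases "s < ?d \<or> t < ?d")
    case True
    then show ?thesis
      using from_start[OF st(1)] from_start[OF st(2)] st step.hyps(2) \<delta>_pos
      by (auto simp: \<gamma>'_def dist_commute)
  next
    case False
    then show ?thesis using \<gamma>(5)[of "s - ?d" "t - ?d"] st by (simp add: \<gamma>'_def)
  qed
  moreover have "(\<integral>\<^sup>+ t \<in> {0..<T + ?d}. ennreal (g (\<gamma>' t)) \<partial>lborel) = ennreal (g x * ?d + c)"
  proof -
    have "(\<integral>\<^sup>+ t \<in> {0..<T + ?d}. ennreal (g (\<gamma>' t)) \<partial>lborel)
       = (\<integral>\<^sup>+ t. ennreal (g x) * indicator {0..<?d} t
            + ennreal (g (\<gamma> (t - ?d))) * indicator {0..<T} (t - ?d) \<partial>lborel)"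
      using \<gamma>(1) by (intro nn_integral_cong) (auto simp: \<gamma>'_def indicator_def not_less dest: order_trans[OF zero_le_dist])
    also have "\<dots> = ennreal (g x) * ennreal ?d
        + (\<integral>\<^sup>+ t. ennreal (g (\<gamma> (t - ?d))) * indicator {0..<T} (t - ?d) \<partial>lborel)"
      by (subst nn_integral_add) (auto simp: nn_integral_cmult)
    also have "(\<integral>\<^sup>+ t. ennreal (g (\<gamma> (t - ?d))) * indicator {0..<T} (t - ?d) \<partial>lborel) = ennreal c"
      unfolding \<gamma>(6)[symmetric]
      by (subst nn_integral_real_affine[where c = 1 and t = "- ?d"
            and f = "\<lambda>t. ennreal (g (\<gamma> t)) * indicator {0..<T} t"]) auto
    finally show ?thesis
      using g_nonneg chain_cost_nonneg[OF step.hyps(1)] by (simp add: ennreal_mult ennreal_plus)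
  qed
  ultimately show ?case
    using \<gamma>(1) by (intro exI[of _ "T + ?d"] exI[of _ \<gamma>']) auto
qed

end

section \<open>Limits of almost Lipschitz paths\<close>

text \<open>The Arzela--Ascoli theorem for maps that are 1-Lipschitz up to an error tending to zero. The
  values at the rational times lie in a compact product; a subsequence converges there, and then at
  all times.\<close>

lemma almost_lipschitz_subseq_limit:
  fixes \<gamma> :: "nat \<Rightarrow> real \<Rightarrow> 'a::metric_space"
  assumes proper: "\<And>x r. compact (cball x r :: 'a set)"
    and T: "filterlim T at_top sequentially" and \<delta>: "\<delta> \<longlonglongrightarrow> 0"
    and lip: "\<And>n s t. s \<in> {0..T n} \<Longrightarrow> t \<in> {0..T n} \<Longrightarrow> dist (\<gamma> n s) (\<gamma> n t) \<le> \<bar>s - t\<bar> + \<delta> n"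
    and start: "\<And>n. \<gamma> n 0 \<in> cball w R"
  obtains r :: "nat \<Rightarrow> nat" and \<gamma>' where "strict_mono r"
    "\<And>t. 0 \<le> t \<Longrightarrow> (\<lambda>n. \<gamma> (r n) t) \<longlonglongrightarrow> \<gamma>' t"
    "\<And>s t. 0 \<le> s \<Longrightarrow> 0 \<le> t \<Longrightarrow> dist (\<gamma>' s) (\<gamma>' t) \<le> \<bar>s - t\<bar>"
proof -
  obtain D where D: "\<And>n. \<bar>\<delta> n\<bar> \<le> D"
    using convergent_imp_Bseq[of \<delta>] \<delta> by (auto simp: Bseq_def convergent_def)
  define q :: "nat \<Rightarrow> real" where "q i = \<bar>of_rat (from_nat i)\<bar>" for i
  have q_nonneg: "0 \<le> q i" for i by (simp add: q_def)
  have q_dense: "\<exists>i. \<bar>t - q i\<bar> < e" if t: "0 \<le> t" "e > 0" for t e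
  proof -
    obtain x where x: "t < of_rat x" "of_rat x < t + e" using of_rat_dense[of t "t + e"] t by auto
    have "q (to_nat x) = of_rat x"
      unfolding q_def from_nat_to_nat by (rule abs_of_nonneg) (use x t in linarith)
    then show ?thesis using x by (intro exI[of _ "to_nat x"]) linarith
  qed
  define K where "K i = cball w (max R 0 + q i + D)" for i
  define f where "f n i = (if q i \<le> T n then \<gamma> n (q i) else w)" for n i
  have "f n \<in> PiE UNIV K" for n
  proof (rule PiE_I)
    fix i
    have "dist w (\<gamma> n (q i)) \<le> max R 0 + q i + D" if "q i \<le> T n"
      using lip[of 0 n "q i"] start[of n] dist_triangle[of w "\<gamma> n (q i)" "\<gamma> n 0"] that
        q_nonneg[of i] D[of n] by auto
    then show "f n i \<in> K i" using q_nonneg[of i] D[of n] by (auto simp: f_def K_def)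
  qed auto
  moreover have "compact (PiE UNIV K)"
    using compactin_PiE[of "\<lambda>_. euclidean" UNIV K] proper
    by (auto simp: K_def euclidean_product_topology)
  then have "seq_compact (PiE UNIV K)" by (simp add: compact_eq_seq_compact_metric)
  ultimately obtain F r where r: "strict_mono r" and F: "(f \<circ> r) \<longlonglongrightarrow> F"
    unfolding seq_compact_def by metis
  have Tr: "filterlim (\<lambda>n. T (r n)) at_top sequentially"
    by (rule filterlim_compose[OF T filterlim_subseq[OF r]])
  have \<delta>r: "(\<lambda>n. \<delta> (r n)) \<longlonglongrightarrow> 0"
    using LIMSEQ_subseq_LIMSEQ[OF \<delta> r] by (simp add: o_def)
  have ev: "\<forall>\<^sub>F n in sequentially. t \<le> T (r n)" for t
    using Tr by (simp add: filterlim_at_top)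
  have Fq: "(\<lambda>n. \<gamma> (r n) (q i)) \<longlonglongrightarrow> F i" for i
  proof -
    have "(\<lambda>n. f (r n) i) \<longlonglongrightarrow> F i"
      using continuous_on_tendsto_compose[OF continuous_on_product_coordinates F] by (simp add: o_def)
    moreover have "\<forall>\<^sub>F n in sequentially. f (r n) i = \<gamma> (r n) (q i)"
      using ev[of "q i"] by eventually_elim (simp add: f_def)
    ultimately show ?thesis by (rule Lim_transform_eventually)
  qed
  have "\<exists>l. (\<lambda>n. \<gamma> (r n) t) \<longlonglongrightarrow> l" if t: "0 \<le> t" for t
  proof -
    obtain N where N: "\<And>n. n \<ge> N \<Longrightarrow> t \<le> T (r n)"
      using ev[of t] by (auto simp: eventually_sequentially)
    have "Cauchy (\<lambda>n. \<gamma> (r n) t)"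
      unfolding Cauchy_def
    proof (intro allI impI)
      fix e :: real assume "e > 0"
      then obtain i where i: "\<bar>t - q i\<bar> < e / 8" using q_dense[OF t, of "e / 8"] by auto
      have "\<forall>\<^sub>F n in sequentially. \<delta> (r n) < e / 8 \<and> dist (\<gamma> (r n) (q i)) (F i) < e / 4
          \<and> t \<le> T (r n) \<and> q i \<le> T (r n)"
        using \<open>e > 0\<close> ev
        by (intro eventually_conj order_tendstoD(2)[OF \<delta>r] tendstoD[OF Fq]) auto
      then obtain M where M: "\<And>n. n \<ge> M \<Longrightarrow> \<delta> (r n) < e / 8 \<and> dist (\<gamma> (r n) (q i)) (F i) < e / 4
          \<and> t \<le> T (r n) \<and> q i \<le> T (r n)"
        by (auto simp: eventually_sequentially)
      have close: "dist (\<gamma> (r n) t) (F i) < e / 2" if "n \<ge> M" for n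
        using lip[of t "r n" "q i"] M[OF that] t q_nonneg[of i] i
          dist_triangle[of "\<gamma> (r n) t" "F i" "\<gamma> (r n) (q i)"] by auto
      show "\<exists>M. \<forall>m\<ge>M. \<forall>n\<ge>M. dist (\<gamma> (r m) t) (\<gamma> (r n) t) < e"
        using dist_triangle_half_l[OF close close] by blast
    qed
    then have "Cauchy (\<lambda>n. \<gamma> (r (n + N)) t)"
      using Cauchy_subseq_Cauchy[of "\<lambda>n. \<gamma> (r n) t" "\<lambda>n. n + N"] by (simp add: strict_mono_def o_def)
    moreover have "\<gamma> (r (n + N)) t \<in> cball w (R + t + D)" for n
      using lip[of 0 "r (n + N)" t] start[of "r (n + N)"] N[of "n + N"] t D[of "r (n + N)"]
        dist_triangle[of w "\<gamma> (r (n + N)) t" "\<gamma> (r (n + N)) 0"] by auto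
    ultimately obtain l where "(\<lambda>n. \<gamma> (r (n + N)) t) \<longlonglongrightarrow> l"
      using compact_imp_complete[OF proper, of w "R + t + D"] by (meson completeE)
    then show ?thesis using LIMSEQ_offset[of "\<lambda>n. \<gamma> (r n) t"] by blast
  qed
  then obtain \<gamma>' where \<gamma>': "\<And>t. 0 \<le> t \<Longrightarrow> (\<lambda>n. \<gamma> (r n) t) \<longlonglongrightarrow> \<gamma>' t" by metis
  have "dist (\<gamma>' s) (\<gamma>' t) \<le> \<bar>s - t\<bar>" if st: "0 \<le> s" "0 \<le> t" for s t
  proof -
    have "(\<lambda>n. \<bar>s - t\<bar> + \<delta> (r n)) \<longlonglongrightarrow> \<bar>s - t\<bar> + 0"
      by (intro tendsto_intros \<delta>r)
    moreover have "(\<lambda>n. dist (\<gamma> (r n) s) (\<gamma> (r n) t)) \<longlonglongrightarrow> dist (\<gamma>' s) (\<gamma>' t)"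
      by (intro tendsto_dist \<gamma>' st)
    moreover have "\<forall>\<^sub>F n in sequentially. dist (\<gamma> (r n) s) (\<gamma> (r n) t) \<le> \<bar>s - t\<bar> + \<delta> (r n)"
      using ev[of s] ev[of t] by eventually_elim (use st in \<open>auto intro!: lip\<close>)
    ultimately show ?thesis using tendsto_le[OF sequentially_bot] by fastforce
  qed
  with \<gamma>' r show ?thesis using that by blast
qed

lemma infinite_curve_of_lipschitz:
  fixes \<gamma> :: "real \<Rightarrow> 'a::metric_space"
  assumes lip: "\<And>s t. 0 \<le> s \<Longrightarrow> 0 \<le> t \<Longrightarrow> dist (\<gamma> s) (\<gamma> t) \<le> \<bar>s - t\<bar>"
    and unbounded: "\<And>x r. \<not> \<gamma> ` {0..} \<subseteq> ball x r"
  shows "({0..}, \<gamma>) \<in> infinite_curves"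
proof -
  have "continuous_on {0..} \<gamma>"
    using lip by (intro lipschitz_on_continuous_on[where L = 1] lipschitz_onI) (auto simp: dist_real_def)
  moreover have "\<not> \<gamma> constant_on {0..}"
  proof
    assume "\<gamma> constant_on {0..}"
    then obtain c where "\<forall>x\<in>{0..}. \<gamma> x = c" unfolding constant_on_def by blast
    then show False using unbounded[of c 1] by auto
  qed
  moreover have "curve_length {a..b} \<gamma> < \<infinity>" if "{a..b} \<subseteq> {0..}" for a b
  proof (cases "a \<le> b")
    case True
    then have "0 \<le> a" using that by auto
    then have "curve_length {a..b} \<gamma> \<le> ennreal (b - a)"
      using lip True by (intro curve_length_le_of_lipschitz) auto
    then show ?thesis using le_less_trans by fastforce
  next
    case False
    then show ?thesis using curve_length_mono[of "{a..b}" "{0}" \<gamma>] by auto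
  qed
  ultimately show ?thesis
    using unbounded is_interval_ci by (auto simp: infinite_curves_def locally_rectifiable_def is_curve_def)
qed

text \<open>If cheap chains start in a fixed ball and lead arbitrarily far away, their step paths converge to
  a curve of small line integral. The curve is unbounded because the densities are bounded below on
  bounded sets.\<close>

lemma exists_cheap_infinite_curve:
  fixes g :: "nat \<Rightarrow> 'a::metric_space \<Rightarrow> real"
  assumes proper: "\<And>x r. compact (cball x r :: 'a set)"
    and g_cont: "\<And>n. continuous_on UNIV (g n)"
    and mono: "\<And>x. mono (\<lambda>n. g n x)"
    and lower: "\<And>R. \<exists>m>0. \<forall>x\<in>cball w R. m \<le> g 0 x"
    and nonneg: "\<And>n x. 0 \<le> g n x"
    and chains: "\<And>n. \<exists>x\<in>cball w R. chain_potential (g n) (1 / real (Suc n)) (- ball w (real n)) x < 1"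
  obtains \<gamma> where "({0..}, \<gamma>) \<in> infinite_curves"
    "line_integral ({0..}, \<gamma>) (\<lambda>x. SUP n. ennreal (g n x)) \<le> 1"
proof -
  have [measurable]: "g n \<in> borel_measurable borel" for n
    by (rule borel_measurable_continuous_onI[OF g_cont])
  let ?\<delta> = "\<lambda>n. 1 / real (Suc n)"
  define Q where "Q n T \<gamma> \<longleftrightarrow> 0 \<le> T \<and> \<gamma> \<in> borel_measurable borel \<and> \<gamma> 0 \<in> cball w R \<and>
      \<gamma> T \<notin> ball w (real n) \<and> (\<forall>t\<in>{0..T}. dist (\<gamma> 0) (\<gamma> t) \<le> t) \<and>
      (\<forall>s\<in>{0..T}. \<forall>t\<in>{0..T}. dist (\<gamma> s) (\<gamma> t) \<le> \<bar>s - t\<bar> + ?\<delta> n) \<and>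
      (\<integral>\<^sup>+ t \<in> {0..<T}. ennreal (g n (\<gamma> t)) \<partial>lborel) \<le> 1" for n T \<gamma>
  have "\<exists>T \<gamma>. Q n T \<gamma>" for n
  proof -
    obtain x where x: "x \<in> cball w R" "chain_potential (g n) (?\<delta> n) (- ball w (real n)) x < 1"
      using chains by blast
    obtain c where c: "chain_cost (g n) (?\<delta> n) (- ball w (real n)) x c" "c < 1"
      using chain_potential_less_1[of "g n" "?\<delta> n", OF nonneg _ x(2)] by auto
    obtain T \<gamma> where "0 \<le> T" "\<gamma> \<in> borel_measurable borel" "\<gamma> 0 = x" "\<gamma> T \<in> - ball w (real n)"
      "\<forall>t\<in>{0..T}. dist x (\<gamma> t) \<le> t"
      "\<forall>s\<in>{0..T}. \<forall>t\<in>{0..T}. dist (\<gamma> s) (\<gamma> t) \<le> \<bar>s - t\<bar> + ?\<delta> n"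
      "(\<integral>\<^sup>+ t \<in> {0..<T}. ennreal (g n (\<gamma> t)) \<partial>lborel) = ennreal c"
      using chain_cost_imp_step_path[of "g n" "?\<delta> n", OF nonneg _ c(1)] by auto
    then have "Q n T \<gamma>" using x c by (auto simp: Q_def)
    then show ?thesis by blast
  qed
  then obtain T \<gamma> where "\<And>n. Q n (T n) (\<gamma> n)" by metis
  then have T_nonneg: "\<And>n. 0 \<le> T n"
    and \<gamma>_meas [measurable]: "\<And>n. \<gamma> n \<in> borel_measurable borel"
    and start: "\<And>n. \<gamma> n 0 \<in> cball w R" and exit: "\<And>n. \<gamma> n (T n) \<notin> ball w (real n)"
    and from_start: "\<And>n t. t \<in> {0..T n} \<Longrightarrow> dist (\<gamma> n 0) (\<gamma> n t) \<le> t"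
    and lip: "\<And>n s t. s \<in> {0..T n} \<Longrightarrow> t \<in> {0..T n} \<Longrightarrow> dist (\<gamma> n s) (\<gamma> n t) \<le> \<bar>s - t\<bar> + ?\<delta> n"
    and int: "\<And>n. (\<integral>\<^sup>+ t \<in> {0..<T n}. ennreal (g n (\<gamma> n t)) \<partial>lborel) \<le> 1"
    unfolding Q_def by blast+
  have T_ge: "real n - R \<le> T n" for n
    using from_start[of "T n" n] T_nonneg[of n] start[of n] exit[of n]
      dist_triangle[of w "\<gamma> n (T n)" "\<gamma> n 0"] by auto
  have T: "filterlim T at_top sequentially"
  proof (rule filterlim_at_top_mono)
    show "filterlim (\<lambda>n. real n - R) at_top sequentially"
      using filterlim_tendsto_add_at_top[OF tendsto_const[of "- R"] filterlim_real_sequentially]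
      by (simp add: algebra_simps)
  qed (use T_ge in auto)
  obtain r \<gamma>' where r: "strict_mono r" and conv: "\<And>t. 0 \<le> t \<Longrightarrow> (\<lambda>n. \<gamma> (r n) t) \<longlonglongrightarrow> \<gamma>' t"
    and lip': "\<And>s t. 0 \<le> s \<Longrightarrow> 0 \<le> t \<Longrightarrow> dist (\<gamma>' s) (\<gamma>' t) \<le> \<bar>s - t\<bar>"
    using almost_lipschitz_subseq_limit[OF proper T LIMSEQ_inverse_real_of_nat[unfolded inverse_eq_divide], of \<gamma> w R]
      lip start by metis
  have bound: "(\<integral>\<^sup>+ t \<in> {0..L}. ennreal (g m (\<gamma>' t)) \<partial>lborel) \<le> 1" for m L
  proof -
    let ?f = "\<lambda>n t. ennreal (g m (\<gamma> (r n) t)) * indicator {0..L} t"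
    have "(\<integral>\<^sup>+ t \<in> {0..L}. ennreal (g m (\<gamma>' t)) \<partial>lborel) = (\<integral>\<^sup>+ t. liminf (\<lambda>n. ?f n t) \<partial>lborel)"
    proof (rule nn_integral_cong)
      fix t :: real
      show "ennreal (g m (\<gamma>' t)) * indicator {0..L} t = liminf (\<lambda>n. ?f n t)"
      proof (cases "t \<in> {0..L}")
        case True
        then have "(\<lambda>n. \<gamma> (r n) t) \<longlonglongrightarrow> \<gamma>' t" using conv by auto
        then have "(\<lambda>n. g m (\<gamma> (r n) t)) \<longlonglongrightarrow> g m (\<gamma>' t)"
          by (rule continuous_on_tendsto_compose[OF g_cont]) auto
        then have "(\<lambda>n. ?f n t) \<longlonglongrightarrow> ennreal (g m (\<gamma>' t))"
          using True by (auto intro: tendsto_ennrealI)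
        then show ?thesis using True by (simp add: lim_imp_Liminf)
      qed (simp add: Liminf_const)
    qed
    also have "\<dots> \<le> liminf (\<lambda>n. \<integral>\<^sup>+ t. ?f n t \<partial>lborel)"
      by (rule nn_integral_liminf) auto
    also have "\<dots> \<le> limsup (\<lambda>n. \<integral>\<^sup>+ t. ?f n t \<partial>lborel)"
      by (rule Liminf_le_Limsup) auto
    also have "\<dots> \<le> 1"
    proof (rule Limsup_bounded)
      have "\<forall>\<^sub>F n in sequentially. L < T (r n)"
        using filterlim_compose[OF T filterlim_subseq[OF r]] by (simp add: filterlim_at_top_dense)
      moreover have "\<forall>\<^sub>F n in sequentially. m \<le> r n"
        using filterlim_subseq[OF r] by (simp add: filterlim_at_top)
      ultimately show "\<forall>\<^sub>F n in sequentially. (\<integral>\<^sup>+ t. ?f n t \<partial>lborel) \<le> 1"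
      proof eventually_elim
        case (elim n)
        have "(\<integral>\<^sup>+ t. ?f n t \<partial>lborel) \<le> (\<integral>\<^sup>+ t \<in> {0..<T (r n)}. ennreal (g (r n) (\<gamma> (r n) t)) \<partial>lborel)"
          using elim monoD[OF mono, of m "r n"]
          by (intro nn_integral_mono) (auto simp: indicator_def intro!: ennreal_leI)
        then show ?case using int[of "r n"] by simp
      qed
    qed
    finally show ?thesis .
  qed
  have unbounded: "\<not> \<gamma>' ` {0..} \<subseteq> ball x \<rho>" for x \<rho>
  proof
    assume sub: "\<gamma>' ` {0..} \<subseteq> ball x \<rho>"
    obtain m where m: "m > 0" "\<And>y. y \<in> cball w (dist w x + \<rho>) \<Longrightarrow> m \<le> g 0 y" using lower by blast
    have "m \<le> g 0 (\<gamma>' t)" if "0 \<le> t" for t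
    proof -
      have "\<gamma>' t \<in> ball x \<rho>" using sub that by auto
      then show ?thesis using dist_triangle[of w "\<gamma>' t" x] by (intro m) auto
    qed
    then have "(\<integral>\<^sup>+ t \<in> {0..2 / m}. ennreal m \<partial>lborel) \<le> (\<integral>\<^sup>+ t \<in> {0..2 / m}. ennreal (g 0 (\<gamma>' t)) \<partial>lborel)"
      by (intro nn_integral_mono) (auto simp: indicator_def intro!: ennreal_leI)
    also have "\<dots> \<le> 1" by (rule bound)
    also have "(\<integral>\<^sup>+ t \<in> {0..2 / m}. ennreal m \<partial>lborel) = ennreal 2"
      using m(1) by (simp add: nn_integral_cmult flip: ennreal_mult)
    finally show False by simp
  qed
  have curve: "({0..}, \<gamma>') \<in> infinite_curves"
    by (rule infinite_curve_of_lipschitz[OF lip' unbounded])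
  have "line_integral_on a b \<gamma>' (\<lambda>x. SUP n. ennreal (g n x)) \<le> 1" if ab: "a \<le> b" "{a..b} \<subseteq> {0..}" for a b
  proof -
    have "0 \<le> a" using ab by auto
    interpret rectifiable_curve a b \<gamma>'
      using curve ab by unfold_locales
        (auto simp: infinite_curves_def locally_rectifiable_def is_curve_def intro: continuous_on_subset)
    have "line_integral_on a b \<gamma>' (\<lambda>x. SUP n. ennreal (g n x))
        = (\<integral>\<^sup>+ s. (SUP n. ennreal (g n (clamped_arc s)) * indicator {0..len b} s) \<partial>lborel)"
      unfolding line_integral_on_clamped by (simp add: SUP_mult_right_ennreal)
    also have "\<dots> = (SUP n. line_integral_on a b \<gamma>' (\<lambda>x. ennreal (g n x)))"
      unfolding line_integral_on_clamped
      using mono by (intro nn_integral_monotone_convergence_SUP)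
        (auto simp: incseq_def le_fun_def mono_def intro!: mult_right_mono ennreal_leI)
    also have "\<dots> \<le> 1"
    proof (rule SUP_least)
      fix n
      have "line_integral_on a b \<gamma>' (\<lambda>x. ennreal (g n x)) \<le> (\<integral>\<^sup>+ t \<in> {a..b}. ennreal (g n (\<gamma>' t)) \<partial>lborel)"
        using lip' \<open>0 \<le> a\<close> by (intro line_integral_on_le_parameter_integral) (auto intro: g_cont nonneg)
      also have "\<dots> \<le> (\<integral>\<^sup>+ t \<in> {0..b}. ennreal (g n (\<gamma>' t)) \<partial>lborel)"
        using \<open>0 \<le> a\<close> by (intro nn_integral_mono) (auto simp: indicator_def)
      also have "\<dots> \<le> 1" by (rule bound)
      finally show "line_integral_on a b \<gamma>' (\<lambda>x. ennreal (g n x)) \<le> 1" .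
    qed
    finally show ?thesis .
  qed
  then have "line_integral ({0..}, \<gamma>') (\<lambda>x. SUP n. ennreal (g n x)) \<le> 1"
    unfolding line_integral_def by (auto intro!: SUP_least)
  with curve show ?thesis using that by blast
qed

section \<open>Approximation of densities from above\<close>

text \<open>Closed sets are intersections of decreasing sequences of open neighbourhoods, and approximability
  from both sides passes to complements and countable unions.\<close>

lemma finite_borel_measure_regular:
  fixes N :: "'a::metric_space measure"
  assumes N: "sets N = sets borel" "finite_measure N" and A: "A \<in> sets borel" and "e > 0"
  shows "\<exists>F U. closed F \<and> open U \<and> F \<subseteq> A \<and> A \<subseteq> U \<and> measure N (U - F) < e"
proof -
  interpret finite_measure N by fact
  note [simp] = N(1)
  have "A \<in> sigma_sets UNIV (Collect closed)" using A by (simp add: borel_eq_closed)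
  then show ?thesis using \<open>e > 0\<close>
  proof (induction arbitrary: e rule: sigma_sets.induct)
    case (Basic F)
    then have F: "closed F" by simp
    show ?case
    proof (cases "F = {}")
      case True
      then show ?thesis using Basic by (intro exI[of _ "{}"]) auto
    next
      case False
      define U where "U n = {x. infdist x F < 1 / real (Suc n)}" for n
      have opU: "open (U n)" for n
        unfolding U_def by (intro open_Collect_less continuous_intros)
      have sub: "F \<subseteq> U n" for n by (auto simp: U_def)
      have dec: "decseq (\<lambda>n. U n - F)"
        by (auto simp: decseq_def U_def frac_le intro: less_le_trans)
      have empty: "(\<Inter>n. U n - F) = {}"
      proof -
        have "x \<in> F" if "\<And>n. x \<in> U n" for x
        proof (rule ccontr)
          assume "x \<notin> F"
          then have "0 < infdist x F" using infdist_pos_not_in_closed F False by blast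
          then obtain n where "1 / real (Suc n) < infdist x F" using nat_approx_posE by blast
          then show False using that[of n] by (simp add: U_def)
        qed
        then show ?thesis by blast
      qed
      have "range (\<lambda>n. U n - F) \<subseteq> sets N" using opU F by auto
      from finite_Lim_measure_decseq[OF this dec] have "(\<lambda>n. measure N (U n - F)) \<longlonglongrightarrow> 0"
        unfolding empty by simp
      then have "\<forall>\<^sub>F n in sequentially. measure N (U n - F) < e"
        using Basic(2) by (rule order_tendstoD)
      then obtain n where "measure N (U n - F) < e" by (auto simp: eventually_sequentially)
      then show ?thesis using opU sub F by blast
    qed
  next
    case Empty
    then show ?case by (intro exI[of _ "{}"]) auto
  next
    case (Compl A)
    obtain F U where "closed F" "open U" "F \<subseteq> A" "A \<subseteq> U" "measure N (U - F) < e"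
      using Compl.IH[OF Compl.prems] by blast
    moreover have "- F - - U = U - F" by auto
    ultimately show ?case by (intro exI[of _ "- U"] exI[of _ "- F"]) auto
  next
    case (Union A)
    define d where "d i = e / 2 * (1 / 2) ^ Suc i" for i
    have "\<forall>i. \<exists>F U. closed F \<and> open U \<and> F \<subseteq> A i \<and> A i \<subseteq> U \<and> measure N (U - F) < d i"
      by (intro allI Union.IH) (use Union.prems in \<open>simp add: d_def\<close>)
    then obtain F U where FU: "\<And>i. closed (F i)" "\<And>i. open (U i)" "\<And>i. F i \<subseteq> A i" "\<And>i. A i \<subseteq> U i"
      "\<And>i. measure N (U i - F i) < d i"
      by metis
    have d: "d sums (e / 2)"
      unfolding d_def using sums_mult[OF power_half_series, of "e / 2"] by simp
    have meas: "U i - F i \<in> sets N" "U i \<in> sets N" "F i \<in> sets N" for i using FU by auto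
    have summ: "summable (\<lambda>i. measure N (U i - F i))"
      by (rule summable_comparison_test'[OF sums_summable[OF d]]) (use FU(5) in \<open>auto intro: less_imp_le\<close>)
    have "measure N ((\<Union>i. U i) - (\<Union>i. F i)) \<le> measure N (\<Union>i. U i - F i)"
      using meas by (intro finite_measure_mono) auto
    also have "\<dots> \<le> (\<Sum>i. measure N (U i - F i))"
      using meas by (intro finite_measure_subadditive_countably summ) auto
    also have "\<dots> \<le> (\<Sum>i. d i)"
      using FU(5) by (intro suminf_le summ sums_summable[OF d]) (auto intro: less_imp_le)
    also have "\<dots> < e" using sums_unique[OF d] Union.prems by simp
    finally have small: "measure N ((\<Union>i. U i) - (\<Union>i. F i)) < e" .
    define D where "D n = (\<Union>i. U i) - (\<Union>i<n. F i)" for n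
    have "range D \<subseteq> sets N" using meas by (auto simp: D_def)
    moreover have "decseq D" by (force simp: decseq_def D_def)
    moreover have "(\<Inter>n. D n) = (\<Union>i. U i) - (\<Union>i. F i)" by (auto simp: D_def)
    ultimately have "(\<lambda>n. measure N (D n)) \<longlonglongrightarrow> measure N ((\<Union>i. U i) - (\<Union>i. F i))"
      using finite_Lim_measure_decseq[of D] by simp
    then have "\<forall>\<^sub>F n in sequentially. measure N (D n) < e" using small by (rule order_tendstoD)
    then obtain n where "measure N (D n) < e" by (auto simp: eventually_sequentially)
    moreover have "closed (\<Union>i<n. F i)" "open (\<Union>i. U i)" using FU by auto
    moreover have "(\<Union>i<n. F i) \<subseteq> \<Union> (range A)" "\<Union> (range A) \<subseteq> (\<Union>i. U i)" using FU(3,4) by blast+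
    ultimately show ?case unfolding D_def by blast
  qed
qed

lemma finite_borel_measure_outer_regular:
  fixes N :: "'a::metric_space measure"
  assumes N: "sets N = sets borel" "finite_measure N" and A: "A \<in> sets borel" and "e > 0"
  obtains U where "open U" "A \<subseteq> U" "emeasure N U \<le> emeasure N A + ennreal e"
proof -
  interpret finite_measure N by fact
  obtain F U where FU: "closed F" "open U" "F \<subseteq> A" "A \<subseteq> U" "measure N (U - F) < e"
    using finite_borel_measure_regular[OF assms] by blast
  have "emeasure N U \<le> emeasure N (A \<union> (U - F))"
    using FU N A by (intro emeasure_mono) auto
  also have "\<dots> \<le> emeasure N A + emeasure N (U - F)"
    using FU N A by (intro emeasure_subadditive) auto
  also have "\<dots> \<le> emeasure N A + ennreal e"
    using FU by (intro add_left_mono) (auto simp: emeasure_eq_measure intro: ennreal_leI)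
  finally show ?thesis using that FU by blast
qed

lemma open_indicator_continuous_approx:
  fixes U :: "'a::metric_space set"
  assumes "open U"
  obtains h :: "nat \<Rightarrow> 'a \<Rightarrow> real" where
    "\<And>k. continuous_on UNIV (h k)" "\<And>k x. 0 \<le> h k x" "\<And>k x. h k x \<le> indicator U x"
    "\<And>x. mono (\<lambda>k. h k x)" "\<And>x. x \<in> U \<Longrightarrow> \<exists>k. h k x = 1"
proof (cases "U = UNIV")
  case True
  then show ?thesis by (intro that[of "\<lambda>_ _. 1"]) (auto simp: mono_def)
next
  case False
  define h where "h k x = min 1 (real k * infdist x (- U))" for k x
  show ?thesis
  proof (rule that[of h])
    show "continuous_on UNIV (h k)" for k unfolding h_def by (intro continuous_intros)
    show "0 \<le> h k x" for k x by (simp add: h_def infdist_nonneg)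
    show "h k x \<le> indicator U x" for k x
      by (auto simp: h_def indicator_def)
    show "mono (\<lambda>k. h k x)" for x
      unfolding mono_def h_def by (intro allI impI min.mono order_refl mult_right_mono infdist_nonneg) simp
    show "\<exists>k. h k x = 1" if "x \<in> U" for x
    proof -
      have "0 < infdist x (- U)"
        using infdist_pos_not_in_closed[of "- U" x] assms False that by auto
      then obtain k where "1 < real k * infdist x (- U)" using reals_Archimedean3 by blast
      then show ?thesis by (intro exI[of _ k]) (simp add: h_def)
    qed
  qed
qed

lemma ball_subset_ball_of_dist: "dist x y + r \<le> s \<Longrightarrow> ball x r \<subseteq> ball y s"
proof
  fix z assume "dist x y + r \<le> s" "z \<in> ball x r"
  then show "z \<in> ball y s" using dist_triangle[of y z x] by (simp add: dist_commute)
qed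

lemma term_le_suminf_ennreal:
  fixes f :: "nat \<Rightarrow> ennreal"
  shows "f k \<le> (\<Sum>k. f k)"
  using sum_le_suminf[of f "{k}"] by simp

lemma dyadic_bracket:
  fixes t :: real
  assumes "1 \<le> t"
  obtains k :: nat where "2 ^ k \<le> t" "t < 2 ^ (k + 1)"
proof -
  let ?n = "LEAST n. t < 2 ^ n"
  have ex: "\<exists>n. t < 2 ^ n" using real_arch_pow[of 2 t] by simp
  then have n: "t < 2 ^ ?n" by (rule LeastI_ex)
  then have "?n \<noteq> 0" using assms by (intro notI) simp
  then obtain k where k: "?n = Suc k" using not0_implies_Suc by blast
  then have "\<not> t < 2 ^ k" using not_less_Least[of k "\<lambda>n. t < 2 ^ n"] by simp
  then show ?thesis using that[of k] n k by simp
qed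

text \<open>A form of the Vitali--Caratheodory theorem: a density in \<open>L\<^sup>p\<close> is dominated by an increasing limit
  of continuous densities of comparable norm. The superlevel sets of \<open>\<rho> / \<eta>\<close> at the dyadic levels
  are enlarged to open sets, using outer regularity of the finite measure with density \<open>\<eta>\<^sup>p\<close>.\<close>

lemma continuous_majorant_sequence:
  fixes M :: "'a::metric_space measure" and \<eta> :: "'a \<Rightarrow> real" and \<rho> :: "'a \<Rightarrow> ennreal"
  assumes M: "sets M = sets borel" and p: "1 \<le> p"
    and \<eta>: "continuous_on UNIV \<eta>" "\<And>x. 0 < \<eta> x" "(\<integral>\<^sup>+ x. ennreal (\<eta> x powr p) \<partial>M) < \<infinity>"
    and \<rho> [measurable]: "\<rho> \<in> borel_measurable borel" and e: "0 < e"
  obtains g :: "nat \<Rightarrow> 'a \<Rightarrow> real" where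
    "\<And>n. continuous_on UNIV (g n)" "\<And>x. mono (\<lambda>n. g n x)" "\<And>n x. \<eta> x \<le> g n x"
    "\<And>x. \<rho> x \<le> (SUP n. ennreal (g n x))"
    "\<And>n. (\<integral>\<^sup>+ x. ennreal (g n x) epowr p \<partial>M)
        \<le> ennreal (2 powr p) * (\<integral>\<^sup>+ x. \<rho> x epowr p \<partial>M) + (\<integral>\<^sup>+ x. ennreal (\<eta> x powr p) \<partial>M) + ennreal e"
proof -
  have sp: "space M = UNIV" using sets_eq_imp_space_eq[OF M] by simp
  have meas: "f \<in> borel_measurable M \<longleftrightarrow> f \<in> borel_measurable borel" for f :: "'a \<Rightarrow> ennreal"
    by (simp only: measurable_cong_sets[OF M refl])
  have [measurable]: "\<eta> \<in> borel_measurable borel" by (rule borel_measurable_continuous_onI[OF \<eta>(1)])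
  define N where "N = density M (\<lambda>x. ennreal (\<eta> x powr p))"
  have N: "sets N = sets borel" by (simp add: N_def M)
  have emN: "emeasure N A = (\<integral>\<^sup>+ x. ennreal (\<eta> x powr p) * indicator A x \<partial>M)" if "A \<in> sets borel" for A
    unfolding N_def using that by (subst emeasure_density) (auto simp: M meas)
  have spN: "space N = UNIV" by (simp add: N_def sp)
  have fin: "finite_measure N"
    by (rule finite_measureI) (use \<eta>(3) emN[of UNIV] in \<open>simp add: spN less_top\<close>)
  \<comment> \<open>The points where \<open>\<rho>\<close> is infinite belong to every level, so that the majorant is infinite there.\<close>
  define E where "E j = {x. ennreal (2 ^ j * \<eta> x) < \<rho> x \<and> (\<rho> x \<le> ennreal (2 ^ (j + 1) * \<eta> x) \<or> \<rho> x = \<infinity>)}"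
    for j :: nat
  have E [measurable]: "E j \<in> sets borel" for j unfolding E_def by measurable
  \<comment> \<open>The level \<open>j\<close> enters the integral with the factor \<open>(2\<^sup>j\<^sup>+\<^sup>1)\<^sup>p\<close>, which is divided out here.\<close>
  define \<epsilon> where "\<epsilon> j = e * (1 / 2) ^ Suc j / (2 ^ (j + 1)) powr p" for j :: nat
  have "0 < \<epsilon> j" for j using e by (simp add: \<epsilon>_def)
  have "\<exists>U. open U \<and> E j \<subseteq> U \<and> emeasure N U \<le> emeasure N (E j) + ennreal (\<epsilon> j)" for j
    using finite_borel_measure_outer_regular[OF N fin E \<open>0 < \<epsilon> j\<close>] by blast
  then obtain U where U: "\<And>j. open (U j)" "\<And>j. E j \<subseteq> U j"
    "\<And>j. emeasure N (U j) \<le> emeasure N (E j) + ennreal (\<epsilon> j)"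
    by metis
  have "\<exists>h :: nat \<Rightarrow> 'a \<Rightarrow> real. (\<forall>k. continuous_on UNIV (h k)) \<and> (\<forall>k x. 0 \<le> h k x) \<and>
      (\<forall>k x. h k x \<le> indicator (U j) x) \<and> (\<forall>x. mono (\<lambda>k. h k x)) \<and> (\<forall>x\<in>U j. \<exists>k. h k x = 1)"
    for j by (rule open_indicator_continuous_approx[OF U(1)[of j]]) blast
  then obtain h :: "nat \<Rightarrow> nat \<Rightarrow> 'a \<Rightarrow> real" where h: "\<And>j k. continuous_on UNIV (h j k)"
    "\<And>j k x. 0 \<le> h j k x" "\<And>j k x. h j k x \<le> indicator (U j) x" "\<And>j x. mono (\<lambda>k. h j k x)"
    "\<And>j x. x \<in> U j \<Longrightarrow> \<exists>k. h j k x = 1"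
    by metis
  \<comment> \<open>A maximum rather than a sum over the levels keeps the \<open>p\<close>-th power under control.\<close>
  define m where "m k j x = rec_nat 1 (\<lambda>i v. max v (2 ^ (i + 1) * h i k x)) j" for k j x
  have m_0: "m k 0 x = 1" and m_Suc: "m k (Suc j) x = max (m k j x) (2 ^ (j + 1) * h j k x)" for k j x
    by (simp_all add: m_def)
  have m_ge_1: "1 \<le> m k j x" for k j x by (induction j) (auto simp: m_0 m_Suc)
  have m_cont: "continuous_on UNIV (m k j)" for k j
  proof (induction j)
    case 0
    have "m k 0 = (\<lambda>_. 1)" by (auto simp: m_0)
    then show ?case by simp
  next
    case (Suc j)
    have "m k (Suc j) = (\<lambda>x. max (m k j x) (2 ^ (j + 1) * h j k x))" by (auto simp: m_Suc)
    then show ?case using Suc h(1) by (auto intro!: continuous_intros)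
  qed
  have m_mono_k: "m k j x \<le> m k' j x" if "k \<le> k'" for k k' j x
  proof (induction j)
    case (Suc j)
    then show ?case
      unfolding m_Suc by (intro max.mono mult_left_mono monoD[OF h(4) that]) auto
  qed (simp add: m_0)
  have m_mono_j: "m k j x \<le> m k j' x" if "j \<le> j'" for k j j' x
    using that by (rule lift_Suc_mono_le[of "\<lambda>j. m k j x", rotated]) (simp add: m_Suc)
  have m_ge: "2 ^ (i + 1) * h i k x \<le> m k j x" if "i < j" for i j k x
  proof -
    have "2 ^ (i + 1) * h i k x \<le> m k (Suc i) x" by (simp add: m_Suc)
    also have "\<dots> \<le> m k j x" using that by (intro m_mono_j) auto
    finally show ?thesis .
  qed
  have m_powr: "m k j x powr p \<le> 1 + (\<Sum>i<j. (2 ^ (i + 1)) powr p * indicator (U i) x)" for k j x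
  proof (induction j)
    case (Suc j)
    have "(2 ^ (j + 1) * h j k x) powr p \<le> (2 ^ (j + 1) * indicator (U j) x) powr p"
      using p h(2,3)[of j k x] by (intro powr_mono2) auto
    also have "\<dots> = (2 ^ (j + 1)) powr p * indicator (U j) x" using p by (auto simp: indicator_def)
    finally have "(2 ^ (j + 1) * h j k x) powr p \<le> (2 ^ (j + 1)) powr p * indicator (U j) x" .
    moreover have "m k (Suc j) x powr p \<le> m k j x powr p + (2 ^ (j + 1) * h j k x) powr p"
      by (simp add: m_Suc max_def)
    ultimately show ?case using Suc unfolding sum.lessThan_Suc by linarith
  qed (simp add: m_0)
  define g where "g k x = \<eta> x * m k k x" for k x
  have g_ge: "\<eta> x \<le> g k x" for k x using \<eta>(2)[of x] m_ge_1[of k k x] by (simp add: g_def)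
  have g_cont: "continuous_on UNIV (g k)" for k unfolding g_def by (intro continuous_intros \<eta>(1) m_cont)
  have g_mono: "mono (\<lambda>k. g k x)" for x
  proof (rule monoI)
    fix k k' :: nat assume "k \<le> k'"
    then have "m k k x \<le> m k' k' x" using m_mono_k m_mono_j order_trans by blast
    then show "g k x \<le> g k' x" using \<eta>(2)[of x] by (simp add: g_def)
  qed
  have reach: "\<exists>k. 2 ^ (j + 1) * \<eta> x \<le> g k x" if "x \<in> E j" for j x
  proof -
    obtain k where k: "h j k x = 1" using h(5) U(2) \<open>x \<in> E j\<close> by blast
    let ?n = "max k (j + 1)"
    have "1 \<le> h j ?n x" using monoD[OF h(4), of k ?n j x] k by simp
    then have "2 ^ (j + 1) \<le> 2 ^ (j + 1) * h j ?n x" by simp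
    also have "\<dots> \<le> m ?n ?n x" by (intro m_ge) auto
    finally show ?thesis using \<eta>(2)[of x] by (intro exI[of _ ?n]) (simp add: g_def mult.commute)
  qed
  have cover: "\<rho> x \<le> (SUP n. ennreal (g n x))" for x
  proof (cases "\<rho> x")
    case (real r)
    show ?thesis
    proof (cases "r \<le> \<eta> x")
      case True
      then have "\<rho> x \<le> ennreal (g 0 x)" using real g_ge[of x 0] by (auto intro: ennreal_leI)
      then show ?thesis by (rule SUP_upper2[OF UNIV_I])
    next
      case False
      obtain k where "r / \<eta> x < 2 ^ k" using real_arch_pow[of 2 "r / \<eta> x"] by auto
      then have ex: "\<exists>k. r \<le> 2 ^ k * \<eta> x"
        using \<eta>(2)[of x] by (auto simp: field_simps intro!: exI[of _ k] less_imp_le)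
      let ?n = "LEAST k. r \<le> 2 ^ k * \<eta> x"
      have n: "r \<le> 2 ^ ?n * \<eta> x" using ex by (rule LeastI_ex)
      have "?n \<noteq> 0" using n False by (intro notI) simp
      then obtain j where j: "?n = Suc j" using not0_implies_Suc by blast
      then have "\<not> r \<le> 2 ^ j * \<eta> x" using not_less_Least[of j "\<lambda>k. r \<le> 2 ^ k * \<eta> x"] by simp
      then have "x \<in> E j"
        using n real \<eta>(2)[of x] unfolding j by (auto simp: E_def intro!: ennreal_lessI ennreal_leI)
      then obtain k where "2 ^ (j + 1) * \<eta> x \<le> g k x" using reach by blast
      then have "\<rho> x \<le> ennreal (g k x)" using real n unfolding j by (auto intro!: ennreal_leI)
      then show ?thesis by (rule SUP_upper2[OF UNIV_I])
    qed
  next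
    case top
    have large: "ennreal y \<le> (SUP n. ennreal (g n x))" for y
    proof -
      obtain j where "y / \<eta> x < 2 ^ j" using real_arch_pow[of 2 "y / \<eta> x"] by auto
      then have "y < 2 ^ j * \<eta> x" "0 < 2 ^ j * \<eta> x" using \<eta>(2)[of x] by (simp_all add: field_simps)
      then have j: "y \<le> 2 ^ (j + 1) * \<eta> x" by simp
      have "x \<in> E j" using top by (auto simp: E_def)
      then obtain k where "2 ^ (j + 1) * \<eta> x \<le> g k x" using reach by blast
      then have "ennreal y \<le> ennreal (g k x)" using j by (auto intro!: ennreal_leI)
      then show ?thesis by (rule SUP_upper2[OF UNIV_I])
    qed
    show ?thesis
    proof (cases "SUP n. ennreal (g n x)")
      case (real s)
      then have "ennreal (s + 1) \<le> ennreal s" using large[of "s + 1"] by simp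
      then show ?thesis using real(1) by (simp add: ennreal_le_iff)
    qed (simp only: top_greatest)
  qed
  have levels: "(\<Sum>i<k. ennreal ((2 ^ (i + 1)) powr p) * (ennreal (\<eta> x powr p) * indicator (E i) x))
      \<le> ennreal (2 powr p) * \<rho> x epowr p" for k x
  proof (cases "\<rho> x")
    case (real r)
    have uniq: "i = j" if "x \<in> E i" "x \<in> E j" for i j
    proof -
      have "\<not> i < j" if "x \<in> E i" "x \<in> E j" for i j
      proof
        assume "i < j"
        then have "(2::real) ^ (i + 1) \<le> 2 ^ j" by (intro power_increasing) auto
        then have "ennreal (2 ^ (i + 1) * \<eta> x) \<le> ennreal (2 ^ j * \<eta> x)"
          using \<eta>(2)[of x] by (intro ennreal_leI mult_right_mono) auto
        then show False using that real unfolding E_def by auto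
      qed
      then show ?thesis using that by (meson linorder_neqE_nat)
    qed
    show ?thesis
    proof (cases "\<exists>j. x \<in> E j")
      case True
      then obtain j where j: "x \<in> E j" by blast
      then have "2 ^ (j + 1) * \<eta> x \<le> 2 * r"
        using real \<eta>(2)[of x] by (auto simp: E_def ennreal_less_iff)
      have "(\<Sum>i<k. ennreal ((2 ^ (i + 1)) powr p) * (ennreal (\<eta> x powr p) * indicator (E i) x))
        = (\<Sum>i<k. if i = j then ennreal ((2 ^ (j + 1)) powr p) * ennreal (\<eta> x powr p) else 0)"
        using uniq j by (intro sum.cong) (auto simp: indicator_def)
      also have "\<dots> \<le> ennreal ((2 ^ (j + 1)) powr p) * ennreal (\<eta> x powr p)"
        by simp
      also have "\<dots> = ennreal ((2 ^ (j + 1) * \<eta> x) powr p)"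
        using \<eta>(2)[of x] by (simp add: powr_mult ennreal_mult)
      also have "\<dots> \<le> ennreal ((2 * r) powr p)"
        using p \<eta>(2)[of x] \<open>2 ^ (j + 1) * \<eta> x \<le> 2 * r\<close> by (intro ennreal_leI powr_mono2) auto
      also have "\<dots> = ennreal (2 powr p) * \<rho> x epowr p"
        using real p by (simp add: ennreal_epowr powr_mult ennreal_mult)
      finally show ?thesis .
    next
      case False
      then show ?thesis by (simp add: indicator_def)
    qed
  next
    case top
    then show ?thesis using p by (simp add: ennreal_mult_top)
  qed
  have bound: "(\<integral>\<^sup>+ x. ennreal (g k x) epowr p \<partial>M)
      \<le> ennreal (2 powr p) * (\<integral>\<^sup>+ x. \<rho> x epowr p \<partial>M) + (\<integral>\<^sup>+ x. ennreal (\<eta> x powr p) \<partial>M) + ennreal e" for k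
  proof -
    have [measurable]: "U j \<in> sets borel" for j using U(1) by auto
    have "(\<integral>\<^sup>+ x. ennreal (g k x) epowr p \<partial>M)
      \<le> (\<integral>\<^sup>+ x. ennreal (\<eta> x powr p)
          + (\<Sum>i<k. ennreal ((2 ^ (i + 1)) powr p) * (ennreal (\<eta> x powr p) * indicator (U i) x)) \<partial>M)"
    proof (rule nn_integral_mono)
      fix x
      have "ennreal (g k x) epowr p = ennreal (\<eta> x powr p * m k k x powr p)"
        using p \<eta>(2)[of x] m_ge_1[of k k x] by (simp add: g_def ennreal_epowr powr_mult)
      also have "\<dots> \<le> ennreal (\<eta> x powr p * (1 + (\<Sum>i<k. (2 ^ (i + 1)) powr p * indicator (U i) x)))"
        by (intro ennreal_leI mult_left_mono m_powr) auto
      also have "\<dots> = ennreal (\<eta> x powr p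
          + (\<Sum>i<k. (2 ^ (i + 1)) powr p * (\<eta> x powr p * indicator (U i) x)))"
        by (simp add: algebra_simps sum_distrib_left)
      also have "\<dots> = ennreal (\<eta> x powr p)
          + (\<Sum>i<k. ennreal ((2 ^ (i + 1)) powr p) * (ennreal (\<eta> x powr p) * indicator (U i) x))"
        by (subst ennreal_plus) (auto simp: sum_nonneg sum_ennreal[symmetric] ennreal_mult ennreal_indicator)
      finally show "ennreal (g k x) epowr p \<le> \<dots>" .
    qed
    also have "\<dots> = (\<integral>\<^sup>+ x. ennreal (\<eta> x powr p) \<partial>M)
        + (\<Sum>i<k. ennreal ((2 ^ (i + 1)) powr p) * emeasure N (U i))"
      by (simp add: nn_integral_add nn_integral_sum nn_integral_cmult meas emN)
    also have "(\<Sum>i<k. ennreal ((2 ^ (i + 1)) powr p) * emeasure N (U i))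
        \<le> (\<Sum>i<k. ennreal ((2 ^ (i + 1)) powr p) * emeasure N (E i) + ennreal (e * (1 / 2) ^ Suc i))"
    proof (rule sum_mono)
      fix i
      have "ennreal ((2 ^ (i + 1)) powr p) * emeasure N (U i)
          \<le> ennreal ((2 ^ (i + 1)) powr p) * (emeasure N (E i) + ennreal (\<epsilon> i))"
        by (intro mult_left_mono U(3)) auto
      also have "\<dots> = ennreal ((2 ^ (i + 1)) powr p) * emeasure N (E i)
          + ennreal ((2 ^ (i + 1)) powr p * \<epsilon> i)"
        using \<open>\<epsilon> i > 0\<close> by (simp add: distrib_left ennreal_mult)
      also have "(2 ^ (i + 1)) powr p * \<epsilon> i = e * (1 / 2) ^ Suc i" by (simp add: \<epsilon>_def)
      finally show "ennreal ((2 ^ (i + 1)) powr p) * emeasure N (U i)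
        \<le> ennreal ((2 ^ (i + 1)) powr p) * emeasure N (E i) + ennreal (e * (1 / 2) ^ Suc i)" .
    qed
    also have "\<dots> = (\<Sum>i<k. ennreal ((2 ^ (i + 1)) powr p) * emeasure N (E i))
        + ennreal (\<Sum>i<k. e * (1 / 2) ^ Suc i)"
      using e by (simp add: sum.distrib sum_ennreal)
    also have "(\<Sum>i<k. ennreal ((2 ^ (i + 1)) powr p) * emeasure N (E i))
        = (\<integral>\<^sup>+ x. (\<Sum>i<k. ennreal ((2 ^ (i + 1)) powr p) * (ennreal (\<eta> x powr p) * indicator (E i) x)) \<partial>M)"
      by (simp add: nn_integral_sum nn_integral_cmult meas emN)
    also have "\<dots> \<le> (\<integral>\<^sup>+ x. ennreal (2 powr p) * \<rho> x epowr p \<partial>M)"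
      by (intro nn_integral_mono levels)
    also have "\<dots> = ennreal (2 powr p) * (\<integral>\<^sup>+ x. \<rho> x epowr p \<partial>M)"
      by (simp add: nn_integral_cmult meas)
    also have "(\<Sum>i<k. e * (1 / 2) ^ Suc i) \<le> (\<Sum>i. e * (1 / 2) ^ Suc i)"
      using e by (intro sum_le_suminf sums_summable[OF sums_mult[OF power_half_series]]) auto
    also have "\<dots> = e" using sums_unique[OF sums_mult[OF power_half_series, of e]] by simp
    finally show ?thesis by (simp add: add_ac add_left_mono add_right_mono ennreal_leI)
  qed
  show ?thesis by (rule that[of g]) (fact g_cont g_mono g_ge cover bound)+
qed

section \<open>Doubling measures\<close>

locale doubling_space =
  fixes M :: "'a::metric_space measure"
  assumes sets_M: "sets M = sets borel" and doubling: "doubling_measure M"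
begin

lemma measurable_M_iff: "f \<in> measurable M N \<longleftrightarrow> f \<in> measurable borel N"
  by (simp only: measurable_cong_sets[OF sets_M refl])

lemma ball_sets [measurable, simp]: "ball x r \<in> sets M"
  by (simp add: sets_M)

lemma emeasure_ball_finite: "emeasure M (ball x r) < \<infinity>"
proof (cases "r > 0")
  case True
  then show ?thesis using doubling by (auto simp: doubling_measure_def balls_finite_positive_def)
qed (auto simp: ball_eq_empty[THEN iffD2])

lemma emeasure_ball: "emeasure M (ball x r) = ennreal (measure M (ball x r))"
  using emeasure_ball_finite[of x r] by (simp add: emeasure_eq_ennreal_measure less_top)

lemma measure_ball_pos: "0 < r \<Longrightarrow> 0 < measure M (ball x r)"
  using doubling emeasure_ball[of x r]
  by (auto simp: doubling_measure_def balls_finite_positive_def zero_less_measure_iff)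
    (metis ennreal_0 less_irrefl measure_nonneg order_le_less)

lemma fmeasurable_ball: "ball x r \<in> fmeasurable M"
  using emeasure_ball_finite by (intro fmeasurableI) auto

lemma bounded_fmeasurable: "A \<in> sets borel \<Longrightarrow> A \<subseteq> ball x r \<Longrightarrow> A \<in> fmeasurable M"
  by (rule fmeasurableI2[OF fmeasurable_ball]) (auto simp: sets_M)

lemma measure_mono_ball: "A \<in> sets borel \<Longrightarrow> A \<subseteq> ball x r \<Longrightarrow> measure M A \<le> measure M (ball x r)"
  by (rule measure_mono_fmeasurable) (auto simp: sets_M fmeasurable_ball)

lemma doubling_iterated:
  obtains C where "1 \<le> C" "\<And>x r k. 0 < r \<Longrightarrow> measure M (ball x (2 ^ k * r)) \<le> C ^ k * measure M (ball x r)"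
proof -
  obtain C where C: "C \<ge> 1" "\<And>x r. r > 0 \<Longrightarrow> emeasure M (ball x (2 * r)) \<le> ennreal C * emeasure M (ball x r)"
    using doubling by (auto simp: doubling_measure_def)
  have one: "measure M (ball x (2 * r)) \<le> C * measure M (ball x r)" if "r > 0" for x r
  proof -
    have "ennreal (measure M (ball x (2 * r))) \<le> ennreal (C * measure M (ball x r))"
      using C(2)[OF that, of x] C(1) by (simp add: emeasure_ball ennreal_mult)
    then show ?thesis using C(1) by (simp add: ennreal_le_iff)
  qed
  have "measure M (ball x (2 ^ k * r)) \<le> C ^ k * measure M (ball x r)" if "r > 0" for x r k
  proof (induction k)
    case (Suc k)
    have "measure M (ball x (2 * (2 ^ k * r))) \<le> C * measure M (ball x (2 ^ k * r))"
      using that by (intro one) auto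
    also have "\<dots> \<le> C * (C ^ k * measure M (ball x r))"
      using Suc C(1) by (intro mult_left_mono) auto
    finally show ?case by (simp add: mult.assoc)
  qed simp
  then show ?thesis using that C(1) by blast
qed

text \<open>The larger ball lies in a dilation of the smaller one by a fixed power of two.\<close>

lemma ball_measure_comparison:
  fixes \<kappa> :: real
  obtains A where "1 \<le> A"
    "\<And>x y r s. 0 < s \<Longrightarrow> r \<le> \<kappa> * s \<Longrightarrow> dist x y < r \<Longrightarrow> measure M (ball x r) \<le> A * measure M (ball y s)"
proof -
  obtain C where C: "1 \<le> C"
    "\<And>x r k. 0 < r \<Longrightarrow> measure M (ball x (2 ^ k * r)) \<le> C ^ k * measure M (ball x r)"
    using doubling_iterated by blast
  obtain k where k: "2 * \<kappa> < 2 ^ k" using real_arch_pow[of 2 "2 * \<kappa>"] by auto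
  have "measure M (ball x r) \<le> C ^ k * measure M (ball y s)"
    if "0 < s" "r \<le> \<kappa> * s" "dist x y < r" for x y r s
  proof -
    have "2 * r \<le> (2 * \<kappa>) * s" using that by simp
    also have "\<dots> \<le> 2 ^ k * s" using k that by (intro mult_right_mono) auto
    finally have "ball x r \<subseteq> ball y (2 ^ k * s)"
      using that by (intro ball_subset_ball_of_dist) (auto simp: dist_commute)
    then have "measure M (ball x r) \<le> measure M (ball y (2 ^ k * s))" by (intro measure_mono_ball) auto
    also have "\<dots> \<le> C ^ k * measure M (ball y s)" using that by (intro C)
    finally show ?thesis .
  qed
  moreover have "1 \<le> C ^ k" using C(1) by simp
  ultimately show ?thesis using that by blast
qed

text \<open>Disjoint balls of a fixed radius inside a given ball are uniformly bounded in number, so closed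
  balls are totally bounded.\<close>

lemma compact_cball_of_doubling:
  assumes "complete (UNIV :: 'a set)"
  shows "compact (cball x r :: 'a set)"
  unfolding compact_eq_totally_bounded
proof (intro conjI allI impI)
  show "complete (cball x r)"
    using complete_closed_subset[OF closed_cball subset_UNIV assms] .
  fix e :: real assume e: "e > 0"
  define \<R> where "\<R> = \<bar>r\<bar> + e"
  have \<R>: "\<R> > 0" using e by (simp add: \<R>_def)
  obtain A where A: "1 \<le> A" "\<And>x y r s. 0 < s \<Longrightarrow> r \<le> 2 * \<R> / e * s \<Longrightarrow> dist x y < r \<Longrightarrow>
      measure M (ball x r) \<le> A * measure M (ball y s)"
    using ball_measure_comparison[of "2 * \<R> / e"] by blast
  define sep where "sep S \<longleftrightarrow> finite S \<and> S \<subseteq> cball x r \<and> (\<forall>y\<in>S. \<forall>z\<in>S. y \<noteq> z \<longrightarrow> e \<le> dist y z)" for S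
  have card_le: "real (card S) \<le> A" if S: "sep S" for S
  proof -
    have disj: "disjoint_family_on (\<lambda>y. ball y (e / 2)) S"
      unfolding disjoint_family_on_def
    proof (intro ballI impI)
      fix y z assume yz: "y \<in> S" "z \<in> S" "y \<noteq> z"
      then have "e \<le> dist y z" using S by (auto simp: sep_def)
      then show "ball y (e / 2) \<inter> ball z (e / 2) = {}"
        using dist_triangle_half_l[of y _ e z] by (fastforce simp: dist_commute)
    qed
    have sub: "ball y (e / 2) \<subseteq> ball x \<R>" if "y \<in> S" for y
      using S that e by (intro ball_subset_ball_of_dist) (auto simp: sep_def \<R>_def dist_commute)
    have "real (card S) * measure M (ball x \<R>) = (\<Sum>y\<in>S. measure M (ball x \<R>))" by simp
    also have "\<dots> \<le> (\<Sum>y\<in>S. A * measure M (ball y (e / 2)))"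
    proof (intro sum_mono A(2))
      fix y assume "y \<in> S"
      then show "dist x y < \<R>" using S e by (auto simp: sep_def \<R>_def)
    qed (use e in auto)
    also have "\<dots> = A * measure M (\<Union>y\<in>S. ball y (e / 2))"
      using S disj emeasure_ball_finite unfolding sum_distrib_left[symmetric] sep_def
      by (subst measure_finite_Union) (auto simp: less_top)
    also have "\<dots> \<le> A * measure M (ball x \<R>)"
      using A(1) sub by (intro mult_left_mono measure_mono_ball) (auto intro!: borel_open)
    finally show ?thesis using measure_ball_pos[OF \<R>, of x] by simp
  qed
  have "\<exists>S. sep S \<and> (\<forall>S'. sep S' \<longrightarrow> card S' \<le> card S)"
  proof (rule ex_has_greatest_nat[of sep "{}" card "Suc (nat \<lceil>A\<rceil>)"])
    show "sep {}" by (simp add: sep_def)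
    have "card S \<le> nat \<lceil>A\<rceil>" if "sep S" for S
      using order_trans[OF card_le[OF that] real_nat_ceiling_ge] by (simp only: of_nat_le_iff)
    then show "\<forall>S. sep S \<longrightarrow> card S < Suc (nat \<lceil>A\<rceil>)" by (simp add: less_Suc_eq_le)
  qed
  then obtain S where S: "sep S" "\<And>S'. sep S' \<Longrightarrow> card S' \<le> card S" by blast
  have "\<exists>y\<in>S. dist y z < e" if z: "z \<in> cball x r" for z
  proof (rule ccontr)
    assume *: "\<not> (\<exists>y\<in>S. dist y z < e)"
    then have "z \<notin> S" using e by auto
    moreover have "sep (insert z S)"
      using S(1) z * by (auto simp: sep_def not_less dist_commute)
    ultimately show False using S(2)[of "insert z S"] S(1) by (simp add: sep_def)
  qed
  then show "\<exists>k. finite k \<and> cball x r \<subseteq> (\<Union>y\<in>k. ball y e)"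
    using S(1) by (intro exI[of _ S]) (auto simp: sep_def)
qed

text \<open>The measure of balls grows at most polynomially, so a sufficiently negative power of the
  distance is integrable.\<close>

lemma exists_small_positive_density:
  fixes w :: 'a
  assumes p: "1 \<le> p" and e: "0 < e"
  obtains \<eta> :: "'a \<Rightarrow> real" where "continuous_on UNIV \<eta>" "\<And>x. 0 < \<eta> x"
    "(\<integral>\<^sup>+ x. ennreal (\<eta> x powr p) \<partial>M) < ennreal e" "\<And>R. \<exists>m>0. \<forall>x\<in>cball w R. m \<le> \<eta> x"
proof -
  obtain C where C: "1 \<le> C"
    "\<And>x r k. 0 < r \<Longrightarrow> measure M (ball x (2 ^ k * r)) \<le> C ^ k * measure M (ball x r)"
    using doubling_iterated by blast
  \<comment> \<open>With this exponent the decay on the ball of radius \<open>2\<^sup>k\<close> beats the growth \<open>C\<^sup>k\<close> of its measure.\<close>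
  obtain Q :: nat where Q: "2 * C < 2 ^ Q" using real_arch_pow[of 2 "2 * C"] by auto
  define \<theta> where "\<theta> x = 1 / (1 + dist w x) ^ Q" for x
  have \<theta>_pos: "0 < \<theta> x" for x by (simp add: \<theta>_def add_pos_nonneg)
  have one_le: "1 \<le> 1 + dist w x" for x by simp
  have \<theta>_le_1: "\<theta> x \<le> 1" for x using one_le_power[OF one_le, of x Q] by (simp add: \<theta>_def divide_le_eq)
  have \<theta>_cont: "continuous_on UNIV \<theta>"
    unfolding \<theta>_def by (intro continuous_intros) (metis one_le not_one_le_zero power_eq_0_iff)
  define \<mu> where "\<mu> = measure M (ball w 1)"
  have pw: "ennreal (\<theta> x) \<le> (\<Sum>k. ennreal (1 / (2 ^ k) ^ Q) * indicator (ball w (2 ^ (k + 1))) x)" for x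
  proof -
    obtain k where k: "2 ^ k \<le> 1 + dist w x" "1 + dist w x < 2 ^ (k + 1)"
      using dyadic_bracket[OF one_le] .
    have "\<theta> x \<le> 1 / (2 ^ k) ^ Q"
      unfolding \<theta>_def using k(1) by (intro frac_le power_mono) auto
    then have "ennreal (\<theta> x) \<le> ennreal (1 / (2 ^ k) ^ Q) * indicator (ball w (2 ^ (k + 1))) x"
      using k(2) by (auto simp: indicator_def intro!: ennreal_leI)
    also have "\<dots> \<le> (\<Sum>k. ennreal (1 / (2 ^ k) ^ Q) * indicator (ball w (2 ^ (k + 1))) x)"
      by (rule term_le_suminf_ennreal)
    finally show ?thesis .
  qed
  have term_le: "ennreal (1 / (2 ^ k) ^ Q) * emeasure M (ball w (2 ^ (k + 1))) \<le> ennreal (C * \<mu> * (1 / 2) ^ k)" for k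
  proof -
    have "measure M (ball w (2 ^ (k + 1) * 1)) \<le> C ^ (k + 1) * \<mu>" unfolding \<mu>_def by (rule C(2)) simp
    then have "1 / (2 ^ k) ^ Q * measure M (ball w (2 ^ (k + 1))) \<le> 1 / (2 ^ k) ^ Q * (C ^ (k + 1) * \<mu>)"
      by (intro mult_left_mono) auto
    also have "\<dots> = C * \<mu> * (C / 2 ^ Q) ^ k"
      by (simp add: power_divide power_mult[symmetric] mult.commute)
    also have "\<dots> \<le> C * \<mu> * (1 / 2) ^ k"
      using C(1) Q by (intro mult_left_mono power_mono) (auto simp: field_simps \<mu>_def)
    finally show ?thesis
      by (simp add: emeasure_ball ennreal_leI flip: ennreal_mult)
  qed
  have [measurable]: "\<theta> \<in> borel_measurable M"
    using borel_measurable_continuous_onI[OF \<theta>_cont] by (simp add: measurable_M_iff)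
  have "(\<integral>\<^sup>+ x. ennreal (\<theta> x) \<partial>M) \<le> (\<integral>\<^sup>+ x. (\<Sum>k. ennreal (1 / (2 ^ k) ^ Q) * indicator (ball w (2 ^ (k + 1))) x) \<partial>M)"
    by (intro nn_integral_mono pw)
  also have "\<dots> = (\<Sum>k. ennreal (1 / (2 ^ k) ^ Q) * emeasure M (ball w (2 ^ (k + 1))))"
    by (simp add: nn_integral_suminf nn_integral_cmult_indicator)
  also have "\<dots> \<le> (\<Sum>k. ennreal (C * \<mu> * (1 / 2) ^ k))"
    by (intro suminf_le term_le) auto
  also have "\<dots> = ennreal (\<Sum>k. C * \<mu> * (1 / 2) ^ k)"
    using C(1) by (intro suminf_ennreal2) (auto simp: \<mu>_def intro!: summable_mult)
  finally have "(\<integral>\<^sup>+ x. ennreal (\<theta> x) \<partial>M) < \<infinity>"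
    by (rule order_le_less_trans) simp
  then obtain I where I: "0 \<le> I" "(\<integral>\<^sup>+ x. ennreal (\<theta> x) \<partial>M) = ennreal I"
    by (cases "\<integral>\<^sup>+ x. ennreal (\<theta> x) \<partial>M") auto
  define \<kappa> where "\<kappa> = (e / (2 * (I + 1))) powr (1 / p)"
  have \<kappa>: "\<kappa> > 0" "\<kappa> powr p = e / (2 * (I + 1))"
    using e I(1) p by (auto simp: \<kappa>_def powr_powr)
  show ?thesis
  proof (rule that[of "\<lambda>x. \<kappa> * \<theta> x"])
    show "continuous_on UNIV (\<lambda>x. \<kappa> * \<theta> x)" by (intro continuous_intros \<theta>_cont)
    show "0 < \<kappa> * \<theta> x" for x using \<kappa> \<theta>_pos by simp
    have "(\<integral>\<^sup>+ x. ennreal ((\<kappa> * \<theta> x) powr p) \<partial>M) \<le> (\<integral>\<^sup>+ x. ennreal (\<kappa> powr p) * ennreal (\<theta> x) \<partial>M)"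
    proof (rule nn_integral_mono)
      fix x
      have "\<theta> x powr p \<le> \<theta> x powr 1" using \<theta>_pos \<theta>_le_1 p by (intro powr_mono') (auto intro: less_imp_le)
      then show "ennreal ((\<kappa> * \<theta> x) powr p) \<le> ennreal (\<kappa> powr p) * ennreal (\<theta> x)"
        using \<kappa>(1) \<theta>_pos[of x]
        by (auto simp: powr_mult less_imp_le intro!: ennreal_leI mult_left_mono simp flip: ennreal_mult)
    qed
    also have "\<dots> = ennreal (\<kappa> powr p * I)"
      using I by (simp add: nn_integral_cmult ennreal_mult)
    also have "\<dots> < ennreal e"
      using e I(1) unfolding \<kappa>(2) by (intro ennreal_lessI) (auto simp: field_simps intro: add_nonneg_pos)
    finally show "(\<integral>\<^sup>+ x. ennreal ((\<kappa> * \<theta> x) powr p) \<partial>M) < ennreal e" .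
    show "\<exists>m>0. \<forall>x\<in>cball w R. m \<le> \<kappa> * \<theta> x" for R
    proof (intro exI conjI ballI)
      show "0 < \<kappa> * (1 / (1 + \<bar>R\<bar>) ^ Q)" using \<kappa> by (simp add: add_pos_nonneg)
      show "\<kappa> * (1 / (1 + \<bar>R\<bar>) ^ Q) \<le> \<kappa> * \<theta> x" if "x \<in> cball w R" for x
        using \<kappa> that unfolding \<theta>_def
        by (intro mult_left_mono frac_le power_mono) (auto intro!: zero_less_power add_pos_nonneg)
    qed
  qed
qed

end

section \<open>Mean values and the Poincare inequality\<close>

context doubling_space
begin

lemma set_integrable_bounded:
  fixes u :: "'a \<Rightarrow> real"
  assumes "u \<in> borel_measurable borel" "\<And>x. \<bar>u x\<bar> \<le> K" "A \<in> sets borel" "A \<subseteq> ball x r"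
  shows "set_integrable M A u"
  unfolding set_integrable_def
  using assms emeasure_ball_finite[of x r] emeasure_mono[of A "ball x r" M]
  by (intro integrableI_bounded_set_indicator[where B = K])
    (auto simp: sets_M measurable_M_iff intro: order_le_less_trans)

lemma mean_on_eq:
  assumes "u \<in> borel_measurable borel" "A \<in> sets borel"
  shows "mean_on M A u = (LINT x:A|M. u x) / measure M A"
proof -
  note assms [measurable]
  have "(\<lambda>x. indicator A x *\<^sub>R u x) \<in> borel_measurable M"
    unfolding measurable_M_iff by measurable
  then show ?thesis
    by (simp add: mean_on_def set_lebesgue_integral_def integral_completion)
qed

lemma integrable_on_balls_bounded:
  fixes u :: "'a \<Rightarrow> real"
  assumes "u \<in> borel_measurable borel" "\<And>x. \<bar>u x\<bar> \<le> K"
  shows "integrable_on_balls M u"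
  unfolding integrable_on_balls_def set_integrable_def
proof (intro allI impI)
  fix x and r :: real
  have "(\<lambda>y. indicator (ball x r) y *\<^sub>R u y) \<in> borel_measurable M"
    unfolding measurable_M_iff
    by (intro borel_measurable_scaleR borel_measurable_indicator borel_open open_ball assms)
  then show "integrable (completion M) (\<lambda>y. indicator (ball x r) y *\<^sub>R u y)"
    using set_integrable_bounded[OF assms, of "ball x r" x r]
    by (simp add: integrable_completion set_integrable_def)
qed

lemma mean_on_const:
  assumes "A \<in> sets borel" "A \<subseteq> ball x r" "0 < measure M A" "\<And>y. y \<in> A \<Longrightarrow> u y = c"
    and "u \<in> borel_measurable borel"
  shows "mean_on M A u = c"
proof -
  have "(LINT x:A|M. u x) = (LINT x:A|M. c)"
    using assms by (intro set_lebesgue_integral_cong) (auto simp: sets_M)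
  also have "\<dots> = c * measure M A"
    using bounded_fmeasurable[OF assms(1,2)] by (simp add: set_lebesgue_integral_def)
  finally show ?thesis using assms by (simp add: mean_on_eq)
qed

lemma mean_on_subset_diff_le:
  assumes "D \<in> sets borel" "B \<in> sets borel" "D \<subseteq> B" "B \<subseteq> ball x r" "0 < measure M D"
    and u: "u \<in> borel_measurable borel" "\<And>y. \<bar>u y\<bar> \<le> K"
  shows "\<bar>mean_on M D u - mean_on M B u\<bar>
    \<le> measure M B / measure M D * mean_on M B (\<lambda>y. \<bar>u y - mean_on M B u\<bar>)"
proof -
  define m where "m = mean_on M B u"
  have DB: "D \<subseteq> ball x r" using assms by auto
  have BD: "measure M D \<le> measure M B"
    using assms by (intro measure_mono_fmeasurable bounded_fmeasurable[of B x r]) (auto simp: sets_M)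
  have bdd: "\<bar>u y - m\<bar> \<le> K + \<bar>m\<bar>" for y using u(2)[of y] by simp
  have meas: "(\<lambda>y. u y - m) \<in> borel_measurable borel" "(\<lambda>y. \<bar>u y - m\<bar>) \<in> borel_measurable borel"
    using u(1) by simp_all
  have i: "set_integrable M D u" "set_integrable M D (\<lambda>y. u y - m)" "set_integrable M D (\<lambda>_. m)"
     "set_integrable M D (\<lambda>y. \<bar>u y - m\<bar>)" "set_integrable M B (\<lambda>y. \<bar>u y - m\<bar>)"
    using set_integrable_bounded[OF u assms(1) DB] set_integrable_bounded[OF meas(1) bdd assms(1) DB]
      set_integrable_bounded[of "\<lambda>_. m", OF _ order_refl assms(1) DB]
      set_integrable_bounded[OF meas(2) _ assms(1) DB, of "K + \<bar>m\<bar>"]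
      set_integrable_bounded[OF meas(2) _ assms(2,4), of "K + \<bar>m\<bar>"] bdd
    by simp_all
  have "(LINT y:D|M. u y - m) = (LINT y:D|M. u y) - m * measure M D"
    using set_integral_diff(2)[OF i(1,3)] bounded_fmeasurable[OF assms(1) DB]
    by (simp add: set_lebesgue_integral_def)
  then have "mean_on M D u - m = (LINT y:D|M. u y - m) / measure M D"
    using assms by (simp add: mean_on_eq diff_divide_distrib)
  then have "\<bar>mean_on M D u - m\<bar> = \<bar>LINT y:D|M. u y - m\<bar> / measure M D"
    using assms(5) by (simp add: abs_divide)
  also have "\<dots> \<le> (LINT y:D|M. \<bar>u y - m\<bar>) / measure M D"
    using set_integral_norm_bound[OF i(2)] by (intro divide_right_mono) auto
  also have "\<dots> \<le> (LINT y:B|M. \<bar>u y - m\<bar>) / measure M D"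
    using i(4,5) assms(3) unfolding set_lebesgue_integral_def set_integrable_def
    by (intro divide_right_mono integral_mono) (auto simp: indicator_def)
  also have "\<dots> = measure M B / measure M D * mean_on M B (\<lambda>y. \<bar>u y - m\<bar>)"
    using BD assms u by (simp add: mean_on_eq)
  finally show ?thesis unfolding m_def .
qed

end

locale poincare_space = doubling_space +
  fixes p :: real
  assumes p: "1 \<le> p" and poincare: "poincare_inequality p M"
begin

definition energy :: "('a \<Rightarrow> ennreal) \<Rightarrow> 'a set \<Rightarrow> real" where
  "energy \<rho> A = enn2real (\<integral>\<^sup>+ x \<in> A. \<rho> x epowr p \<partial>M)"

text \<open>Values in the unit interval make the functions integrable on balls; both the chain potentials
  and the indicators of balls are of this kind.\<close>

definition test_pair :: "('a \<Rightarrow> real) \<Rightarrow> ('a \<Rightarrow> ennreal) \<Rightarrow> bool" where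
  "test_pair u \<rho> \<longleftrightarrow> u \<in> borel_measurable borel \<and> (\<forall>x. 0 \<le> u x \<and> u x \<le> 1) \<and> upper_gradient \<rho> u \<and>
    (\<integral>\<^sup>+ x. \<rho> x epowr p \<partial>M) < \<infinity>"

lemma test_pairD:
  assumes "test_pair u \<rho>"
  shows "u \<in> borel_measurable borel" "\<bar>u x\<bar> \<le> 1" "upper_gradient \<rho> u"
    "(\<integral>\<^sup>+ x. \<rho> x epowr p \<partial>M) < \<infinity>" "\<rho> \<in> borel_measurable borel"
  using assms by (auto simp: test_pair_def upper_gradient_def)

lemma energy_nonneg [simp]: "0 \<le> energy \<rho> A"
  by (simp add: energy_def)

lemma set_nn_integral_energy:
  assumes "test_pair u \<rho>"
  shows "(\<integral>\<^sup>+ x \<in> A. \<rho> x epowr p \<partial>M) = ennreal (energy \<rho> A)"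
proof -
  have "(\<integral>\<^sup>+ x \<in> A. \<rho> x epowr p \<partial>M) \<le> (\<integral>\<^sup>+ x. \<rho> x epowr p \<partial>M)"
    by (intro nn_integral_mono) (auto simp: indicator_def)
  also have "\<dots> < top" using test_pairD(4)[OF assms] by simp
  finally show ?thesis by (simp add: energy_def)
qed

lemma energy_mono:
  assumes "test_pair u \<rho>" "A \<subseteq> B"
  shows "energy \<rho> A \<le> energy \<rho> B"
proof -
  have "ennreal (energy \<rho> A) \<le> ennreal (energy \<rho> B)"
    unfolding set_nn_integral_energy[OF assms(1), symmetric]
    by (intro nn_integral_mono) (use assms(2) in \<open>auto simp: indicator_def\<close>)
  then show ?thesis by (simp add: ennreal_le_iff)
qed

lemma poincare_energy:
  obtains C \<tau> where "0 < C" "1 \<le> \<tau>"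
    "\<And>u \<rho> x r. test_pair u \<rho> \<Longrightarrow> 0 < r \<Longrightarrow>
      mean_on M (ball x r) (\<lambda>y. \<bar>u y - mean_on M (ball x r) u\<bar>)
        \<le> C * r * (energy \<rho> (ball x (\<tau> * r)) / measure M (ball x (\<tau> * r))) powr (1 / p)"
proof -
  obtain C \<tau> where C: "0 < C" "1 \<le> \<tau>"
    "\<And>u \<rho> x r. integrable_on_balls M u \<Longrightarrow> upper_gradient \<rho> u \<Longrightarrow> 0 < r \<Longrightarrow>
      ennreal (mean_on M (ball x r) (\<lambda>y. \<bar>u y - mean_on M (ball x r) u\<bar>))
          \<le> ennreal (C * r)
             * ((\<integral>\<^sup>+ y \<in> ball x (\<tau> * r). \<rho> y epowr p \<partial>M)
                  / emeasure M (ball x (\<tau> * r))) epowr (1 / p)"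
    using poincare unfolding poincare_inequality_def by blast
  have "mean_on M (ball x r) (\<lambda>y. \<bar>u y - mean_on M (ball x r) u\<bar>)
        \<le> C * r * (energy \<rho> (ball x (\<tau> * r)) / measure M (ball x (\<tau> * r))) powr (1 / p)"
    if u: "test_pair u \<rho>" and r: "0 < r" for u \<rho> x r
  proof -
    let ?q = "energy \<rho> (ball x (\<tau> * r)) / measure M (ball x (\<tau> * r))"
    have pos: "0 < measure M (ball x (\<tau> * r))" using C(2) r by (intro measure_ball_pos) auto
    have "ennreal (mean_on M (ball x r) (\<lambda>y. \<bar>u y - mean_on M (ball x r) u\<bar>))
      \<le> ennreal (C * r) * (ennreal (energy \<rho> (ball x (\<tau> * r))) / ennreal (measure M (ball x (\<tau> * r)))) epowr (1 / p)"
      using C(3)[OF integrable_on_balls_bounded[OF test_pairD(1,2)[OF u]] test_pairD(3)[OF u] r, of x]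
      by (simp add: set_nn_integral_energy[OF u] emeasure_ball)
    also have "\<dots> = ennreal (C * r * ?q powr (1 / p))"
      using pos p C(1) r by (simp add: divide_ennreal ennreal_epowr ennreal_mult)
    finally show ?thesis
      using C(1) r by (subst (asm) ennreal_le_iff) auto
  qed
  then show ?thesis using that C by blast
qed

text \<open>If the shell were empty, the indicator function of a ball would have upper gradient zero, and the
  Poincare inequality would force it to be almost everywhere constant on a larger ball.\<close>

lemma exists_point_in_shell:
  fixes w y :: 'a
  assumes shell: "0 < a" "a < b" and y: "b \<le> dist w y"
  shows "\<exists>z. a \<le> dist w z \<and> dist w z < b"
proof (rule ccontr)
  assume no: "\<not> (\<exists>z. a \<le> dist w z \<and> dist w z < b)"
  define u :: "'a \<Rightarrow> real" where "u = indicator (ball w a)"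
  have u_meas: "u \<in> borel_measurable borel"
    unfolding u_def by (intro borel_measurable_indicator borel_open open_ball)
  have "u (\<gamma> s) = u (\<gamma> t)" if \<gamma>: "is_curve ({s..t}, \<gamma>)" "curve_length {s..t} \<gamma> < \<infinity>" for s t \<gamma>
  proof -
    interpret rectifiable_curve s t \<gamma> using \<gamma> by (rule rectifiable_curve_of_is_curve)
    have c: "continuous_on {s..t} (\<lambda>x. dist w (\<gamma> x))" by (intro continuous_intros cont)
    have hit: "\<exists>x\<in>{s..t}. dist w (\<gamma> x) = a"
      if "(dist w (\<gamma> s) < a \<and> a \<le> dist w (\<gamma> t)) \<or> (dist w (\<gamma> t) < a \<and> a \<le> dist w (\<gamma> s))"
      using IVT'[OF _ _ ab c, of a] IVT2'[OF _ _ ab c, of a] that by fastforce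
    have "dist w (\<gamma> x) \<noteq> a" for x using no shell(2) by auto
    then have "dist w (\<gamma> s) < a \<longleftrightarrow> dist w (\<gamma> t) < a" using hit not_less by blast
    then show ?thesis by (simp add: u_def indicator_def)
  qed
  then have "upper_gradient (\<lambda>_. 0) u" by (auto simp: upper_gradient_def)
  then have u: "test_pair u (\<lambda>_. 0)" using p u_meas by (auto simp: test_pair_def u_def indicator_def)
  have E: "energy (\<lambda>_. 0) A = 0" for A using p by (simp add: energy_def)
  obtain C \<tau> where C: "0 < C" "1 \<le> \<tau>"
    "\<And>u \<rho> x r. test_pair u \<rho> \<Longrightarrow> 0 < r \<Longrightarrow>
      mean_on M (ball x r) (\<lambda>y. \<bar>u y - mean_on M (ball x r) u\<bar>)
        \<le> C * r * (energy \<rho> (ball x (\<tau> * r)) / measure M (ball x (\<tau> * r))) powr (1 / p)"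
    using poincare_energy by blast
  define B where "B = ball w (dist w y + b)"
  have osc: "mean_on M B (\<lambda>x. \<bar>u x - mean_on M B u\<bar>) \<le> 0"
    using C(3)[OF u, of "dist w y + b" w] y shell p unfolding B_def E by simp
  have near: "mean_on M D u = mean_on M B u" if D: "D = ball x r" "D \<subseteq> B" "0 < r" for D x r
  proof -
    have pos: "0 < measure M D" using D measure_ball_pos by simp
    have "\<bar>mean_on M D u - mean_on M B u\<bar>
      \<le> measure M B / measure M D * mean_on M B (\<lambda>x. \<bar>u x - mean_on M B u\<bar>)"
      using D pos test_pairD(1,2)[OF u] B_def by (intro mean_on_subset_diff_le[where K = 1]) auto
    also have "\<dots> \<le> 0" using osc by (intro mult_nonneg_nonpos) auto
    finally show ?thesis by simp
  qed
  have "mean_on M (ball w a) u = 1"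
    using shell by (intro mean_on_const[of _ w a] measure_ball_pos u_meas) (auto simp: u_def)
  moreover have "mean_on M (ball y (b - a)) u = 0"
  proof (rule mean_on_const[of _ y "b - a"])
    fix z assume "z \<in> ball y (b - a)"
    then have "a \<le> dist w z" using y dist_triangle[of w y z] by (simp add: dist_commute)
    then show "u z = 0" by (simp add: u_def)
  qed (use shell in \<open>auto intro!: measure_ball_pos u_meas\<close>)
  moreover have "ball w a \<subseteq> B" "ball y (b - a) \<subseteq> B"
    unfolding B_def using y shell by (intro ball_subset_ball_of_dist; simp add: dist_commute)+
  then have "mean_on M (ball w a) u = mean_on M B u" "mean_on M (ball y (b - a)) u = mean_on M B u"
    using shell by (auto intro: near)
  ultimately show False by simp
qed

end

section \<open>Telescoping along annular chains\<close>

locale annular_space = poincare_space +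
  fixes w :: 'a
  assumes chains: "annular_chain_property w"
begin

text \<open>Consecutive balls of a chain contain a common ball of comparable size, whose mean value is close
  to both of theirs by the Poincare inequality on the dilated balls, which stay in a larger shell. The
  change from the radius \<open>r\<close> to \<open>r'\<close> at \<open>y\<close> prepares the passage from one annulus to the next.\<close>

lemma mean_diff_in_annulus:
  obtains C \<Lambda> c where "0 \<le> C" "1 \<le> \<Lambda>" "1 \<le> c"
    "\<And>r x. 0 < r \<Longrightarrow> x \<in> ball w r - ball w (r / 2) \<Longrightarrow> ball x (r / \<Lambda>) \<inter> ball w (r / c) = {}"
    "\<And>u \<rho> r r' x y. test_pair u \<rho> \<Longrightarrow> 0 < r \<Longrightarrow> r \<le> r' \<Longrightarrow> r' \<le> 2 * r \<Longrightarrow>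
       x \<in> ball w r - ball w (r / 2) \<Longrightarrow> y \<in> ball w r - ball w (r / 2) \<Longrightarrow>
       y \<in> ball w r' - ball w (r' / 2) \<Longrightarrow>
       \<bar>mean_on M (ball x (r / \<Lambda>)) u - mean_on M (ball y (r' / \<Lambda>)) u\<bar> \<le>
         C * (r * (energy \<rho> (ball w (c * r) - ball w (r / c)) / measure M (ball w r)) powr (1 / p)
            + r' * (energy \<rho> (ball w (c * r') - ball w (r' / c)) / measure M (ball w r')) powr (1 / p))"
proof -
  obtain Cp \<tau> where Cp: "0 < Cp" and \<tau>: "1 \<le> \<tau>" and poinc:
    "\<And>u \<rho> x r. test_pair u \<rho> \<Longrightarrow> 0 < r \<Longrightarrow>
      mean_on M (ball x r) (\<lambda>y. \<bar>u y - mean_on M (ball x r) u\<bar>)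
        \<le> Cp * r * (energy \<rho> (ball x (\<tau> * r)) / measure M (ball x (\<tau> * r))) powr (1 / p)"
    using poincare_energy by blast
  have "annular_chain_condition \<tau> w" using chains \<tau> by (simp add: annular_chain_property_def)
  then obtain c1 c \<delta> K where c: "1 \<le> c1" "1 \<le> c" "0 < \<delta>"
    and chain: "\<And>r x y. 0 < r \<Longrightarrow> x \<in> ball w r - ball w (r / 2) \<Longrightarrow> y \<in> ball w r - ball w (r / 2) \<Longrightarrow>
        \<exists>(k::nat) z. 1 \<le> k \<and> k \<le> K \<and> z 1 = x \<and> z k = y \<and>
          (\<forall>i\<in>{1..k}. ball (z i) (\<tau> * (r / (\<tau> * c1))) \<subseteq> ball w (c * r) - ball w (r / c)) \<and>
          (\<forall>i\<in>{1..<k}. \<exists>v. ball v (\<delta> * r)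
               \<subseteq> ball (z i) (r / (\<tau> * c1)) \<inter> ball (z (i + 1)) (r / (\<tau> * c1)))"
    unfolding annular_chain_condition_def by metis
  define \<Lambda> where "\<Lambda> = \<tau> * c1"
  have \<Lambda>: "1 \<le> \<Lambda>" using \<tau> c(1) mult_mono[of 1 \<tau> 1 c1] by (simp add: \<Lambda>_def)
  have chain_subset: "ball x (\<tau> * (r / \<Lambda>)) \<subseteq> ball w (c * r) - ball w (r / c)"
    if "0 < r" "x \<in> ball w r - ball w (r / 2)" for r x
    using chain[OF that that(2)] unfolding \<Lambda>_def by (metis atLeastAtMost_iff order_refl)
  define Q where "Q \<rho> r = r * (energy \<rho> (ball w (c * r) - ball w (r / c)) / measure M (ball w r)) powr (1 / p)"
    for \<rho> r
  have Q_nonneg: "0 \<le> Q \<rho> r" if "0 < r" for \<rho> r using that by (simp add: Q_def)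
  obtain A1 where A1: "1 \<le> A1" "\<And>x y r s. 0 < s \<Longrightarrow> r \<le> 1 / (\<Lambda> * \<delta>) * s \<Longrightarrow> dist x y < r \<Longrightarrow>
      measure M (ball x r) \<le> A1 * measure M (ball y s)"
    using ball_measure_comparison[of "1 / (\<Lambda> * \<delta>)"] by blast
  obtain A2 where A2: "1 \<le> A2" "\<And>x y r s. 0 < s \<Longrightarrow> r \<le> c1 * c * s \<Longrightarrow> dist x y < r \<Longrightarrow>
      measure M (ball x r) \<le> A2 * measure M (ball y s)"
    using ball_measure_comparison[of "c1 * c"] by blast
  obtain A3 where A3: "1 \<le> A3" "\<And>x y r s. 0 < s \<Longrightarrow> r \<le> 2 * s \<Longrightarrow> dist x y < r \<Longrightarrow>
      measure M (ball x r) \<le> A3 * measure M (ball y s)"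
    using ball_measure_comparison[of 2] by blast
  define C3 where "C3 = Cp / \<Lambda> * A2 powr (1 / p)"
  have C3: "0 \<le> C3" using Cp \<Lambda> by (simp add: C3_def)
  have osc: "mean_on M (ball z (r / \<Lambda>)) (\<lambda>y. \<bar>u y - mean_on M (ball z (r / \<Lambda>)) u\<bar>) \<le> C3 * Q \<rho> r"
    if u: "test_pair u \<rho>" and r: "0 < r" and z: "ball z (\<tau> * (r / \<Lambda>)) \<subseteq> ball w (c * r) - ball w (r / c)"
    for u \<rho> z r
  proof -
    let ?B = "ball z (\<tau> * (r / \<Lambda>))"
    have rad: "0 < \<tau> * (r / \<Lambda>)" using \<tau> r \<Lambda> by simp
    have "z \<in> ball w (c * r)" using z centre_in_ball[THEN iffD2, OF rad, of z] by blast
    then have "dist w z < c * r" by simp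
    moreover have "c * r \<le> c1 * c * (\<tau> * (r / \<Lambda>))" using \<tau> c(1) by (simp add: \<Lambda>_def)
    ultimately have "measure M (ball w (c * r)) \<le> A2 * measure M ?B" using rad by (intro A2)
    moreover have "measure M (ball w r) \<le> measure M (ball w (c * r))"
      using c(2) r by (intro measure_mono_ball subset_ball) auto
    ultimately have \<mu>: "measure M (ball w r) \<le> A2 * measure M ?B" by linarith
    have pos: "0 < measure M ?B" "0 < measure M (ball w r)" using rad r by (auto intro: measure_ball_pos)
    have "energy \<rho> ?B / measure M ?B \<le> energy \<rho> (ball w (c * r) - ball w (r / c)) / measure M ?B"
      using energy_mono[OF u z] by (intro divide_right_mono) auto
    also have "\<dots> \<le> A2 * (energy \<rho> (ball w (c * r) - ball w (r / c)) / measure M (ball w r))"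
      using mult_left_mono[OF \<mu>, of "energy \<rho> (ball w (c * r) - ball w (r / c))"] pos by (simp add: field_simps)
    finally have "(energy \<rho> ?B / measure M ?B) powr (1 / p)
       \<le> A2 powr (1 / p) * (energy \<rho> (ball w (c * r) - ball w (r / c)) / measure M (ball w r)) powr (1 / p)"
      using p A2(1) by (subst powr_mult[symmetric]) (auto intro!: powr_mono2)
    then have "Cp * (r / \<Lambda>) * (energy \<rho> ?B / measure M ?B) powr (1 / p) \<le> Cp * (r / \<Lambda>) *
       (A2 powr (1 / p) * (energy \<rho> (ball w (c * r) - ball w (r / c)) / measure M (ball w r)) powr (1 / p))"
      using Cp r \<Lambda> by (intro mult_left_mono) auto
    also have "\<dots> = C3 * Q \<rho> r" by (simp add: C3_def Q_def)
    finally show ?thesis using poinc[OF u, of "r / \<Lambda>" z] r \<Lambda> by simp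
  qed
  have sub: "\<bar>mean_on M D u - mean_on M (ball z (r / \<Lambda>)) u\<bar> \<le> A * C3 * Q \<rho> r"
    if u: "test_pair u \<rho>" and r: "0 < r" and z: "ball z (\<tau> * (r / \<Lambda>)) \<subseteq> ball w (c * r) - ball w (r / c)"
      and D: "D = ball v s" "0 < s" "D \<subseteq> ball z (r / \<Lambda>)" "measure M (ball z (r / \<Lambda>)) \<le> A * measure M D"
    for u \<rho> z r D v s A
  proof -
    have pos: "0 < measure M D" using D measure_ball_pos by simp
    have "\<bar>mean_on M D u - mean_on M (ball z (r / \<Lambda>)) u\<bar> \<le> measure M (ball z (r / \<Lambda>)) / measure M D *
       mean_on M (ball z (r / \<Lambda>)) (\<lambda>y. \<bar>u y - mean_on M (ball z (r / \<Lambda>)) u\<bar>)"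
      using D pos test_pairD(1,2)[OF u] by (intro mean_on_subset_diff_le[where K = 1]) auto
    also have "\<dots> \<le> measure M (ball z (r / \<Lambda>)) / measure M D * (C3 * Q \<rho> r)"
      by (intro mult_left_mono osc[OF u r z]) auto
    also have "\<dots> \<le> A * (C3 * Q \<rho> r)"
      using D(4) pos C3 Q_nonneg[OF r, of \<rho>] by (intro mult_right_mono) (auto simp: divide_le_eq)
    finally show ?thesis by simp
  qed
  \<comment> \<open>A chain has at most \<open>K\<close> links, and each contributes the oscillation on two balls.\<close>
  have along: "\<bar>mean_on M (ball x (r / \<Lambda>)) u - mean_on M (ball y (r / \<Lambda>)) u\<bar> \<le> real K * (2 * A1 * C3 * Q \<rho> r)"
    if u: "test_pair u \<rho>" and r: "0 < r" and x: "x \<in> ball w r - ball w (r / 2)" and y: "y \<in> ball w r - ball w (r / 2)"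
    for u \<rho> r x y
  proof -
    obtain k z where k: "1 \<le> k" "k \<le> K" "z 1 = x" "z k = y"
      and shell: "\<And>i. i \<in> {1..k} \<Longrightarrow> ball (z i) (\<tau> * (r / \<Lambda>)) \<subseteq> ball w (c * r) - ball w (r / c)"
      and link: "\<And>i. i \<in> {1..<k} \<Longrightarrow> \<exists>v. ball v (\<delta> * r) \<subseteq> ball (z i) (r / \<Lambda>) \<inter> ball (z (i + 1)) (r / \<Lambda>)"
      using chain[OF r x y] unfolding \<Lambda>_def by metis
    let ?m = "\<lambda>i. mean_on M (ball (z i) (r / \<Lambda>)) u"
    let ?q = "2 * A1 * C3 * Q \<rho> r"
    have q: "0 \<le> ?q" using A1(1) C3 Q_nonneg[OF r] by simp
    have step: "\<bar>?m i - ?m (i + 1)\<bar> \<le> ?q" if i: "i \<in> {1..<k}" for i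
    proof -
      obtain v where v: "ball v (\<delta> * r) \<subseteq> ball (z i) (r / \<Lambda>) \<inter> ball (z (i + 1)) (r / \<Lambda>)"
        using link[OF i] by blast
      have \<delta>r: "0 < \<delta> * r" using c r by simp
      then have vin: "v \<in> ball (z i) (r / \<Lambda>)" "v \<in> ball (z (i + 1)) (r / \<Lambda>)"
        using v centre_in_ball[of v "\<delta> * r"] by blast+
      have "r / \<Lambda> \<le> 1 / (\<Lambda> * \<delta>) * (\<delta> * r)" using c(3) by simp
      then have "\<bar>mean_on M (ball v (\<delta> * r)) u - ?m j\<bar> \<le> A1 * C3 * Q \<rho> r" if "j = i \<or> j = i + 1" for j
        using that vin v i \<delta>r by (intro sub[OF u r shell _ \<delta>r] A1) auto
      from this[of i] this[of "i + 1"] show ?thesis by simp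
    qed
    have "\<bar>?m 1 - ?m (1 + n)\<bar> \<le> real n * ?q" if "1 + n \<le> k" for n
      using that
    proof (induction n)
      case (Suc n)
      then have "\<bar>?m 1 - ?m (1 + n)\<bar> \<le> real n * ?q" "\<bar>?m (1 + n) - ?m (1 + Suc n)\<bar> \<le> ?q"
        using step[of "1 + n"] by auto
      moreover have "real (Suc n) * ?q = real n * ?q + ?q" by (simp add: algebra_simps)
      ultimately show ?case by linarith
    qed simp
    from this[of "k - 1"] have "\<bar>?m 1 - ?m k\<bar> \<le> real (k - 1) * ?q" using k by simp
    also have "\<dots> \<le> real K * ?q" using k q by (intro mult_right_mono) auto
    finally show ?thesis using k by simp
  qed
  define C where "C = real K * (2 * A1 * C3) + A3 * C3"
  have C: "0 \<le> C" using A1(1) A3(1) C3 by (simp add: C_def)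
  show ?thesis
  proof (rule that[OF C \<Lambda> c(2)])
    fix r x assume "0 < r" "x \<in> ball w r - ball w (r / 2)"
    moreover have "ball x (r / \<Lambda>) \<subseteq> ball x (\<tau> * (r / \<Lambda>))"
      using mult_right_mono[OF \<tau>, of "r / \<Lambda>"] \<open>0 < r\<close> \<Lambda> by (intro subset_ball) simp
    ultimately show "ball x (r / \<Lambda>) \<inter> ball w (r / c) = {}" using chain_subset by blast
  next
    fix u \<rho> r r' x y
    assume u: "test_pair u \<rho>" and r: "0 < r" "r \<le> r'" "r' \<le> 2 * r"
      and x: "x \<in> ball w r - ball w (r / 2)" and y: "y \<in> ball w r - ball w (r / 2)"
      and y': "y \<in> ball w r' - ball w (r' / 2)"
    have r': "0 < r'" using r by simp
    have "\<bar>mean_on M (ball y (r / \<Lambda>)) u - mean_on M (ball y (r' / \<Lambda>)) u\<bar> \<le> A3 * C3 * Q \<rho> r'"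
      using r r' \<Lambda>
      by (intro sub[OF u r' chain_subset[OF r' y'], of _ y "r / \<Lambda>"] A3) (auto simp: field_simps intro!: subset_ball divide_right_mono)
    moreover have "\<bar>mean_on M (ball x (r / \<Lambda>)) u - mean_on M (ball y (r / \<Lambda>)) u\<bar> \<le> real K * (2 * A1 * C3 * Q \<rho> r)"
      by (rule along[OF u r(1) x y])
    ultimately have "\<bar>mean_on M (ball x (r / \<Lambda>)) u - mean_on M (ball y (r' / \<Lambda>)) u\<bar>
        \<le> real K * (2 * A1 * C3) * Q \<rho> r + A3 * C3 * Q \<rho> r'" by (simp add: mult.assoc)
    also have "\<dots> \<le> C * Q \<rho> r + C * Q \<rho> r'"
      using Q_nonneg[OF r(1)] Q_nonneg[OF r'] A1(1) A3(1) C3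
      by (intro add_mono mult_right_mono) (auto simp: C_def)
    finally show "\<bar>mean_on M (ball x (r / \<Lambda>)) u - mean_on M (ball y (r' / \<Lambda>)) u\<bar> \<le>
         C * (r * (energy \<rho> (ball w (c * r) - ball w (r / c)) / measure M (ball w r)) powr (1 / p)
            + r' * (energy \<rho> (ball w (c * r') - ball w (r' / c)) / measure M (ball w r')) powr (1 / p))"
      by (simp add: Q_def distrib_left)
  qed
qed

end

section \<open>Summability of the dyadic weights\<close>

text \<open>These weights carry the information in \<open>R\<^sub>p\<close>: if all annuli have positive measure, then \<open>R\<^sub>1\<close> is
  their supremum and, for \<open>p > 1\<close>, \<open>R\<^sub>p\<close> is the sum of their powers with the exponent dual to \<open>p\<close>.\<close>

definition dyadic_weight :: "real \<Rightarrow> 'a::metric_space measure \<Rightarrow> 'a \<Rightarrow> nat \<Rightarrow> real" where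
  "dyadic_weight p M w j = 2 ^ j * measure M (dyadic_annulus w j) powr (- 1 / p)"

lemma young_split:
  fixes b e \<epsilon> p :: real
  assumes "1 < p" "0 < \<epsilon>" "0 \<le> b" "0 \<le> e"
  shows "b * e powr (1 / p) \<le> \<epsilon> * b powr (p / (p - 1)) + \<epsilon> powr (1 - p) * e"
proof (cases "b = 0 \<or> e = 0")
  case False
  then have pos: "0 < b" "0 < e" using assms by auto
  show ?thesis
  proof (cases "e powr (1 / p) \<le> \<epsilon> * b powr (1 / (p - 1))")
    case True
    then have "b * e powr (1 / p) \<le> b * (\<epsilon> * b powr (1 / (p - 1)))" using pos by (intro mult_left_mono) auto
    also have "\<dots> = \<epsilon> * (b powr 1 * b powr (1 / (p - 1)))" using pos by simp
    also have "\<dots> = \<epsilon> * b powr (p / (p - 1))"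
      unfolding powr_add[symmetric] using assms(1) by (simp add: field_simps)
    finally show ?thesis using assms by (simp add: add_increasing2)
  next
    case False
    then have "b powr (1 / (p - 1)) \<le> e powr (1 / p) / \<epsilon>" using assms by (simp add: field_simps)
    then have "(b powr (1 / (p - 1))) powr (p - 1) \<le> (e powr (1 / p) / \<epsilon>) powr (p - 1)"
      using assms by (intro powr_mono2) auto
    then have "b \<le> (e powr (1 / p) / \<epsilon>) powr (p - 1)"
      using assms pos by (simp add: powr_powr)
    also have "\<dots> = (e powr (1 / p)) powr (p - 1) * \<epsilon> powr (1 - p)"
      using assms powr_minus_divide[of \<epsilon> "p - 1"] by (simp add: powr_divide)
    finally have "b \<le> (e powr (1 / p)) powr (p - 1) * \<epsilon> powr (1 - p)" .
    then have "b * e powr (1 / p) \<le> ((e powr (1 / p)) powr (p - 1) * \<epsilon> powr (1 - p)) * e powr (1 / p)"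
      by (intro mult_right_mono) auto
    also have "\<dots> = \<epsilon> powr (1 - p) * (e powr ((p - 1) / p) * e powr (1 / p))"
      by (simp add: powr_powr)
    also have "\<dots> = \<epsilon> powr (1 - p) * e"
      unfolding powr_add[symmetric] using assms pos by (simp add: add_divide_distrib[symmetric])
    finally show ?thesis using assms by (simp add: add_increasing)
  qed
qed (use assms in auto)

context doubling_space
begin

lemma dyadic_annulus_borel: "dyadic_annulus z j \<in> sets borel"
  by (auto simp: dyadic_annulus_def)

lemma emeasure_dyadic_annulus:
  "emeasure M (dyadic_annulus z j) = ennreal (measure M (dyadic_annulus z j))"
  using bounded_fmeasurable[OF dyadic_annulus_borel, of z j z "2 ^ (j + 1)"]
  by (intro emeasure_eq_measure2) (auto simp: dyadic_annulus_def)

lemma epowr_dyadic_annulus: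
  assumes "0 < measure M (dyadic_annulus z j)"
  shows "emeasure M (dyadic_annulus z j) epowr q = ennreal (measure M (dyadic_annulus z j) powr q)"
  using assms unfolding emeasure_dyadic_annulus by (auto simp: ennpowr_def)

lemma dyadic_weight_powr:
  assumes "1 < p"
  shows "dyadic_weight p M z j powr (p / (p - 1))
    = (2 ^ j) powr (p / (p - 1)) * measure M (dyadic_annulus z j) powr (1 / (1 - p))"
proof -
  have "- 1 / p * (p / (p - 1)) = 1 / (1 - p)" using assms by (simp add: field_simps)
  then show ?thesis by (simp add: dyadic_weight_def powr_mult powr_powr)
qed

lemma Rp_eq_dyadic_weights:
  assumes "1 \<le> p" and pos: "\<And>j. 0 < measure M (dyadic_annulus z j)"
  shows "Rp p M z = (if p = 1 then SUP j. ennreal (dyadic_weight p M z j)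
    else \<Sum>j. ennreal (dyadic_weight p M z j powr (p / (p - 1))))"
proof (cases "p = 1")
  case True
  then show ?thesis
    using epowr_dyadic_annulus[OF pos] by (simp add: Rp_def dyadic_weight_def flip: ennreal_mult)
next
  case False
  then have "1 < p" using assms by simp
  then show ?thesis
    using epowr_dyadic_annulus[OF pos] False
    by (simp add: Rp_def dyadic_weight_powr ennreal_mult)
qed

lemma dyadic_annulus_pos_of_Rp:
  assumes "1 \<le> p" "Rp p M z < \<infinity>"
  shows "0 < measure M (dyadic_annulus z j)"
proof (rule ccontr)
  assume "\<not> 0 < measure M (dyadic_annulus z j)"
  then have 0: "emeasure M (dyadic_annulus z j) = 0"
    using measure_nonneg[of M "dyadic_annulus z j"] by (simp add: emeasure_dyadic_annulus)
  have "Rp p M z = \<infinity>"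
  proof (cases "p = 1")
    case True
    have "ennreal (2 ^ j) * emeasure M (dyadic_annulus z j) epowr (-1) = \<infinity>"
      unfolding 0 by (simp add: ennpowr_def ennreal_mult_top)
    then show ?thesis
      using True SUP_upper[of j UNIV "\<lambda>j. ennreal (2 ^ j) * emeasure M (dyadic_annulus z j) epowr (-1)"]
      by (simp add: Rp_def top_unique)
  next
    case False
    have "ennreal ((2 ^ j) powr (p / (p - 1))) * emeasure M (dyadic_annulus z j) epowr (1 / (1 - p)) = \<infinity>"
      using False assms(1) unfolding 0 by (simp add: ennpowr_def ennreal_mult_top)
    then show ?thesis
      using False term_le_suminf_ennreal[of "\<lambda>j. ennreal ((2 ^ j) powr (p / (p - 1)))
                * emeasure M (dyadic_annulus z j) epowr (1 / (1 - p))" j]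
      by (simp add: Rp_def top_unique)
  qed
  then show False using assms by simp
qed

text \<open>Finiteness of \<open>R\<^sub>p\<close> gives, by Young's inequality, a bound for sums of the weights against
  energies, with an arbitrarily small constant term.\<close>

lemma dyadic_weight_sum_le:
  assumes p: "1 \<le> p" and R: "Rp p M z < \<infinity>" and \<epsilon>: "0 < \<epsilon>"
  obtains K where "0 \<le> K" "\<And>n e. (\<And>j. 0 \<le> e j) \<Longrightarrow>
    (\<Sum>j<n. dyadic_weight p M z j * e j powr (1 / p)) \<le> \<epsilon> + K * (\<Sum>j<n. e j)"
proof -
  let ?b = "dyadic_weight p M z"
  have b: "0 \<le> ?b j" for j by (simp add: dyadic_weight_def)
  note Req = Rp_eq_dyadic_weights[OF p dyadic_annulus_pos_of_Rp[OF p R]]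
  obtain r where r: "0 \<le> r" "Rp p M z = ennreal r" using R by (cases "Rp p M z") auto
  show ?thesis
  proof (cases "p = 1")
    case True
    have le: "?b j \<le> r" for j
    proof -
      have "ennreal (?b j) \<le> Rp p M z" unfolding Req using True by (simp, intro SUP_upper UNIV_I)
      then show ?thesis using r by (simp add: ennreal_le_iff)
    qed
    have "(\<Sum>j<n. ?b j * e j powr (1 / p)) \<le> \<epsilon> + r * (\<Sum>j<n. e j)" if "\<And>j. 0 \<le> e j" for n e
    proof -
      have "(\<Sum>j<n. ?b j * e j powr (1 / p)) \<le> (\<Sum>j<n. r * e j)"
        using True that le by (intro sum_mono) (auto intro: mult_right_mono)
      then show ?thesis using \<epsilon> by (simp add: sum_distrib_left)
    qed
    then show ?thesis using that r(1) by blast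
  next
    case False
    then have p1: "1 < p" using p by simp
    define \<epsilon>' where "\<epsilon>' = \<epsilon> / (r + 1)"
    have \<epsilon>': "0 < \<epsilon>'" "\<epsilon>' * r \<le> \<epsilon>" using \<epsilon> r(1) by (auto simp: \<epsilon>'_def field_simps)
    have sum_le: "(\<Sum>j<n. ?b j powr (p / (p - 1))) \<le> r" for n
    proof -
      have "ennreal (\<Sum>j<n. ?b j powr (p / (p - 1))) = (\<Sum>j<n. ennreal (?b j powr (p / (p - 1))))"
        by (simp add: sum_ennreal)
      also have "\<dots> \<le> (\<Sum>j. ennreal (?b j powr (p / (p - 1))))" by (rule sum_le_suminf) auto
      also have "\<dots> = Rp p M z" unfolding Req using False by simp
      finally show ?thesis using r by (simp add: ennreal_le_iff)
    qed
    have "(\<Sum>j<n. ?b j * e j powr (1 / p)) \<le> \<epsilon> + \<epsilon>' powr (1 - p) * (\<Sum>j<n. e j)" if e: "\<And>j. 0 \<le> e j" for n e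
    proof -
      have "(\<Sum>j<n. ?b j * e j powr (1 / p))
          \<le> (\<Sum>j<n. \<epsilon>' * ?b j powr (p / (p - 1)) + \<epsilon>' powr (1 - p) * e j)"
        by (intro sum_mono young_split p1 \<epsilon>' b e)
      also have "\<dots> = \<epsilon>' * (\<Sum>j<n. ?b j powr (p / (p - 1))) + \<epsilon>' powr (1 - p) * (\<Sum>j<n. e j)"
        by (simp add: sum.distrib sum_distrib_left)
      also have "\<epsilon>' * (\<Sum>j<n. ?b j powr (p / (p - 1))) \<le> \<epsilon>"
        using mult_left_mono[OF sum_le, of \<epsilon>' n] \<epsilon>' by linarith
      finally show ?thesis by simp
    qed
    then show ?thesis using that[of "\<epsilon>' powr (1 - p)"] by simp
  qed
qed

end

section \<open>Positive modulus\<close>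

text \<open>The radii double from one shell to the next, so after the first shell that contains a point at
  distance \<open>t\<close> from the centre only \<open>m - 1\<close> more can contain it.\<close>

lemma card_dyadic_shells_le:
  fixes \<alpha> \<beta> t :: real and m n :: nat
  assumes "0 < \<alpha>" "\<beta> \<le> 2 ^ m * \<alpha>"
  shows "card {j. j < n \<and> 2 ^ j * \<alpha> \<le> t \<and> t < 2 ^ j * \<beta>} \<le> m"
proof (cases "{j. j < n \<and> 2 ^ j * \<alpha> \<le> t \<and> t < 2 ^ j * \<beta>} = {}")
  case False
  let ?S = "{j. j < n \<and> 2 ^ j * \<alpha> \<le> t \<and> t < 2 ^ j * \<beta>}"
  have fin: "finite ?S" by simp
  define i where "i = Min ?S"
  have i: "i \<in> ?S" unfolding i_def using fin False by (rule Min_in)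
  have "?S \<subseteq> {i..<i + m}"
  proof
    fix j assume j: "j \<in> ?S"
    have "i \<le> j" unfolding i_def using fin j by (rule Min_le)
    have "2 ^ j * \<alpha> < 2 ^ i * \<beta>" using i j by auto
    also have "\<dots> \<le> 2 ^ i * (2 ^ m * \<alpha>)" using assms(2) by (intro mult_left_mono) auto
    also have "\<dots> = 2 ^ (i + m) * \<alpha>" by (simp add: power_add)
    finally have "(2::real) ^ j < 2 ^ (i + m)" using assms(1) by simp
    then show "j \<in> {i..<i + m}" using \<open>i \<le> j\<close> by simp
  qed
  then have "card ?S \<le> card {i..<i + m}" by (intro card_mono) auto
  then show ?thesis by simp
qed (simp only: card.empty le0)

context poincare_space
begin

lemma sum_energy_shells_le:
  assumes u: "test_pair u \<rho>" and "0 < \<alpha>" "\<beta> \<le> 2 ^ m * \<alpha>"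
  shows "(\<Sum>j<n. energy \<rho> (ball w (2 ^ j * \<beta>) - ball w (2 ^ j * \<alpha>))) \<le> real m * energy \<rho> UNIV"
proof -
  let ?S = "\<lambda>j. ball w (2 ^ j * \<beta>) - ball w (2 ^ j * \<alpha>)"
  have [measurable]: "(\<lambda>x. \<rho> x epowr p) \<in> borel_measurable M"
    using borel_measurable_epowr[OF test_pairD(5)[OF u]] by (simp add: measurable_M_iff)
  have [measurable]: "?S j \<in> sets M" for j by simp
  have "ennreal (\<Sum>j<n. energy \<rho> (?S j)) = (\<Sum>j<n. \<integral>\<^sup>+ x \<in> ?S j. \<rho> x epowr p \<partial>M)"
    unfolding set_nn_integral_energy[OF u] by (simp add: sum_ennreal)
  also have "\<dots> = (\<integral>\<^sup>+ x. (\<Sum>j<n. \<rho> x epowr p * indicator (?S j) x) \<partial>M)"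
    by (subst nn_integral_sum) auto
  also have "\<dots> \<le> (\<integral>\<^sup>+ x. of_nat m * (\<rho> x epowr p * indicator UNIV x) \<partial>M)"
  proof (rule nn_integral_mono)
    fix x
    have "(\<Sum>j<n. indicator (?S j) x :: ennreal)
        = of_nat (card {j. j < n \<and> 2 ^ j * \<alpha> \<le> dist w x \<and> dist w x < 2 ^ j * \<beta>})"
    proof -
      have "(\<Sum>j<n. indicator (?S j) x :: ennreal)
          = (\<Sum>j<n. if 2 ^ j * \<alpha> \<le> dist w x \<and> dist w x < 2 ^ j * \<beta> then 1 else 0)"
        by (intro sum.cong) (auto simp: indicator_def)
      also have "\<dots> = of_nat (card {j \<in> {..<n}. 2 ^ j * \<alpha> \<le> dist w x \<and> dist w x < 2 ^ j * \<beta>})"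
        by (simp add: sum.inter_filter[symmetric])
      finally show ?thesis by simp
    qed
    also have "\<dots> \<le> of_nat m"
      using card_dyadic_shells_le[OF assms(2,3), of n "dist w x"] by (simp add: of_nat_mono)
    finally have "\<rho> x epowr p * (\<Sum>j<n. indicator (?S j) x) \<le> \<rho> x epowr p * of_nat m"
      by (intro mult_left_mono) auto
    then show "(\<Sum>j<n. \<rho> x epowr p * indicator (?S j) x) \<le> of_nat m * (\<rho> x epowr p * indicator UNIV x)"
      by (simp add: sum_distrib_left mult.commute)
  qed
  also have "\<dots> = of_nat m * (\<integral>\<^sup>+ x \<in> UNIV. \<rho> x epowr p \<partial>M)"
    by (subst nn_integral_cmult) auto
  also have "\<dots> = ennreal (real m * energy \<rho> UNIV)"
    unfolding set_nn_integral_energy[OF u] by (simp add: ennreal_mult ennreal_of_nat_eq_real_of_nat)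
  finally show ?thesis by (subst (asm) ennreal_le_iff) auto
qed

end

context annular_space
begin

text \<open>Passing from the scale \<open>2\<^sup>j\<close> to the scale \<open>2\<^sup>j\<^sup>+\<^sup>1\<close> takes two annuli, of radii
  \<open>7/4 \<cdot> 2\<^sup>j\<close> and \<open>5/2 \<cdot> 2\<^sup>j\<close>, since an annulus of ratio two does not contain points at distances
  \<open>2\<^sup>j\<close> and \<open>2\<^sup>j\<^sup>+\<^sup>1\<close> from the centre. The points \<open>Z j\<close> and \<open>Y j\<close> lie at distances about \<open>2\<^sup>j\<close> and
  \<open>3/2 \<cdot> 2\<^sup>j\<close>.\<close>

lemma dyadic_mean_steps:
  assumes unbounded: "\<And>R. \<exists>y. R \<le> dist w y"
    and pos: "\<And>j. 0 < measure M (dyadic_annulus w j)"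
  obtains C c and B :: "nat \<Rightarrow> 'a set" where "0 \<le> C" "1 \<le> c"
    "\<And>j. \<exists>x r. 0 < r \<and> B j = ball x r" "B 0 \<subseteq> cball w 3"
    "\<And>j. B j \<inter> ball w (2 ^ j / c) = {}"
    "\<And>u \<rho> j. test_pair u \<rho> \<Longrightarrow> \<bar>mean_on M (B j) u - mean_on M (B (Suc j)) u\<bar>
       \<le> C * (dyadic_weight p M w j * energy \<rho> (ball w (2 ^ j * (4 * c)) - ball w (2 ^ j * (1 / c))) powr (1 / p))"
proof -
  obtain C \<Lambda> c where C: "0 \<le> C" and \<Lambda>: "1 \<le> \<Lambda>" and c: "1 \<le> c"
    and away: "\<And>r x. 0 < r \<Longrightarrow> x \<in> ball w r - ball w (r / 2) \<Longrightarrow> ball x (r / \<Lambda>) \<inter> ball w (r / c) = {}"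
    and diff: "\<And>u \<rho> r r' x y. test_pair u \<rho> \<Longrightarrow> 0 < r \<Longrightarrow> r \<le> r' \<Longrightarrow> r' \<le> 2 * r \<Longrightarrow>
       x \<in> ball w r - ball w (r / 2) \<Longrightarrow> y \<in> ball w r - ball w (r / 2) \<Longrightarrow>
       y \<in> ball w r' - ball w (r' / 2) \<Longrightarrow>
       \<bar>mean_on M (ball x (r / \<Lambda>)) u - mean_on M (ball y (r' / \<Lambda>)) u\<bar> \<le>
         C * (r * (energy \<rho> (ball w (c * r) - ball w (r / c)) / measure M (ball w r)) powr (1 / p)
            + r' * (energy \<rho> (ball w (c * r') - ball w (r' / c)) / measure M (ball w r')) powr (1 / p))"
    using mean_diff_in_annulus by blast
  have shell: "\<exists>z. a \<le> dist w z \<and> dist w z < b" if "0 < a" "a < b" for a b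
    using exists_point_in_shell[OF that] unbounded by blast
  have "\<exists>z. 2 ^ j \<le> dist w z \<and> dist w z < 5 / 4 * 2 ^ j" for j :: nat by (rule shell) auto
  then obtain Z where Z: "\<And>j::nat. 2 ^ j \<le> dist w (Z j) \<and> dist w (Z j) < 5 / 4 * 2 ^ j" by metis
  have "\<exists>z. 3 / 2 * 2 ^ j \<le> dist w z \<and> dist w z < 7 / 4 * 2 ^ j" for j :: nat by (rule shell) auto
  then obtain Y where Y: "\<And>j::nat. 3 / 2 * 2 ^ j \<le> dist w (Y j) \<and> dist w (Y j) < 7 / 4 * 2 ^ j" by metis
  obtain A where A: "1 \<le> A" "\<And>x y r s. 0 < s \<Longrightarrow> r \<le> 2 * s \<Longrightarrow> dist x y < r \<Longrightarrow>
      measure M (ball x r) \<le> A * measure M (ball y s)"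
    using ball_measure_comparison[of 2] by blast
  define B where "B j = ball (Z j) (7 / 4 * 2 ^ j / \<Lambda>)" for j
  define S where "S j = ball w (2 ^ j * (4 * c)) - ball w (2 ^ j * (1 / c))" for j :: nat
  define Q where "Q \<rho> r = r * (energy \<rho> (ball w (c * r) - ball w (r / c)) / measure M (ball w r)) powr (1 / p)"
    for \<rho> r
  have Q: "Q \<rho> r \<le> 4 * A powr (1 / p) * (dyadic_weight p M w j * energy \<rho> (S j) powr (1 / p))"
    if u: "test_pair u \<rho>" and r: "2 ^ j \<le> r" "r \<le> 4 * 2 ^ j" for u \<rho> r j
  proof -
    have r0: "0 < r" by (rule less_le_trans[OF _ r(1)]) simp
    have "ball w (c * r) - ball w (r / c) \<subseteq> S j"
      unfolding S_def using r c
      by (intro Diff_mono subset_ball) (auto simp: divide_right_mono mult.commute[of c] mult_right_mono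
          mult.assoc[symmetric] mult.commute[of "2 ^ j" 4])
    then have "energy \<rho> (ball w (c * r) - ball w (r / c)) \<le> energy \<rho> (S j)" by (rule energy_mono[OF u])
    moreover have "measure M (dyadic_annulus w j) \<le> A * measure M (ball w r)"
    proof -
      have "measure M (dyadic_annulus w j) \<le> measure M (ball w (2 ^ (j + 1)))"
        by (intro measure_mono_ball dyadic_annulus_borel) (auto simp: dyadic_annulus_def)
      also have "\<dots> \<le> A * measure M (ball w r)" using r r0 by (intro A) auto
      finally show ?thesis .
    qed
    then have "1 / measure M (ball w r) \<le> A / measure M (dyadic_annulus w j)"
      using pos[of j] measure_ball_pos[OF r0, of w] by (simp add: field_simps)
    ultimately have "energy \<rho> (ball w (c * r) - ball w (r / c)) * (1 / measure M (ball w r))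
       \<le> energy \<rho> (S j) * (A / measure M (dyadic_annulus w j))"
      by (intro mult_mono) auto
    then have "(energy \<rho> (ball w (c * r) - ball w (r / c)) / measure M (ball w r)) powr (1 / p)
       \<le> (energy \<rho> (S j) * (A / measure M (dyadic_annulus w j))) powr (1 / p)"
      using p by (intro powr_mono2) auto
    then have "Q \<rho> r \<le> (4 * 2 ^ j) * (energy \<rho> (S j) * (A / measure M (dyadic_annulus w j))) powr (1 / p)"
      unfolding Q_def using r r0 by (intro mult_mono) auto
    also have "\<dots> = 4 * A powr (1 / p) * (dyadic_weight p M w j * energy \<rho> (S j) powr (1 / p))"
      using A(1) pos[of j] by (simp add: dyadic_weight_def powr_mult powr_divide powr_minus_divide)
    finally show ?thesis .
  qed
  show ?thesis
  proof (rule that[of "C * 16 * A powr (1 / p)" c B])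
    show "0 \<le> C * 16 * A powr (1 / p)" using C by simp
    show "1 \<le> c" by (fact c)
    show "\<exists>x r. 0 < r \<and> B j = ball x r" for j
      unfolding B_def using \<Lambda> by (intro exI conjI) auto
    show "B 0 \<subseteq> cball w 3"
    proof
      fix x assume x: "x \<in> B 0"
      have "7 / 4 / \<Lambda> \<le> 7 / 4" using \<Lambda> by (simp add: divide_le_eq)
      then show "x \<in> cball w 3"
        using x Z[of 0] dist_triangle[of w x "Z 0"] by (simp add: B_def)
    qed
    show "B j \<inter> ball w (2 ^ j / c) = {}" for j
    proof -
      have "B j \<inter> ball w (7 / 4 * 2 ^ j / c) = {}"
        unfolding B_def using Z[of j] by (intro away) auto
      moreover have "ball w (2 ^ j / c) \<subseteq> ball w (7 / 4 * 2 ^ j / c)"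
        using c by (intro subset_ball divide_right_mono) auto
      ultimately show ?thesis by blast
    qed
    show "\<bar>mean_on M (B j) u - mean_on M (B (Suc j)) u\<bar> \<le> C * 16 * A powr (1 / p) *
       (dyadic_weight p M w j * energy \<rho> (ball w (2 ^ j * (4 * c)) - ball w (2 ^ j * (1 / c))) powr (1 / p))"
      if u: "test_pair u \<rho>" for u \<rho> j
    proof -
      let ?mY = "mean_on M (ball (Y j) (5 / 2 * 2 ^ j / \<Lambda>)) u"
      let ?q = "4 * A powr (1 / p) * (dyadic_weight p M w j * energy \<rho> (S j) powr (1 / p))"
      have B_Suc: "B (Suc j) = ball (Z (Suc j)) (7 / 2 * 2 ^ j / \<Lambda>)" by (simp add: B_def)
      have "\<bar>mean_on M (B j) u - ?mY\<bar> \<le> C * (Q \<rho> (7 / 4 * 2 ^ j) + Q \<rho> (5 / 2 * 2 ^ j))"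
        unfolding B_def Q_def using Z[of j] Y[of j] by (intro diff u) auto
      also have "\<dots> \<le> C * (?q + ?q)"
        by (intro mult_left_mono add_mono Q[OF u] C) auto
      finally have 1: "\<bar>mean_on M (B j) u - ?mY\<bar> \<le> C * (?q + ?q)" .
      have "\<bar>?mY - mean_on M (B (Suc j)) u\<bar> \<le> C * (Q \<rho> (5 / 2 * 2 ^ j) + Q \<rho> (7 / 2 * 2 ^ j))"
        unfolding B_Suc Q_def using Z[of "Suc j"] Y[of j] by (intro diff u) auto
      also have "\<dots> \<le> C * (?q + ?q)"
        by (intro mult_left_mono add_mono Q[OF u] C) auto
      finally have "\<bar>mean_on M (B j) u - mean_on M (B (Suc j)) u\<bar> \<le> C * (?q + ?q) + C * (?q + ?q)"
        using 1 by linarith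
      also have "\<dots> = C * 16 * A powr (1 / p) * (dyadic_weight p M w j * energy \<rho> (S j) powr (1 / p))"
        by (simp add: algebra_simps)
      finally show ?thesis by (simp add: S_def)
    qed
  qed
qed

text \<open>A lower bound for the capacity between a fixed ball and infinity. If \<open>u\<close> were one on the ball, its
  mean values along the balls \<open>B j\<close> would fall from one to zero; but the steps are bounded by the
  weights times the energies in shells of bounded overlap.\<close>

lemma capacity_lower_bound:
  assumes R: "Rp p M w < \<infinity>"
  obtains d where "0 < d"
    "\<And>u \<rho> N. test_pair u \<rho> \<Longrightarrow> (\<integral>\<^sup>+ x. \<rho> x epowr p \<partial>M) < ennreal d \<Longrightarrow>
       (\<And>x. x \<notin> ball w N \<Longrightarrow> u x = 0) \<Longrightarrow> \<exists>x\<in>cball w 3. u x < 1"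
proof -
  have pos: "\<And>j. 0 < measure M (dyadic_annulus w j)"
    by (rule dyadic_annulus_pos_of_Rp[OF p R])
  have unbounded: "\<exists>y. T \<le> dist w y" for T
  proof -
    obtain j where j: "T < 2 ^ j" using real_arch_pow[of 2 T] by auto
    have "dyadic_annulus w j \<noteq> {}" using pos[of j] by auto
    then obtain y where "y \<in> dyadic_annulus w j" by blast
    then have "2 ^ j \<le> dist w y" by (simp add: dyadic_annulus_def)
    then show ?thesis using j by (intro exI[of _ y]) simp
  qed
  obtain C c and B :: "nat \<Rightarrow> 'a set" where C: "0 \<le> C" and c: "1 \<le> c"
    and B: "\<And>j. \<exists>x r. 0 < r \<and> B j = ball x r" and B0: "B 0 \<subseteq> cball w 3"
    and away: "\<And>j. B j \<inter> ball w (2 ^ j / c) = {}"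
    and step: "\<And>u \<rho> j. test_pair u \<rho> \<Longrightarrow> \<bar>mean_on M (B j) u - mean_on M (B (Suc j)) u\<bar>
       \<le> C * (dyadic_weight p M w j * energy \<rho> (ball w (2 ^ j * (4 * c)) - ball w (2 ^ j * (1 / c))) powr (1 / p))"
    using dyadic_mean_steps[OF unbounded pos] by metis
  obtain K where K: "0 \<le> K" "\<And>n e. (\<And>j. 0 \<le> e j) \<Longrightarrow>
    (\<Sum>j<n. dyadic_weight p M w j * e j powr (1 / p)) \<le> 1 / (2 * (C + 1)) + K * (\<Sum>j<n. e j)"
    using dyadic_weight_sum_le[OF p R, of "1 / (2 * (C + 1))"] C by auto
  obtain m where m: "4 * c * c < 2 ^ m" using real_arch_pow[of 2 "4 * c * c"] by auto
  define L where "L = C * K * real m"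
  have L: "0 \<le> L" using C K by (simp add: L_def)
  show ?thesis
  proof (rule that[of "1 / (2 * (L + 1))"])
    show "0 < 1 / (2 * (L + 1))" using L by simp
    fix u \<rho> N
    assume u: "test_pair u \<rho>" and small: "(\<integral>\<^sup>+ x. \<rho> x epowr p \<partial>M) < ennreal (1 / (2 * (L + 1)))"
      and zero: "\<And>x. x \<notin> ball w N \<Longrightarrow> u x = 0"
    show "\<exists>x\<in>cball w 3. u x < 1"
    proof (rule ccontr)
      assume "\<not> (\<exists>x\<in>cball w 3. u x < 1)"
      then have "1 \<le> u x" if "x \<in> cball w 3" for x using that not_less by blast
      then have one: "u x = 1" if "x \<in> cball w 3" for x
        using u that by (intro antisym) (auto simp: test_pair_def)
      let ?m = "\<lambda>j. mean_on M (B j) u"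
      let ?e = "\<lambda>j. energy \<rho> (ball w (2 ^ j * (4 * c)) - ball w (2 ^ j * (1 / c)))"
      obtain n where n: "N * c < 2 ^ n" using real_arch_pow[of 2 "N * c"] by auto
      have const: "?m j = a" if "\<And>x. x \<in> B j \<Longrightarrow> u x = a" for j a
      proof -
        obtain x r where "0 < r" "B j = ball x r" using B by blast
        then show ?thesis using that test_pairD(1)[OF u] measure_ball_pos
          by (intro mean_on_const[of _ x r]) auto
      qed
      have "?m 0 = 1" using one B0 by (intro const) auto
      moreover have "?m n = 0"
      proof (rule const)
        fix x assume "x \<in> B n"
        then have "x \<notin> ball w (2 ^ n / c)" using away[of n] by blast
        moreover have "N \<le> 2 ^ n / c" using n c by (simp add: field_simps)
        ultimately show "u x = 0" by (intro zero) auto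
      qed
      moreover have telescope: "\<bar>?m 0 - ?m k\<bar> \<le> (\<Sum>j<k. C * (dyadic_weight p M w j * ?e j powr (1 / p)))" for k
      proof (induction k)
        case (Suc k)
        then show ?case using step[OF u, of k] by simp
      qed simp
      ultimately have "1 \<le> (\<Sum>j<n. C * (dyadic_weight p M w j * ?e j powr (1 / p)))"
        using telescope[of n] by simp
      also have "\<dots> = C * (\<Sum>j<n. dyadic_weight p M w j * ?e j powr (1 / p))"
        by (simp add: sum_distrib_left)
      also have "\<dots> \<le> C * (1 / (2 * (C + 1)) + K * (\<Sum>j<n. ?e j))"
        by (intro mult_left_mono K(2) C) simp
      also have "\<dots> \<le> C * (1 / (2 * (C + 1)) + K * (real m * energy \<rho> UNIV))"
        using c m by (intro mult_left_mono add_left_mono sum_energy_shells_le[OF u] C K(1))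
          (auto simp: field_simps)
      also have "\<dots> = C / (2 * (C + 1)) + L * energy \<rho> UNIV"
        by (simp add: L_def distrib_left)
      also have "C / (2 * (C + 1)) < 1 / 2" using C by (simp add: field_simps)
      also have "L * energy \<rho> UNIV \<le> L * (1 / (2 * (L + 1)))"
      proof -
        have "ennreal (energy \<rho> UNIV) < ennreal (1 / (2 * (L + 1)))"
          using small set_nn_integral_energy[OF u, of UNIV] by simp
        then have "energy \<rho> UNIV \<le> 1 / (2 * (L + 1))" by (simp add: ennreal_less_iff)
        then show ?thesis by (rule mult_left_mono[OF _ L])
      qed
      also have "L * (1 / (2 * (L + 1))) \<le> 1 / 2" using L by (simp add: field_simps)
      finally show False by simp
    qed
  qed
qed

text \<open>If the modulus vanished, a density of tiny norm would be admissible. Its continuous majorants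
  have chain potentials that vanish near infinity, hence, by the capacity bound, cheap chains lead
  from a fixed ball to infinity. They produce an infinite curve that violates admissibility.\<close>

lemma modulus_pos_of_Rp_finite:
  assumes complete: "complete (UNIV :: 'a set)" and R: "Rp p M w < \<infinity>"
  shows "0 < modulus p M infinite_curves"
proof (rule ccontr)
  assume "\<not> 0 < modulus p M infinite_curves"
  then have zero: "modulus p M infinite_curves = 0" by simp
  have p0: "0 < p" using p by simp
  obtain d where d: "0 < d" and cap:
    "\<And>u \<rho> N. test_pair u \<rho> \<Longrightarrow> (\<integral>\<^sup>+ x. \<rho> x epowr p \<partial>M) < ennreal d \<Longrightarrow>
       (\<And>x. x \<notin> ball w N \<Longrightarrow> u x = 0) \<Longrightarrow> \<exists>x\<in>cball w 3. u x < 1"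
    using capacity_lower_bound[OF R] by blast
  \<comment> \<open>The two factors \<open>2\<^sup>p\<close> come from the doubling of the density and from the dyadic levels.\<close>
  define s where "s = d / 4 / (2 powr p * 2 powr p)"
  have s: "0 < s" using d by (simp add: s_def)
  obtain \<rho> where \<rho>: "\<rho> \<in> borel_measurable borel"
    and adm: "\<And>\<gamma>. \<gamma> \<in> infinite_curves \<Longrightarrow> locally_rectifiable \<gamma> \<Longrightarrow> 1 \<le> line_integral \<gamma> \<rho>"
    and small: "(\<integral>\<^sup>+ x. \<rho> x epowr p \<partial>M) < ennreal s"
  proof -
    have "modulus p M infinite_curves < ennreal s" using zero s by simp
    then show ?thesis using that unfolding modulus_def by (auto simp: INF_less_iff)
  qed
  note \<rho> [measurable]
  obtain \<eta> :: "'a \<Rightarrow> real" where \<eta>: "continuous_on UNIV \<eta>" "\<And>x. 0 < \<eta> x"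
    "(\<integral>\<^sup>+ x. ennreal (\<eta> x powr p) \<partial>M) < ennreal (d / 4)" "\<And>R. \<exists>m>0. \<forall>x\<in>cball w R. m \<le> \<eta> x"
    using exists_small_positive_density[OF p, of "d / 4" w] d by auto
  \<comment> \<open>The limit curve only satisfies a bound by one; doubling \<open>\<rho>\<close> makes it contradict admissibility.\<close>
  have \<rho>2: "(\<integral>\<^sup>+ x. (2 * \<rho> x) epowr p \<partial>M) = ennreal (2 powr p) * (\<integral>\<^sup>+ x. \<rho> x epowr p \<partial>M)"
    using epowr_cmult[OF p0, of 2] by (simp add: nn_integral_cmult measurable_M_iff)
  obtain g :: "nat \<Rightarrow> 'a \<Rightarrow> real" where g: "\<And>n. continuous_on UNIV (g n)" "\<And>x. mono (\<lambda>n. g n x)"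
    "\<And>n x. \<eta> x \<le> g n x" "\<And>x. 2 * \<rho> x \<le> (SUP n. ennreal (g n x))"
    and g_int: "\<And>n. (\<integral>\<^sup>+ x. ennreal (g n x) epowr p \<partial>M) \<le> ennreal (2 powr p) * (\<integral>\<^sup>+ x. (2 * \<rho> x) epowr p \<partial>M)
        + (\<integral>\<^sup>+ x. ennreal (\<eta> x powr p) \<partial>M) + ennreal (d / 4)"
    by (rule continuous_majorant_sequence[OF sets_M p \<eta>(1,2), of "\<lambda>x. 2 * \<rho> x" "d / 4"])
      (use \<eta>(3) d in \<open>auto intro: less_trans\<close>)
  have g_nonneg: "0 \<le> g n x" for n x using g(3)[of x n] \<eta>(2)[of x] by simp
  have g_small: "(\<integral>\<^sup>+ x. ennreal (g n x) epowr p \<partial>M) < ennreal d" for n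
  proof -
    have "ennreal (2 powr p) * (\<integral>\<^sup>+ x. (2 * \<rho> x) epowr p \<partial>M) \<le> ennreal (2 powr p) * (ennreal (2 powr p) * ennreal s)"
      unfolding \<rho>2 using small by (intro mult_left_mono) auto
    also have "\<dots> = ennreal (2 powr p * (2 powr p * s))" using s by (simp add: ennreal_mult)
    also have "2 powr p * (2 powr p * s) = d / 4" by (simp add: s_def)
    finally have "(\<integral>\<^sup>+ x. ennreal (g n x) epowr p \<partial>M) \<le> ennreal (d / 4) + ennreal (d / 4) + ennreal (d / 4)"
      using g_int[of n] \<eta>(3) by (meson add_mono less_imp_le order_refl order_trans)
    also have "\<dots> < ennreal d" using d by (simp add: ennreal_less_iff flip: ennreal_plus)
    finally show ?thesis .
  qed
  have chains: "\<exists>x\<in>cball w 3. chain_potential (g n) (1 / real (Suc n)) (- ball w (real n)) x < 1" for n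
  proof (rule cap[where \<rho> = "\<lambda>x. ennreal (g n x)" and N = "real n"])
    let ?u = "chain_potential (g n) (1 / real (Suc n)) (- ball w (real n))"
    show "test_pair ?u (\<lambda>x. ennreal (g n x))"
      unfolding test_pair_def
      using g_small[of n] g_nonneg g(1)
      by (auto intro!: borel_measurable_continuous_onI continuous_on_chain_potential chain_potential_nonneg
          chain_potential_le_1 upper_gradient_chain_potential intro: less_trans)
    show "?u x = 0" if "x \<notin> ball w (real n)" for x
      using that g_nonneg by (intro chain_potential_eq_0) auto
  qed (fact g_small)
  have lower: "\<exists>m>0. \<forall>x\<in>cball w R. m \<le> g 0 x" for R
    using \<eta>(4)[of R] g(3)[of _ 0] order_trans by blast
  obtain \<gamma> where \<gamma>: "({0..}, \<gamma>) \<in> infinite_curves"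
    "line_integral ({0..}, \<gamma>) (\<lambda>x. SUP n. ennreal (g n x)) \<le> 1"
    using exists_cheap_infinite_curve[OF compact_cball_of_doubling[OF complete] g(1,2) lower g_nonneg chains] by blast
  have rect: "locally_rectifiable ({0..}, \<gamma>)" using \<gamma>(1) by (simp add: infinite_curves_def)
  have "2 * line_integral ({0..}, \<gamma>) \<rho> = line_integral ({0..}, \<gamma>) (\<lambda>x. 2 * \<rho> x)"
    by (rule line_integral_cmult[OF rect \<rho>, symmetric])
  also have "\<dots> \<le> line_integral ({0..}, \<gamma>) (\<lambda>x. SUP n. ennreal (g n x))"
    by (rule line_integral_mono[OF g(4)])
  finally have "2 * line_integral ({0..}, \<gamma>) \<rho> \<le> 1" using \<gamma>(2) by simp
  moreover have "2 * 1 \<le> 2 * line_integral ({0..}, \<gamma>) \<rho>"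
    using adm[OF \<gamma>(1) rect] by (intro mult_left_mono) auto
  ultimately have "(2::ennreal) \<le> 1" using order_trans by fastforce
  then show False by simp
qed

end

section \<open>Limits along curves of finite energy\<close>

text \<open>If all line integrals of \<open>\<rho>\<close> were infinite, every positive multiple of \<open>\<rho>\<close> would be admissible.\<close>

lemma exists_curve_finite_line_integral:
  fixes M :: "'a::metric_space measure"
  assumes M: "sets M = sets borel" and p: "0 < p" and pos: "0 < modulus p M infinite_curves"
    and \<rho>: "\<rho> \<in> borel_measurable borel" "(\<integral>\<^sup>+ x. \<rho> x epowr p \<partial>M) < \<infinity>"
  obtains \<gamma> where "({0..}, \<gamma>) \<in> infinite_curves" "line_integral ({0..}, \<gamma>) \<rho> < \<infinity>"
proof (rule ccontr)
  note curve = that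
  assume no: "\<not> thesis"
  have inf: "line_integral ({0..}, \<gamma>) \<rho> = \<infinity>" if \<gamma>: "({0..}, \<gamma>) \<in> infinite_curves" for \<gamma>
  proof (rule ccontr)
    assume "line_integral ({0..}, \<gamma>) \<rho> \<noteq> \<infinity>"
    then have thesis using \<gamma> by (intro curve[of \<gamma>]) (simp_all add: less_top)
    then show False using no by simp
  qed
  have [measurable]: "\<rho> \<in> borel_measurable M" using \<rho>(1) by (simp add: measurable_cong_sets[OF M refl])
  obtain I where I: "0 \<le> I" "(\<integral>\<^sup>+ x. \<rho> x epowr p \<partial>M) = ennreal I"
    using \<rho>(2) by (cases "\<integral>\<^sup>+ x. \<rho> x epowr p \<partial>M") auto
  have mod_le: "modulus p M infinite_curves \<le> ennreal (c powr p * I)" if c: "0 < c" for c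
  proof -
    have "modulus p M infinite_curves \<le> (\<integral>\<^sup>+ x. (ennreal c * \<rho> x) epowr p \<partial>M)"
      unfolding modulus_def
    proof (rule INF_lower, clarify, intro conjI ballI impI)
      show "(\<lambda>x. ennreal c * \<rho> x) \<in> borel_measurable borel" using \<rho>(1) by simp
      fix \<Gamma> :: "'a curve" assume \<Gamma>: "\<Gamma> \<in> infinite_curves" "locally_rectifiable \<Gamma>"
      then obtain \<gamma> where eq: "\<Gamma> = ({0..}, \<gamma>)" by (auto simp: infinite_curves_def)
      have "line_integral \<Gamma> (\<lambda>x. ennreal c * \<rho> x) = ennreal c * \<infinity>"
        using \<Gamma> inf[of \<gamma>] \<rho>(1) unfolding eq by (simp add: line_integral_cmult)
      then show "1 \<le> line_integral \<Gamma> (\<lambda>x. ennreal c * \<rho> x)" using c by (simp add: ennreal_mult_top)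
    qed
    also have "\<dots> = ennreal (c powr p * I)"
      using I c p by (simp add: epowr_cmult nn_integral_cmult ennreal_mult)
    finally show ?thesis .
  qed
  have "modulus p M infinite_curves < \<infinity>" using mod_le[of 1] by (auto intro: order_le_less_trans)
  then obtain m where m: "modulus p M infinite_curves = ennreal m" "0 < m"
    using pos by (cases "modulus p M infinite_curves") auto
  define c where "c = (m / (2 * (I + 1))) powr (1 / p)"
  have c: "0 < c" "c powr p = m / (2 * (I + 1))" using m I(1) p by (auto simp: c_def powr_powr)
  have "m \<le> c powr p * I" using mod_le[OF c(1)] m I(1) by (simp add: ennreal_le_iff)
  also have "\<dots> < m" using m(2) I(1) unfolding c(2) by (simp add: field_simps add_nonneg_pos)
  finally show False by simp
qed

text \<open>The increments of \<open>h\<close> are dominated by those of a bounded monotone function, so \<open>h\<close> is Cauchy at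
  infinity.\<close>

lemma convergent_at_top_of_mono_majorant:
  fixes h f :: "real \<Rightarrow> real"
  assumes le: "\<And>s t. 0 \<le> s \<Longrightarrow> s \<le> t \<Longrightarrow> \<bar>h s - h t\<bar> \<le> f t - f s"
    and bounded: "\<And>t. 0 \<le> t \<Longrightarrow> f t \<le> J"
  shows "\<exists>L. (h \<longlongrightarrow> L) at_top"
proof -
  have f_mono: "f s \<le> f t" if "0 \<le> s" "s \<le> t" for s t using le[OF that] by linarith
  define l where "l = (SUP n. f (real n))"
  have bdd: "bdd_above (range (\<lambda>n. f (real n)))" using bounded by (intro bdd_aboveI[of _ J]) auto
  have f_le_l: "f t \<le> l" if "0 \<le> t" for t
  proof -
    have "f t \<le> f (real (nat \<lceil>t\<rceil>))" using that by (intro f_mono real_nat_ceiling_ge)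
    also have "\<dots> \<le> l" unfolding l_def by (rule cSUP_upper[OF UNIV_I bdd])
    finally show ?thesis .
  qed
  have near: "\<exists>N. \<forall>t\<ge>real N. \<bar>h (real N) - h t\<bar> < e" if e: "0 < e" for e
  proof -
    obtain N where N: "l - e < f (real N)"
      using less_cSUP_iff[of UNIV "\<lambda>n. f (real n)" "l - e"] bdd e unfolding l_def by auto
    have "\<bar>h (real N) - h t\<bar> < e" if "real N \<le> t" for t
      using le[of "real N" t] f_le_l[of t] N that by simp
    then show ?thesis by blast
  qed
  have "Cauchy (\<lambda>n. h (real n))"
    unfolding Cauchy_def dist_real_def
  proof (intro allI impI)
    fix e :: real assume "0 < e"
    then obtain N where N: "\<forall>t\<ge>real N. \<bar>h (real N) - h t\<bar> < e / 2" using near[of "e / 2"] by auto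
    have "\<bar>h (real m) - h (real n)\<bar> < e" if "m \<ge> N" "n \<ge> N" for m n
    proof -
      have "\<bar>h (real N) - h (real m)\<bar> < e / 2" "\<bar>h (real N) - h (real n)\<bar> < e / 2"
        using N that by auto
      then show ?thesis by linarith
    qed
    then show "\<exists>N. \<forall>m\<ge>N. \<forall>n\<ge>N. \<bar>h (real m) - h (real n)\<bar> < e" by blast
  qed
  then obtain L where L: "(\<lambda>n. h (real n)) \<longlonglongrightarrow> L" using Cauchy_convergent convergent_def by blast
  have "(h \<longlongrightarrow> L) at_top"
  proof (rule tendstoI)
    fix e :: real assume e: "0 < e"
    then obtain N where N: "\<forall>t\<ge>real N. \<bar>h (real N) - h t\<bar> < e / 3" using near[of "e / 3"] by auto
    have "\<forall>\<^sub>F n in sequentially. N \<le> n \<and> dist (h (real n)) L < e / 3"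
      using L e by (intro eventually_conj eventually_ge_at_top tendstoD) auto
    then obtain n where n: "n \<ge> N" "dist (h (real n)) L < e / 3"
      by (auto simp: eventually_sequentially)
    have "dist (h t) L < e" if "real N \<le> t" for t
    proof -
      have "\<bar>h (real N) - h t\<bar> < e / 3" "\<bar>h (real N) - h (real n)\<bar> < e / 3" "\<bar>h (real n) - L\<bar> < e / 3"
        using N n that by (auto simp: dist_real_def)
      then show ?thesis unfolding dist_real_def by linarith
    qed
    then show "\<forall>\<^sub>F t in at_top. dist (h t) L < e" by (auto simp: eventually_at_top_linorder)
  qed
  then show ?thesis by blast
qed

text \<open>The line integral over the initial piece of the curve serves as the monotone majorant.\<close>

lemma limit_along_curve_of_finite_line_integral:
  assumes \<gamma>: "({0..}, \<gamma>) \<in> infinite_curves" "line_integral ({0..}, \<gamma>) \<rho> < \<infinity>"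
    and ug: "upper_gradient \<rho> u"
  shows "\<exists>L::real. ((\<lambda>t. u (\<gamma> t)) \<longlongrightarrow> L) at_top"
proof -
  have rect: "locally_rectifiable ({0..}, \<gamma>)" using \<gamma>(1) by (simp add: infinite_curves_def)
  have \<rho>: "\<rho> \<in> borel_measurable borel" using ug by (simp add: upper_gradient_def)
  obtain J where J: "0 \<le> J" "line_integral ({0..}, \<gamma>) \<rho> = ennreal J"
    using \<gamma>(2) by (cases "line_integral ({0..}, \<gamma>) \<rho>") auto
  define f where "f t = enn2real (line_integral_on 0 t \<gamma> \<rho>)" for t
  have F_le: "line_integral_on 0 t \<gamma> \<rho> \<le> ennreal J" if "0 \<le> t" for t
    using line_integral_on_le_line_integral[OF that, of "{0..}" \<gamma> \<rho>] J by simp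
  have F: "line_integral_on 0 t \<gamma> \<rho> = ennreal (f t)" if "0 \<le> t" for t
    using order_le_less_trans[OF F_le[OF that] ennreal_less_top] unfolding f_def by simp
  show ?thesis
  proof (rule convergent_at_top_of_mono_majorant)
    fix t :: real assume t: "0 \<le> t"
    show "f t \<le> J" using F_le[OF t] F[OF t] J(1) by (simp add: ennreal_le_iff)
  next
    fix s t :: real assume st: "0 \<le> s" "s \<le> t"
    interpret rectifiable_curve 0 t \<gamma>
      using st by (intro rectifiable_curve_of_locally_rectifiable[OF rect]) auto
    have "ennreal \<bar>u (\<gamma> s) - u (\<gamma> t)\<bar> \<le> line_integral_on s t \<gamma> \<rho>"
    proof (cases "\<gamma> constant_on {s..t}")
      case True
      then have "\<gamma> s = \<gamma> t" using st unfolding constant_on_def by force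
      then show ?thesis by simp
    next
      case False
      then have "is_curve ({s..t}, \<gamma>)"
        using cont st by (auto simp: is_curve_def is_interval_cc intro: continuous_on_subset)
      then show ?thesis
        using ug curve_length_finite[of s t] st unfolding upper_gradient_def by auto
    qed
    then have "ennreal (f s) + ennreal \<bar>u (\<gamma> s) - u (\<gamma> t)\<bar>
        \<le> line_integral_on 0 s \<gamma> \<rho> + line_integral_on s t \<gamma> \<rho>"
      using F[OF st(1)] by (simp add: add_left_mono)
    also have "\<dots> \<le> ennreal (f t)"
      using line_integral_on_add_le[OF _ \<rho>, of s] F[of t] st by simp
    finally have "ennreal (f s + \<bar>u (\<gamma> s) - u (\<gamma> t)\<bar>) \<le> ennreal (f t)"
      by (simp add: f_def)
    then have "f s + \<bar>u (\<gamma> s) - u (\<gamma> t)\<bar> \<le> f t"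
      by (subst (asm) ennreal_le_iff) (auto simp: f_def)
    then show "\<bar>u (\<gamma> s) - u (\<gamma> t)\<bar> \<le> f t - f s" by simp
  qed
qed

section \<open>Coefficients witnessing divergence\<close>

lemma abel_dini_increment:
  fixes s t p :: real
  assumes "1 < p" "0 < s" "s \<le> t"
  shows "(t - s) / t powr p \<le> (s powr (1 - p) - t powr (1 - p)) / (p - 1)"
proof (cases "s = t")
  case False
  then have "s < t" using assms by simp
  have "\<exists>z. s < z \<and> z < t \<and> t powr (1 - p) - s powr (1 - p) = (t - s) * ((1 - p) * z powr (1 - p - 1))"
    using \<open>s < t\<close> assms by (intro MVT2) (auto intro!: derivative_eq_intros)
  then obtain z where z: "s < z" "z < t"
    "t powr (1 - p) - s powr (1 - p) = (t - s) * ((1 - p) * z powr (- p))" by auto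
  have "t powr (- p) \<le> z powr (- p)" using z assms by (intro powr_mono2') auto
  then have "(p - 1) * ((t - s) * t powr (- p)) \<le> (p - 1) * ((t - s) * z powr (- p))"
    using assms by (intro mult_left_mono) auto
  also have "\<dots> = s powr (1 - p) - t powr (1 - p)" using z(3) by (simp add: algebra_simps)
  finally have "(t - s) * t powr (- p) \<le> (s powr (1 - p) - t powr (1 - p)) / (p - 1)"
    using assms by (simp add: field_simps)
  then show ?thesis by (simp add: powr_minus divide_inverse)
qed simp

text \<open>The Abel--Dini theorem. Tails of the first series contain blocks over which \<open>S\<close> doubles, and the
  terms of the second one are dominated by the increments of the convergent sequence \<open>S powr (1 - p)\<close>.\<close>

lemma abel_dini:
  fixes \<beta> :: "nat \<Rightarrow> real"
  assumes pos: "\<And>j. 0 < \<beta> j" and div: "\<not> summable \<beta>" and p: "1 < p"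
  defines "S \<equiv> \<lambda>n. \<Sum>j\<le>n. \<beta> j"
  shows "\<not> summable (\<lambda>j. \<beta> j / S j)" "summable (\<lambda>j. \<beta> j / S j powr p)"
proof -
  have S_pos: "0 < S n" for n unfolding S_def using pos by (intro sum_pos) auto
  have S_Suc: "S (Suc n) = S n + \<beta> (Suc n)" for n by (simp add: S_def)
  have S_mono: "S m \<le> S n" if "m \<le> n" for m n
    unfolding S_def using that pos by (intro sum_mono2) (auto intro: less_imp_le)
  show "\<not> summable (\<lambda>j. \<beta> j / S j)"
  proof
    assume "summable (\<lambda>j. \<beta> j / S j)"
    then obtain N where N: "\<And>m n. m \<ge> N \<Longrightarrow> norm (\<Sum>j\<in>{m..<n}. \<beta> j / S j) < 1 / 2"
      unfolding summable_Cauchy by (meson half_gt_zero zero_less_one)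
    have "\<exists>n. 2 * S N < S n"
    proof (rule ccontr)
      assume "\<not> (\<exists>n. 2 * S N < S n)"
      then have "S n \<le> 2 * S N" for n by (simp add: not_less)
      then have "summable \<beta>"
        using pos by (intro bounded_imp_summable[of \<beta> "2 * S N"]) (auto simp: S_def intro: less_imp_le)
      then show False using div by blast
    qed
    then obtain n where n: "2 * S N < S n" by blast
    then have "N < n" using S_mono[of n N] S_pos[of N] by (intro not_le_imp_less notI) auto
    have "S n - S N = (\<Sum>j\<in>{Suc N..<Suc n}. \<beta> j)"
    proof -
      have eq: "{..n} = {..N} \<union> {Suc N..<Suc n}" using \<open>N < n\<close> by auto
      have "S n = S N + (\<Sum>j\<in>{Suc N..<Suc n}. \<beta> j)"
        unfolding S_def eq by (rule sum.union_disjoint) auto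
      then show ?thesis by simp
    qed
    then have "(S n - S N) / S n = (\<Sum>j\<in>{Suc N..<Suc n}. \<beta> j / S n)" by (simp only: sum_divide_distrib)
    also have "\<dots> \<le> (\<Sum>j\<in>{Suc N..<Suc n}. \<beta> j / S j)"
      using pos S_pos by (intro sum_mono divide_left_mono S_mono) (auto intro: less_imp_le)
    also have "\<dots> < 1 / 2" using N[of "Suc N" "Suc n"] by (simp del: sum.op_ivl_Suc)
    finally show False using n S_pos[of n] by (simp add: field_simps)
  qed
  have bound: "(\<Sum>j\<le>n. \<beta> j / S j powr p)
      \<le> \<beta> 0 / S 0 powr p + (S 0 powr (1 - p) - S n powr (1 - p)) / (p - 1)" for n
  proof (induction n)
    case (Suc n)
    have "\<beta> (Suc n) / S (Suc n) powr p \<le> (S n powr (1 - p) - S (Suc n) powr (1 - p)) / (p - 1)"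
      using abel_dini_increment[OF p S_pos[of n], of "S (Suc n)"] S_mono[of n "Suc n"] by (simp add: S_Suc)
    then show ?case using Suc by (simp add: diff_divide_distrib)
  qed simp
  show "summable (\<lambda>j. \<beta> j / S j powr p)"
  proof (rule bounded_imp_summable)
    show "0 \<le> \<beta> n / S n powr p" for n using pos[of n] by simp
    show "(\<Sum>j\<le>n. \<beta> j / S j powr p) \<le> \<beta> 0 / S 0 powr p + S 0 powr (1 - p) / (p - 1)" for n
      using bound[of n] p by (simp add: diff_divide_distrib) (smt (verit) divide_nonneg_pos powr_ge_zero)
  qed
qed

text \<open>A sequence outside the dual space of \<open>\<ell>\<^sup>p\<close> pairs to infinity with some nonnegative element of \<open>\<ell>\<^sup>p\<close>.
  For \<open>p > 1\<close>, the sequence \<open>a = \<beta> / S\<close> of the Abel--Dini theorem for the powers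
  \<open>\<beta> = b powr (p / (p - 1))\<close> does this, since \<open>(\<beta> / b) powr p = \<beta>\<close>. For \<open>p = 1\<close>, the indicator of a
  subsequence along which \<open>b\<close> grows exponentially is enough.\<close>

lemma exists_divergent_pairing:
  fixes b :: "nat \<Rightarrow> real"
  assumes pos: "\<And>j. 0 < b j" and p: "1 \<le> p"
    and div: "if p = 1 then \<not> bdd_above (range b) else \<not> summable (\<lambda>j. b j powr (p / (p - 1)))"
  obtains a where "\<And>j. 0 \<le> a j" "\<not> summable a" "summable (\<lambda>j. (a j / b j) powr p)"
proof (cases "p = 1")
  case True
  have large: "\<exists>j>n. B \<le> b j" for n B
  proof (rule ccontr)
    assume no: "\<not> (\<exists>j>n. B \<le> b j)"
    have "b j \<le> max B (Max (b ` {..n}))" for j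
      using no by (cases "j \<le> n") (auto simp: not_le le_max_iff_disj intro: Max_ge less_imp_le)
    then show False using div True by (auto simp: bdd_above_def)
  qed
  obtain r :: "nat \<Rightarrow> nat" where r: "\<And>k. 2 ^ k \<le> b (r k)" "\<And>k. r k < r (Suc k)"
    using dependent_nat_choice[of "\<lambda>k j. 2 ^ k \<le> b j" "\<lambda>k j j'. j < j'"] large by metis
  have "strict_mono r" using r(2) by (simp add: strict_mono_Suc_iff)
  define a :: "nat \<Rightarrow> real" where "a j = indicator (range r) j" for j
  show ?thesis
  proof (rule that[of a])
    show "0 \<le> a j" for j by (simp add: a_def)
    show "\<not> summable a"
    proof
      assume "summable a"
      then have "(\<lambda>k. a (r k)) \<longlonglongrightarrow> 0"
        using LIMSEQ_subseq_LIMSEQ[OF summable_LIMSEQ_zero \<open>strict_mono r\<close>] by (simp add: o_def)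
      then show False by (simp add: a_def LIMSEQ_const_iff)
    qed
    have "summable (\<lambda>k. (a (r k) / b (r k)) powr p)"
    proof (rule summable_comparison_test'[of "\<lambda>k. (1 / 2) ^ k"])
      fix k :: nat
      have "1 / b (r k) \<le> 1 / 2 ^ k" using r(1)[of k] by (intro divide_left_mono mult_pos_pos pos) auto
      then show "norm ((a (r k) / b (r k)) powr p) \<le> (1 / 2) ^ k"
        using True pos[of "r k"] by (simp add: a_def power_divide)
    qed simp
    then show "summable (\<lambda>j. (a j / b j) powr p)"
      by (subst (asm) summable_mono_reindex[OF \<open>strict_mono r\<close>]) (auto simp: a_def)
  qed
next
  case False
  then have p1: "1 < p" using p by simp
  define \<beta> where "\<beta> j = b j powr (p / (p - 1))" for j
  define S where "S n = (\<Sum>j\<le>n. \<beta> j)" for n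
  have \<beta>: "0 < \<beta> j" for j using pos[of j] by (simp add: \<beta>_def)
  have S_pos: "0 < S n" for n unfolding S_def using \<beta> by (intro sum_pos) auto
  have "\<not> summable \<beta>" using div False by (simp add: \<beta>_def[abs_def])
  note dini = abel_dini[OF \<beta> this p1, folded S_def]
  have "(\<beta> j / S j / b j) powr p = \<beta> j / S j powr p" for j
  proof -
    have "\<beta> j / b j = b j powr (p / (p - 1) - 1)" using pos[of j] by (simp add: \<beta>_def powr_diff)
    also have "p / (p - 1) - 1 = 1 / (p - 1)" using p1 by (simp add: field_simps)
    finally have "(\<beta> j / b j) powr p = \<beta> j" by (simp only: powr_powr) (simp add: \<beta>_def)
    moreover have "\<beta> j / S j / b j = \<beta> j / b j / S j" by simp
    ultimately show ?thesis using S_pos[of j] \<beta>[of j] pos[of j] by (simp only: powr_divide)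
  qed
  then show ?thesis
    using dini S_pos \<beta> by (intro that[of "\<lambda>j. \<beta> j / S j"]) (auto intro: less_imp_le)
qed

section \<open>Oscillating radial functions\<close>

definition dyadic_ramp :: "nat \<Rightarrow> real \<Rightarrow> real" where
  "dyadic_ramp j t = max 0 (min 1 (t / 2 ^ j - 1))"

definition radial_profile :: "(nat \<Rightarrow> real) \<Rightarrow> real \<Rightarrow> real" where
  "radial_profile a t = (\<Sum>j. a j * dyadic_ramp j t)"

lemma dyadic_ramp_eq_0:
  assumes "t \<le> 2 ^ j"
  shows "dyadic_ramp j t = 0"
  unfolding dyadic_ramp_def by (rule max_absorb1, rule min.coboundedI2) (use assms in simp)

lemma dyadic_ramp_eq_1:
  assumes "2 * 2 ^ j \<le> t"
  shows "dyadic_ramp j t = 1"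
proof -
  have "min 1 (t / 2 ^ j - 1) = 1" by (rule min_absorb1) (use assms in \<open>simp add: field_simps\<close>)
  then show ?thesis by (simp add: dyadic_ramp_def)
qed

lemma radial_profile_eq_sum:
  assumes "t \<le> 2 ^ n"
  shows "radial_profile a t = (\<Sum>j<n. a j * dyadic_ramp j t)"
  unfolding radial_profile_def
proof (rule suminf_finite)
  fix j assume "j \<notin> {..<n}"
  then have "(2::real) ^ n \<le> 2 ^ j" by (intro power_increasing) auto
  then have "t \<le> 2 ^ j" using assms by linarith
  then show "a j * dyadic_ramp j t = 0" by (simp add: dyadic_ramp_eq_0)
qed simp

lemma continuous_on_radial_profile: "continuous_on A (radial_profile a)"
proof -
  have "isCont (radial_profile a) t" for t
  proof -
    obtain n where n: "t < 2 ^ n" using real_arch_pow[of 2 t] by auto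
    have "continuous_on {..<2 ^ n} (\<lambda>t. \<Sum>j<n. a j * dyadic_ramp j t)"
      unfolding dyadic_ramp_def by (intro continuous_intros) auto
    then have "continuous_on {..<2 ^ n} (radial_profile a)"
      by (rule continuous_on_eq) (simp add: radial_profile_eq_sum[of _ n])
    then show ?thesis using n by (simp add: continuous_on_eq_continuous_at)
  qed
  then show ?thesis by (simp add: continuous_at_imp_continuous_on)
qed

lemma radial_profile_ge:
  assumes "\<And>j. 0 \<le> a j" "2 ^ n \<le> t"
  shows "(\<Sum>j<n. a j) \<le> radial_profile a t"
proof -
  obtain m where m: "t < 2 ^ m" using real_arch_pow[of 2 t] by auto
  have "n \<le> m"
  proof (rule ccontr)
    assume "\<not> n \<le> m"
    then have "(2::real) ^ m \<le> 2 ^ n" by (intro power_increasing) auto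
    then show False using m assms(2) by linarith
  qed
  have "(\<Sum>j<n. a j) = (\<Sum>j<n. a j * dyadic_ramp j t)"
  proof (rule sum.cong)
    fix j assume "j \<in> {..<n}"
    then have "(2::real) * 2 ^ j \<le> 2 ^ n" using power_increasing[of "Suc j" n "2::real"] by simp
    then have "2 * 2 ^ j \<le> t" using assms(2) by linarith
    then show "a j = a j * dyadic_ramp j t" by (simp add: dyadic_ramp_eq_1)
  qed simp
  also have "\<dots> \<le> (\<Sum>j<m. a j * dyadic_ramp j t)"
    using assms \<open>n \<le> m\<close> by (intro sum_mono2) (auto simp: dyadic_ramp_def)
  also have "\<dots> = radial_profile a t" using m by (simp add: radial_profile_eq_sum[of _ m])
  finally show ?thesis .
qed

lemma radial_profile_unbounded:
  assumes "\<And>j. 0 \<le> a j" "\<not> summable a"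
  obtains T where "\<And>t. T \<le> t \<Longrightarrow> B \<le> radial_profile a t"
proof -
  have "\<exists>n. B \<le> (\<Sum>j<n. a j)"
  proof (rule ccontr)
    assume "\<not> (\<exists>n. B \<le> (\<Sum>j<n. a j))"
    then have "(\<Sum>j<n. a j) \<le> B" for n by (simp add: not_le less_imp_le)
    then have "summable a" by (rule summableI_nonneg_bounded[OF assms(1)])
    then show False using assms(2) by blast
  qed
  then obtain n where "B \<le> (\<Sum>j<n. a j)" by blast
  then show ?thesis
    using radial_profile_ge[OF assms(1), of n] by (intro that[of "2 ^ n"]) (rule order_trans)
qed

text \<open>Here \<open>s2\<close> is the first time at which \<open>f\<close> reaches \<open>y\<close>, and \<open>s1\<close> the last time before it at which \<open>f\<close>
  is at most \<open>x\<close>.\<close>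

lemma lipschitz_crossing:
  fixes f :: "real \<Rightarrow> real"
  assumes lip: "\<And>s t. \<bar>f s - f t\<bar> \<le> \<bar>s - t\<bar>" and "0 \<le> L" and "x < y" "f 0 \<le> x" "y \<le> f L"
  obtains s1 s2 where "0 \<le> s1" "s1 \<le> s2" "s2 \<le> L" "y - x \<le> s2 - s1" "\<And>s. s1 < s \<Longrightarrow> s < s2 \<Longrightarrow> x < f s \<and> f s < y"
proof -
  have cont: "continuous_on A f" for A
    using lip by (intro lipschitz_on_continuous_on[where L = 1] lipschitz_onI) (auto simp: dist_real_def)
  have cl: "closed {s \<in> {0..r}. y \<le> f s}" "closed {s \<in> {0..r}. f s \<le> x}" for r
    using continuous_closed_preimage[OF cont closed_atLeastAtMost[of 0 r], of "{y..}"]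
      continuous_closed_preimage[OF cont closed_atLeastAtMost[of 0 r], of "{..x}"]
    by (simp_all add: Int_def vimage_def)
  have co: "compact {s \<in> {0..r}. y \<le> f s}" "compact {s \<in> {0..r}. f s \<le> x}" for r
    using cl by (auto intro!: compact_Int_closed[of "{0..r}", unfolded Int_def] simp: compact_eq_bounded_closed
        intro: bounded_subset[OF bounded_closed_interval])
  have "{s \<in> {0..L}. y \<le> f s} \<noteq> {}" using assms by auto
  then obtain s2 where s2: "s2 \<in> {s \<in> {0..L}. y \<le> f s}" "\<forall>s\<in>{s \<in> {0..L}. y \<le> f s}. s2 \<le> s"
    using compact_attains_inf[OF co(1)] by blast
  then have "{s \<in> {0..s2}. f s \<le> x} \<noteq> {}" using assms by auto
  then obtain s1 where s1: "s1 \<in> {s \<in> {0..s2}. f s \<le> x}" "\<forall>s\<in>{s \<in> {0..s2}. f s \<le> x}. s \<le> s1"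
    using compact_attains_sup[OF co(2)] by blast
  show ?thesis
  proof (rule that[of s1 s2])
    show "y - x \<le> s2 - s1" using lip[of s2 s1] s1 s2 by auto
    show "x < f s \<and> f s < y" if "s1 < s" "s < s2" for s
    proof -
      have "s \<in> {0..s2}" "s \<in> {0..L}" using s1(1) s2(1) that by auto
      then have "\<not> f s \<le> x" "\<not> y \<le> f s"
        using s1(2)[rule_format, of s] s2(2)[rule_format, of s] that by auto
      then show ?thesis by simp
    qed
  qed (use s1 s2 in auto)
qed

text \<open>The ramp changes only while \<open>f\<close> crosses the interval on which it increases, where its slope is
  \<open>1 / 2\<^sup>j\<close>. Reversing the time reduces decreasing to increasing crossings.\<close>

lemma dyadic_ramp_diff_le:
  fixes f :: "real \<Rightarrow> real"
  assumes lip: "\<And>s t. \<bar>f s - f t\<bar> \<le> \<bar>s - t\<bar>" and L: "0 \<le> L"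
  shows "ennreal (2 ^ j * \<bar>dyadic_ramp j (f 0) - dyadic_ramp j (f L)\<bar>)
    \<le> emeasure lborel {s \<in> {0..L}. 2 ^ j \<le> f s \<and> f s < 2 ^ (j + 1)}"
proof -
  let ?A = "\<lambda>f. {s \<in> {0..L}. 2 ^ j \<le> f s \<and> f s < 2 ^ (j + 1)}"
  have up: "\<exists>I. I \<subseteq> ?A f \<and> I \<in> sets lborel \<and>
      ennreal (2 ^ j * (dyadic_ramp j (f L) - dyadic_ramp j (f 0))) \<le> emeasure lborel I"
    if lip: "\<And>s t. \<bar>f s - f t\<bar> \<le> \<bar>s - t\<bar>" and less: "dyadic_ramp j (f 0) < dyadic_ramp j (f L)"
    for f :: "real \<Rightarrow> real"
  proof -
    define x where "x = 2 ^ j * (1 + dyadic_ramp j (f 0))"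
    define y where "y = 2 ^ j * (1 + dyadic_ramp j (f L))"
    have x: "2 ^ j \<le> x" "f 0 \<le> x" and y: "y \<le> 2 ^ (j + 1)" "y \<le> f L" and "x < y"
      using less by (auto simp: x_def y_def dyadic_ramp_def field_simps max_def min_def split: if_splits)
    obtain s1 s2 where s: "0 \<le> s1" "s1 \<le> s2" "s2 \<le> L" "y - x \<le> s2 - s1"
      "\<And>s. s1 < s \<Longrightarrow> s < s2 \<Longrightarrow> x < f s \<and> f s < y"
      using lipschitz_crossing[OF lip L \<open>x < y\<close> x(2) y(2)] by blast
    have "{s1<..<s2} \<subseteq> ?A f" using s x(1) y(1) by fastforce
    moreover have "2 ^ j * (dyadic_ramp j (f L) - dyadic_ramp j (f 0)) = y - x"
      by (simp add: x_def y_def algebra_simps)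
    ultimately show ?thesis
      using s by (intro exI[of _ "{s1<..<s2}"]) (auto intro!: ennreal_leI)
  qed
  have [measurable]: "f \<in> borel_measurable borel"
    using lip by (intro borel_measurable_continuous_onI lipschitz_on_continuous_on[where L = 1] lipschitz_onI)
      (auto simp: dist_real_def)
  have meas: "?A f \<in> sets lborel" by measurable
  consider "dyadic_ramp j (f 0) = dyadic_ramp j (f L)" | "dyadic_ramp j (f 0) < dyadic_ramp j (f L)"
    | "dyadic_ramp j (f L) < dyadic_ramp j (f 0)" by linarith
  then show ?thesis
  proof cases
    case 2
    then obtain I where I: "I \<subseteq> ?A f" "ennreal (2 ^ j * (dyadic_ramp j (f L) - dyadic_ramp j (f 0))) \<le> emeasure lborel I"
      using up[OF lip] by blast
    have le: "emeasure lborel I \<le> emeasure lborel (?A f)" by (rule emeasure_mono[OF I(1) meas])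
    have eq: "\<bar>dyadic_ramp j (f 0) - dyadic_ramp j (f L)\<bar> = dyadic_ramp j (f L) - dyadic_ramp j (f 0)"
      using 2 by simp
    show ?thesis unfolding eq by (rule order_trans[OF I(2) le])
  next
    case 3
    let ?f = "\<lambda>s. f (L - s)"
    have lip': "\<bar>?f s - ?f t\<bar> \<le> \<bar>s - t\<bar>" for s t using lip[of "L - s" "L - t"] by simp
    obtain I where I: "I \<subseteq> ?A ?f" "I \<in> sets lborel"
      "ennreal (2 ^ j * (dyadic_ramp j (?f L) - dyadic_ramp j (?f 0))) \<le> emeasure lborel I"
      using up[of ?f, OF lip'] 3 by auto
    have "emeasure lborel I \<le> emeasure lborel (?A ?f)" by (rule emeasure_mono[OF I(1)]) measurable
    also have "\<dots> = emeasure lborel (?A f)"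
    proof -
      have "emeasure lborel (?A f) = (\<integral>\<^sup>+ s. indicator (?A f) s \<partial>lborel)" using meas by simp
      also have "\<dots> = (\<integral>\<^sup>+ s. indicator (?A f) (L + (-1) * s) \<partial>lborel)"
        using meas by (subst nn_integral_real_affine[where c = "-1" and t = L]) auto
      also have "\<dots> = (\<integral>\<^sup>+ s. indicator (?A ?f) s \<partial>lborel)"
        by (intro nn_integral_cong) (auto simp: indicator_def)
      also have "\<dots> = emeasure lborel (?A ?f)" by (rule nn_integral_indicator) measurable
      finally show ?thesis by simp
    qed
    finally have le: "emeasure lborel I \<le> emeasure lborel (?A f)" .
    have eq: "\<bar>dyadic_ramp j (f 0) - dyadic_ramp j (f L)\<bar> = dyadic_ramp j (?f L) - dyadic_ramp j (?f 0)"
      using 3 by simp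
    show ?thesis unfolding eq by (rule order_trans[OF I(3) le])
  qed simp
qed

lemma disjoint_dyadic_annuli: "disjoint_family (dyadic_annulus w)"
  unfolding disjoint_family_on_def
proof (intro ballI impI)
  fix i j :: nat assume "i \<noteq> j"
  have *: "dyadic_annulus w i \<inter> dyadic_annulus w j = {}" if "i < j" for i j
    using power_increasing[of "Suc i" j "2::real"] that by (auto simp: dyadic_annulus_def)
  show "dyadic_annulus w i \<inter> dyadic_annulus w j = {}"
    using *[of i j] *[of j i] \<open>i \<noteq> j\<close> by (cases "i < j") auto
qed

text \<open>Only finitely many ramps matter on a given curve, and each contributes its slope times the length
  of the part of the curve in its annulus. The sine keeps the upper gradient.\<close>

lemma upper_gradient_sin_radial:
  fixes w :: "'a::metric_space"
  assumes a: "\<And>j. 0 \<le> a j"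
  shows "upper_gradient (\<lambda>x. \<Sum>j. ennreal (a j / 2 ^ j) * indicator (dyadic_annulus w j) x)
    (\<lambda>x. sin (radial_profile a (dist w x)))"
  unfolding upper_gradient_def
proof (intro conjI allI impI; (elim conjE)?)
  have [measurable]: "dyadic_annulus w j \<in> sets borel" for j by (auto simp: dyadic_annulus_def)
  show meas: "(\<lambda>x. \<Sum>j. ennreal (a j / 2 ^ j) * indicator (dyadic_annulus w j) x) \<in> borel_measurable borel"
    by measurable
  fix \<alpha> \<beta> \<gamma> assume "is_curve ({\<alpha>..\<beta>}, \<gamma> :: real \<Rightarrow> 'a)" "curve_length {\<alpha>..\<beta>} \<gamma> < \<infinity>"
  then interpret rectifiable_curve \<alpha> \<beta> \<gamma> by (rule rectifiable_curve_of_is_curve)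
  let ?\<rho> = "\<lambda>x. \<Sum>j. ennreal (a j / 2 ^ j) * indicator (dyadic_annulus w j) x :: ennreal"
  define L where "L = len \<beta>"
  define f where "f s = dist w (clamped_arc s)" for s
  have L: "0 \<le> L" by (simp add: L_def)
  have lip: "\<bar>f s - f t\<bar> \<le> \<bar>s - t\<bar>" for s t
    using dist_clamped_arc_le[of s t] dist_triangle[of w "clamped_arc s" "clamped_arc t"]
      dist_triangle[of w "clamped_arc t" "clamped_arc s"]
    by (simp add: f_def dist_commute)
  have ends: "f 0 = dist w (\<gamma> \<alpha>)" "f L = dist w (\<gamma> \<beta>)"
    by (simp_all add: f_def L_def clamped_arc_eq arc_start arc_end)
  obtain n where n: "max (f 0) (f L) < 2 ^ n" using real_arch_pow[of 2 "max (f 0) (f L)"] by auto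
  let ?d = "\<lambda>j. \<bar>dyadic_ramp j (f 0) - dyadic_ramp j (f L)\<bar>"
  have "\<bar>sin (radial_profile a (f 0)) - sin (radial_profile a (f L))\<bar>
      \<le> \<bar>radial_profile a (f 0) - radial_profile a (f L)\<bar>"
  proof -
    let ?x = "radial_profile a (f 0)" and ?y = "radial_profile a (f L)"
    have "\<bar>sin ?x - sin ?y\<bar> = 2 * \<bar>sin ((?x - ?y) / 2)\<bar> * \<bar>cos ((?x + ?y) / 2)\<bar>"
      by (simp add: sin_diff_sin abs_mult)
    also have "\<dots> \<le> 2 * \<bar>(?x - ?y) / 2\<bar> * 1"
      by (intro mult_mono mult_left_mono abs_sin_x_le_abs_x) auto
    finally show ?thesis by simp
  qed
  also have "radial_profile a (f 0) - radial_profile a (f L)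
      = (\<Sum>j<n. a j * (dyadic_ramp j (f 0) - dyadic_ramp j (f L)))"
    using n by (simp add: radial_profile_eq_sum[of _ n] sum_subtractf right_diff_distrib)
  also have "\<bar>\<dots>\<bar> \<le> (\<Sum>j<n. \<bar>a j * (dyadic_ramp j (f 0) - dyadic_ramp j (f L))\<bar>)"
    by (rule sum_abs)
  also have "\<dots> = (\<Sum>j<n. a j / 2 ^ j * (2 ^ j * ?d j))"
    using a by (simp add: abs_mult)
  finally have "ennreal \<bar>sin (radial_profile a (f 0)) - sin (radial_profile a (f L))\<bar>
      \<le> ennreal (\<Sum>j<n. a j / 2 ^ j * (2 ^ j * ?d j))"
    by (rule ennreal_leI)
  also have "\<dots> = (\<Sum>j<n. ennreal (a j / 2 ^ j) * ennreal (2 ^ j * ?d j))"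
    using a by (subst sum_ennreal[symmetric]) (auto simp: ennreal_mult'[symmetric])
  also have "\<dots> \<le> (\<Sum>j<n. ennreal (a j / 2 ^ j) * emeasure lborel {s \<in> {0..L}. 2 ^ j \<le> f s \<and> f s < 2 ^ (j + 1)})"
    by (intro sum_mono mult_left_mono dyadic_ramp_diff_le lip L) auto
  also have "\<dots> = (\<Sum>j<n. \<integral>\<^sup>+ s. ennreal (a j / 2 ^ j) * (indicator (dyadic_annulus w j) (clamped_arc s) * indicator {0..L} s) \<partial>lborel)"
  proof (rule sum.cong)
    fix j
    have "{s \<in> {0..L}. 2 ^ j \<le> f s \<and> f s < 2 ^ (j + 1)} = clamped_arc -` dyadic_annulus w j \<inter> {0..L}"
      by (auto simp: dyadic_annulus_def f_def)
    moreover have "clamped_arc -` dyadic_annulus w j \<in> sets borel"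
      using measurable_sets[OF borel_measurable_clamped_arc, of "dyadic_annulus w j"] by simp
    ultimately show "ennreal (a j / 2 ^ j) * emeasure lborel {s \<in> {0..L}. 2 ^ j \<le> f s \<and> f s < 2 ^ (j + 1)}
      = (\<integral>\<^sup>+ s. ennreal (a j / 2 ^ j) * (indicator (dyadic_annulus w j) (clamped_arc s) * indicator {0..L} s) \<partial>lborel)"
      by (simp add: nn_integral_cmult indicator_inter_arith[symmetric] indicator_vimage[symmetric])
  qed simp
  also have "\<dots> = (\<integral>\<^sup>+ s. (\<Sum>j<n. ennreal (a j / 2 ^ j) * (indicator (dyadic_annulus w j) (clamped_arc s) * indicator {0..L} s)) \<partial>lborel)"
    by (rule nn_integral_sum[symmetric]) measurable
  also have "\<dots> \<le> (\<integral>\<^sup>+ s \<in> {0..L}. ?\<rho> (clamped_arc s) \<partial>lborel)"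
  proof (rule nn_integral_mono)
    fix s
    have "(\<Sum>j<n. ennreal (a j / 2 ^ j) * indicator (dyadic_annulus w j) (clamped_arc s)) \<le> ?\<rho> (clamped_arc s)"
      by (rule sum_le_suminf) auto
    then have "(\<Sum>j<n. ennreal (a j / 2 ^ j) * indicator (dyadic_annulus w j) (clamped_arc s)) * indicator {0..L} s
      \<le> ?\<rho> (clamped_arc s) * indicator {0..L} s" by (rule mult_right_mono) simp
    then show "(\<Sum>j<n. ennreal (a j / 2 ^ j) * (indicator (dyadic_annulus w j) (clamped_arc s) * indicator {0..L} s))
      \<le> ?\<rho> (clamped_arc s) * indicator {0..L} s" by (simp only: sum_distrib_right mult.assoc)
  qed
  finally show "ennreal \<bar>sin (radial_profile a (dist w (\<gamma> \<alpha>))) - sin (radial_profile a (dist w (\<gamma> \<beta>)))\<bar>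
      \<le> line_integral_on \<alpha> \<beta> \<gamma> ?\<rho>"
    by (simp add: line_integral_on_clamped L_def[symmetric] ends)
qed

text \<open>The curve may return to the centre again and again, but its distance from \<open>w\<close> is unbounded on
  every interval \<open>[T, \<infinity>)\<close>. By continuity the profile takes all large values there, and the sine
  oscillates.\<close>

lemma no_limit_sin_radial:
  fixes w :: "'a::metric_space"
  assumes a: "\<And>j. 0 \<le> a j" "\<not> summable a" and \<gamma>: "({0..}, \<gamma>) \<in> infinite_curves"
  shows "\<not> ((\<lambda>t. sin (radial_profile a (dist w (\<gamma> t)))) \<longlongrightarrow> L) at_top"
proof
  let ?h = "\<lambda>t. radial_profile a (dist w (\<gamma> t))"
  assume "((\<lambda>t. sin (?h t)) \<longlongrightarrow> L) at_top"
  then have "\<forall>\<^sub>F t in at_top. dist (sin (?h t)) L < 1 / 2" by (rule tendstoD) simp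
  then obtain T where "\<And>t. T \<le> t \<Longrightarrow> dist (sin (?h t)) L < 1 / 2"
    by (auto simp: eventually_at_top_linorder)
  then have T: "\<And>t. max T 0 \<le> t \<Longrightarrow> dist (sin (?h t)) L < 1 / 2" by simp
  have \<gamma>_cont: "continuous_on {0..} \<gamma>" and unbounded: "\<And>x r. \<not> \<gamma> ` {0..} \<subseteq> ball x r"
    using \<gamma> by (auto simp: infinite_curves_def locally_rectifiable_def is_curve_def)
  have h_cont: "continuous_on {0..} ?h"
    by (intro continuous_on_compose2[OF continuous_on_radial_profile[of UNIV]] continuous_intros \<gamma>_cont) auto
  have large: "\<exists>t\<ge>max T 0. B \<le> ?h t" for B
  proof -
    obtain r where r: "\<And>s. r \<le> s \<Longrightarrow> B \<le> radial_profile a s"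
      using radial_profile_unbounded[OF a] by blast
    have "compact (\<gamma> ` {0..max T 0})"
      by (intro compact_continuous_image continuous_on_subset[OF \<gamma>_cont]) auto
    then obtain r' where "\<gamma> ` {0..max T 0} \<subseteq> ball w r'"
      using bounded_subset_ballD[OF compact_imp_bounded] by metis
    then have "\<gamma> t \<in> ball w r'" if "t \<in> {0..max T 0}" for t using that by blast
    then have r': "dist w (\<gamma> t) < r'" if "t \<in> {0..max T 0}" for t using that by simp
    obtain t where t: "0 \<le> t" "max r r' \<le> dist w (\<gamma> t)"
      using unbounded[of w "max r r'"] by (auto simp: image_subset_iff not_less)
    have "max T 0 \<le> t" using r'[of t] t by force
    then show ?thesis using r t by auto
  qed
  have hit: "\<exists>t\<ge>max T 0. ?h t = v" if v: "?h (max T 0) \<le> v" for v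
  proof -
    obtain t where t: "t \<ge> max T 0" "v \<le> ?h t" using large by blast
    have "continuous_on {max T 0..t} ?h" by (rule continuous_on_subset[OF h_cont]) auto
    then show ?thesis using IVT'[of ?h "max T 0" v t] v t by auto
  qed
  obtain k :: nat where k: "?h (max T 0) < real k * (2 * pi)"
    using reals_Archimedean3[of "2 * pi"] by auto
  have "?h (max T 0) \<le> real k * (2 * pi) + pi / 2" "?h (max T 0) \<le> real k * (2 * pi) + 3 / 2 * pi"
    using k pi_gt_zero by linarith+
  from hit[OF this(1)] hit[OF this(2)] obtain t1 t2
    where t1: "t1 \<ge> max T 0" "?h t1 = real k * (2 * pi) + pi / 2"
      and t2: "t2 \<ge> max T 0" "?h t2 = real k * (2 * pi) + 3 / 2 * pi"
    by blast
  have sin_per: "sin (real k * (2 * pi) + y) = sin y" for k :: nat and y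
  proof (induction k)
    case (Suc k)
    have "sin (real (Suc k) * (2 * pi) + y) = sin (real k * (2 * pi) + y + 2 * pi)"
      by (simp add: algebra_simps)
    then show ?case using Suc by (simp only: sin_periodic)
  qed simp
  have "sin (?h t1) = 1" unfolding t1(2) sin_per by simp
  moreover have "sin (?h t2) = - 1" unfolding t2(2) sin_per by (rule sin_3over2_pi)
  ultimately show False using T[OF t1(1)] T[OF t2(1)] unfolding dist_real_def by linarith
qed

context annular_space
begin

text \<open>A point beyond the annulus would, by the absence of empty shells, come with a ball inside the
  annulus, which has positive measure. So a null annulus makes the space bounded.\<close>

lemma infinite_curves_empty_of_null_annulus:
  assumes "measure M (dyadic_annulus w j) = 0"
  shows "infinite_curves = ({} :: 'a curve set)"
proof -
  have "dist w y < 2 ^ (j + 1)" for y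
  proof (rule ccontr)
    assume "\<not> dist w y < 2 ^ (j + 1)"
    moreover have "(7 / 4 :: real) * 2 ^ j \<le> 2 ^ (j + 1)" by simp
    ultimately have "7 / 4 * 2 ^ j \<le> dist w y" by linarith
    then obtain z where z: "5 / 4 * 2 ^ j \<le> dist w z" "dist w z < 7 / 4 * 2 ^ j"
      using exists_point_in_shell[of "5 / 4 * 2 ^ j" "7 / 4 * 2 ^ j" w y] by auto
    have sub: "ball z (2 ^ j / 4) \<subseteq> dyadic_annulus w j"
    proof
      fix x assume "x \<in> ball z (2 ^ j / 4)"
      then show "x \<in> dyadic_annulus w j"
        using z dist_triangle[of w x z] dist_triangle[of w z x] by (simp add: dyadic_annulus_def dist_commute)
    qed
    have "0 < measure M (ball z (2 ^ j / 4))" by (intro measure_ball_pos) simp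
    also have "\<dots> \<le> measure M (dyadic_annulus w j)"
      using sub by (intro measure_mono_fmeasurable bounded_fmeasurable[OF dyadic_annulus_borel, of w j w "2 ^ (j + 1)"])
        (auto simp: dyadic_annulus_def)
    finally show False using assms by simp
  qed
  then have "\<gamma> ` {0..} \<subseteq> ball w (2 ^ (j + 1))" for \<gamma> :: "real \<Rightarrow> 'a" by auto
  then show ?thesis unfolding infinite_curves_def by blast
qed

text \<open>The sine of the radial profile with slopes \<open>a\<^sub>j / 2\<^sup>j\<close> has an upper gradient whose energy is the sum
  of \<open>(a\<^sub>j / b\<^sub>j)\<^sup>p\<close>, where \<open>b\<close> are the dyadic weights, and the profile is unbounded if the sum of the
  \<open>a\<^sub>j\<close> diverges. If some annulus is null there are no infinite curves, and any function will do.\<close>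

lemma exists_dirichlet_function_without_limits:
  assumes R: "Rp p M w = \<infinity>"
  shows "\<exists>u\<in>dirichlet_space p M. \<forall>\<gamma> L. ({0..}, \<gamma>) \<in> infinite_curves \<longrightarrow> \<not> ((\<lambda>t. u (\<gamma> t)) \<longlongrightarrow> L) at_top"
proof (cases "\<exists>j. measure M (dyadic_annulus w j) = 0")
  case True
  then have "infinite_curves = ({} :: 'a curve set)" using infinite_curves_empty_of_null_annulus by blast
  moreover have "(\<lambda>_. 0) \<in> dirichlet_space p M"
    using p by (auto simp: dirichlet_space_def locally_integrable_def set_integrable_def upper_gradient_def
        intro!: exI[of _ 1] exI[of _ "\<lambda>_. 0"])
  ultimately show ?thesis by blast
next
  case False
  then have pos: "0 < measure M (dyadic_annulus w j)" for j
    using measure_nonneg[of M "dyadic_annulus w j"] by (metis order_le_less)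
  let ?b = "dyadic_weight p M w"
  have b: "0 < ?b j" for j using pos[of j] by (simp add: dyadic_weight_def)
  note Req = Rp_eq_dyadic_weights[OF p pos]
  have "if p = 1 then \<not> bdd_above (range ?b) else \<not> summable (\<lambda>j. ?b j powr (p / (p - 1)))"
  proof (cases "p = 1")
    case True
    have "\<not> bdd_above (range ?b)"
    proof
      assume "bdd_above (range ?b)"
      then obtain B where "\<And>j. ?b j \<le> B" by (auto simp: bdd_above_def)
      then have "Rp p M w \<le> ennreal B" unfolding Req using True by (auto intro!: SUP_least ennreal_leI)
      then show False using R by (simp add: top_unique)
    qed
    then show ?thesis using True by simp
  next
    case False
    have "\<not> summable (\<lambda>j. ?b j powr (p / (p - 1)))"
    proof
      assume "summable (\<lambda>j. ?b j powr (p / (p - 1)))"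
      then have "(\<Sum>j. ennreal (?b j powr (p / (p - 1)))) = ennreal (\<Sum>j. ?b j powr (p / (p - 1)))"
        by (intro suminf_ennreal2) auto
      then show False using R False unfolding Req by simp
    qed
    then show ?thesis using False by simp
  qed
  note div = this
  obtain a where a: "\<And>j. 0 \<le> a j" "\<not> summable a" "summable (\<lambda>j. (a j / ?b j) powr p)"
    by (rule exists_divergent_pairing[OF b p div], rule that)
  define u where "u x = sin (radial_profile a (dist w x))" for x
  define \<rho> :: "'a \<Rightarrow> ennreal" where "\<rho> x = (\<Sum>j. ennreal (a j / 2 ^ j) * indicator (dyadic_annulus w j) x)" for x
  have ug: "upper_gradient \<rho> u"
    using upper_gradient_sin_radial[where a = a and w = w, OF a(1)] by (simp add: \<rho>_def[abs_def] u_def[abs_def])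
  have \<rho>_powr: "\<rho> x epowr p = (\<Sum>j. ennreal ((a j / 2 ^ j) powr p) * indicator (dyadic_annulus w j) x)" for x
  proof (cases "\<exists>j. x \<in> dyadic_annulus w j")
    case True
    then obtain j where j: "x \<in> dyadic_annulus w j" by blast
    show ?thesis
      using p a(1)[of j] unfolding \<rho>_def suminf_cmult_indicator[OF disjoint_dyadic_annuli j]
      by (simp add: ennreal_epowr)
  next
    case False
    then show ?thesis using p by (simp add: \<rho>_def)
  qed
  have annulus: "dyadic_annulus w j \<in> sets M" for j using dyadic_annulus_borel by (simp add: sets_M)
  have "(\<integral>\<^sup>+ x. \<rho> x epowr p \<partial>M)
      = (\<integral>\<^sup>+ x. (\<Sum>j. ennreal ((a j / 2 ^ j) powr p) * indicator (dyadic_annulus w j) x) \<partial>M)"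
    by (intro nn_integral_cong \<rho>_powr)
  also have "\<dots> = (\<Sum>j. \<integral>\<^sup>+ x. ennreal ((a j / 2 ^ j) powr p) * indicator (dyadic_annulus w j) x \<partial>M)"
    using annulus by (intro nn_integral_suminf) simp
  also have "\<dots> = (\<Sum>j. ennreal ((a j / 2 ^ j) powr p) * emeasure M (dyadic_annulus w j))"
    by (intro suminf_cong nn_integral_cmult_indicator annulus)
  also have "\<dots> = (\<Sum>j. ennreal ((a j / ?b j) powr p))"
  proof (rule suminf_cong)
    fix j
    have "(a j / ?b j) powr p = (a j / 2 ^ j) powr p * measure M (dyadic_annulus w j)"
    proof -
      let ?\<mu> = "measure M (dyadic_annulus w j)"
      have eq: "a j / ?b j = a j / 2 ^ j * ?\<mu> powr (1 / p)"
        using pos[of j] by (simp add: dyadic_weight_def powr_minus_divide)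
      show ?thesis
        unfolding eq using p pos[of j] a(1)[of j] by (subst powr_mult) (simp_all add: powr_powr)
    qed
    then show "ennreal ((a j / 2 ^ j) powr p) * emeasure M (dyadic_annulus w j) = ennreal ((a j / ?b j) powr p)"
      by (simp add: emeasure_dyadic_annulus ennreal_mult)
  qed
  also have "\<dots> = ennreal (\<Sum>j. (a j / ?b j) powr p)"
    using a(3) by (intro suminf_ennreal2) auto
  finally have fin: "(\<integral>\<^sup>+ x. \<rho> x epowr p \<partial>M) < \<infinity>" by simp
  have "continuous_on UNIV u"
    unfolding u_def by (intro continuous_intros continuous_on_compose2[OF continuous_on_radial_profile[of UNIV]]) auto
  then have "integrable_on_balls M u"
    by (intro integrable_on_balls_bounded[where K = 1] borel_measurable_continuous_onI) (auto simp: u_def)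
  then have "locally_integrable M u"
    unfolding locally_integrable_def integrable_on_balls_def using zero_less_one by blast
  then have "u \<in> dirichlet_space p M" using ug fin by (auto simp: dirichlet_space_def)
  moreover have "\<not> ((\<lambda>t. u (\<gamma> t)) \<longlongrightarrow> L) at_top" if "({0..}, \<gamma>) \<in> infinite_curves" for \<gamma> L
    using no_limit_sin_radial[OF a(1,2) that] by (simp add: u_def)
  ultimately show ?thesis by blast
qed

end

section \<open>Equivalence of the three conditions\<close>

theorem theorem1p2:
  fixes M :: "'a::metric_space measure" and w :: 'a and p :: real
  assumes "1 \<le> p"
    and "complete (UNIV :: 'a set)"
    and "sets M = sets borel"
    and "doubling_measure M"
    and "poincare_inequality p M"
    and "annular_chain_property w"
  shows "(Rp p M w < \<infinity> \<longleftrightarrow> 0 < modulus p M infinite_curves) \<and>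
         (0 < modulus p M infinite_curves \<longleftrightarrow>
            (\<forall>u \<in> dirichlet_space p M. \<exists>(I, \<gamma>) \<in> infinite_curves.
               \<exists>L::real. ((\<lambda>t. u (\<gamma> t)) \<longlongrightarrow> L) at_top))"
proof -
  interpret annular_space M p w by unfold_locales (use assms in auto)
  have infinite_curve_domain: "I = {0..}" if "(I, \<gamma>) \<in> infinite_curves" for I and \<gamma> :: "real \<Rightarrow> 'a"
    using that by (simp add: infinite_curves_def)
  let ?III = "\<forall>u \<in> dirichlet_space p M. \<exists>(I, \<gamma>) \<in> infinite_curves.
               \<exists>L::real. ((\<lambda>t. u (\<gamma> t)) \<longlongrightarrow> L) at_top"
  have "0 < modulus p M infinite_curves" if "Rp p M w < \<infinity>"
    using modulus_pos_of_Rp_finite assms(2) that .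
  moreover have ?III if mod: "0 < modulus p M infinite_curves"
  proof
    fix u assume "u \<in> dirichlet_space p M"
    then obtain \<rho> where \<rho>: "upper_gradient \<rho> u" "(\<integral>\<^sup>+ x. \<rho> x epowr p \<partial>M) < \<infinity>"
      by (auto simp: dirichlet_space_def)
    then have "\<rho> \<in> borel_measurable borel" by (simp add: upper_gradient_def)
    moreover have "0 < p" using p by simp
    ultimately obtain \<gamma> where "({0..}, \<gamma>) \<in> infinite_curves" "line_integral ({0..}, \<gamma>) \<rho> < \<infinity>"
      using exists_curve_finite_line_integral[OF sets_M _ mod _ \<rho>(2)] by blast
    then show "\<exists>(I, \<gamma>) \<in> infinite_curves. \<exists>L::real. ((\<lambda>t. u (\<gamma> t)) \<longlongrightarrow> L) at_top"
      using limit_along_curve_of_finite_line_integral[OF _ _ \<rho>(1)] by blast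
  qed
  moreover have "Rp p M w < \<infinity>" if III: ?III
  proof (rule ccontr)
    assume "\<not> Rp p M w < \<infinity>"
    then have "Rp p M w = \<infinity>" using less_top[of "Rp p M w"] by auto
    then obtain u where "u \<in> dirichlet_space p M"
      "\<And>\<gamma> L. ({0..}, \<gamma>) \<in> infinite_curves \<Longrightarrow> \<not> ((\<lambda>t. u (\<gamma> t)) \<longlongrightarrow> L) at_top"
      using exists_dirichlet_function_without_limits by blast
    then show False using III infinite_curve_domain by blast
  qed
  ultimately show ?thesis by blast
qed

end
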